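(* Let $(x,\Phi)$ be a minimizer of the Crisanti–Sommers functional $\mathscr C$ with constraint $Q$, and let $\mu_P$ be the measure with $\mu_P([0,t])=x(t)$. If $(a,b)\subseteq\mathrm{supp}\,\mu_P$ with $0\le a<b<m$, then $$\mu_P([0,u])=\frac{\langle\xi'''(\Phi(u)),\Phi'(u)^{\circ3}\rangle}{2\,\mathrm{Trace}\Big(\big(\Phi'(u)^{\frac12}\,(\xi''(\Phi(u))\odot\Phi'(u))\,\Phi'(u)^{\frac12}\big)^{\frac32}\Big)}$$ for all $u\in(a,b)$.
   Context: Fix $m\ge1$. For each $p\ge2$ let $\vec\beta_p\in\mathbb R^m$, with $\vec\beta_p=0$ for odd $p$ and $\sum_{p\ge2}2^p\vec\beta_p(j)^2<\infty$ for every $1\le j\le m$; let $\vec h\in\mathbb R^m$. (The inverse temperature is absorbed into $\xi$ and $\vec h$.) $\odot$ is the entrywise product, $A^{\circ p}$ the entrywise $p$-th power, $\langle\cdot,\cdot\rangle$ the Frobenius inner product, $|A|$ the determinant. $\vec\beta_p\otimes\vec\beta_p=(\vec\beta_p(i)\vec\beta_p(j))_{i,j}$, $\xi(A)=\sum_p(\vec\beta_p\otimes\vec\beta_p)\odot A^{\circ p}$, and $\xi'(A)=\sum_pp(\vec\beta_p\otimes\vec\beta_p)\odot A^{\circ(p-1)}$, $\xi''(A)=\sum_pp(p-1)(\vec\beta_p\otimes\vec\beta_p)\odot A^{\circ(p-2)}$, $\xi'''(A)=\sum_{p\ge3}p(p-1)(p-2)(\vec\beta_p\otimes\vec\beta_p)\odot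 A^{\circ(p-3)}$. $\mathbb S^m_+$ is the set of symmetric positive semidefinite $m\times m$ matrices. $Q\in\mathbb S^m_+$ has entries in $[-1,1]$ and diagonal entries $1$. Admissible pairs $(x,\Phi)$: $x:[0,m]\to[0,1]$ is right-continuous and nondecreasing with $x(0^-)=0$, $x(m)=1$, with associated probability measure $\mu_P([0,t])=x(t)$; $\Phi\in\mathscr M$, i.e. $\Phi:[0,m]\to\mathbb S^m_+$ is a continuously differentiable, Lipschitz, monotone (Loewner-nondecreasing) path with Lipschitz derivative, $\Phi(0)=0$, $\Phi(m)=Q$, and $\mathrm{Trace}(\Phi(t))=t$ for $t\in\mathrm{supp}\,\mu_P$; and $|Q-\Phi(t_x)|>0$ where $t_x=\inf\{t:x(t)=1\}$. Put $\hat\Phi(t)=\int_t^mx(s)\Phi'(s)ds$. For $\hat T\in(t_x,m)$ with $|Q-\Phi(\hat T)|>0$ (the value does not depend on $\hat T$), $$\mathscr C(x,\Phi)=\tfrac12\Big[\int_0^mx(t)\langle\xi'(\Phi(t))+\vec h\vec h^T,\Phi'(t)\rangle dt+\log|\Phi(m)-\Phi(\hat T)|+\int_0^{\hat T}\langle\hat\Phi(t)^{-1},\Phi'(t)\rangle dt\Big].$$ A minimizer is a pair minimizing $\mathscr C$ over all admissible pairs. *)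

theory Defs
  imports "HOL-Analysis.Analysis"
begin

text \<open>The number \<open>m\<close> of coordinates is \<open>CARD('m)\<close>. The inner product \<open>\<bullet>\<close> of the type
  \<open>real^'m^'m\<close> is the Frobenius inner product.\<close>

definition outer :: "real^'m \<Rightarrow> real^'m \<Rightarrow> real^'m^'m" (infixl "\<otimes>" 75)
  where "u \<otimes> v = (\<chi> i j. u $ i * v $ j)"

definition hadamard :: "real^'m^'m \<Rightarrow> real^'m^'m \<Rightarrow> real^'m^'m" (infixl "\<odot>" 70)
  where "A \<odot> B = (\<chi> i j. A $ i $ j * B $ i $ j)"

text \<open>Entries \<open>0 ^ 0\<close> are \<open>1\<close>, so the zeroth entrywise power is the all-ones matrix.\<close>

definition hadamard_power :: "real^'m^'m \<Rightarrow> nat \<Rightarrow> real^'m^'m" (infixr "\<circ>^" 80)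
  where "A \<circ>^ p = (\<chi> i j. (A $ i $ j) ^ p)"

definition psd :: "(real^'m^'m) set"
  where "psd = {A. transpose A = A \<and> (\<forall>v. 0 \<le> v \<bullet> (A *v v))}"

definition loewner_le :: "real^'m^'m \<Rightarrow> real^'m^'m \<Rightarrow> bool"
  where "loewner_le A B \<longleftrightarrow> B - A \<in> psd"

definition diag_matrix :: "real^'m \<Rightarrow> real^'m^'m"
  where "diag_matrix d = (\<chi> i j. if i = j then d $ i else 0)"

text \<open>Real powers of a positive semidefinite matrix by spectral calculus. The result does not
  depend on the diagonalization; \<open>0 powr r = 0\<close>, so for \<open>r > 0\<close> singular matrices cause
  no problem.\<close>

definition psd_powr :: "real^'m^'m \<Rightarrow> real \<Rightarrow> real^'m^'m"
  where "psd_powr A r = (THE B. \<exists>P d. orthogonal_matrix P \<and> (\<forall>i. 0 \<le> d $ i) \<and>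
    A = P ** diag_matrix d ** transpose P \<and>
    B = P ** diag_matrix (\<chi> i. (d $ i) powr r) ** transpose P)"

definition mixture :: "(nat \<Rightarrow> real^'m) \<Rightarrow> bool"
  where "mixture \<beta> \<longleftrightarrow> (\<forall>p\<ge>2. odd p \<longrightarrow> \<beta> p = 0) \<and>
    (\<forall>j. (\<lambda>p. 2 ^ p * (\<beta> p $ j)\<^sup>2) summable_on {2..})"

definition xi1 :: "(nat \<Rightarrow> real^'m) \<Rightarrow> real^'m^'m \<Rightarrow> real^'m^'m"
  where "xi1 \<beta> A = (\<Sum>\<^sub>\<infinity>p\<in>{2..}. real p *\<^sub>R ((\<beta> p \<otimes> \<beta> p) \<odot> A \<circ>^ (p - 1)))"

definition xi2 :: "(nat \<Rightarrow> real^'m) \<Rightarrow> real^'m^'m \<Rightarrow> real^'m^'m"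
  where "xi2 \<beta> A = (\<Sum>\<^sub>\<infinity>p\<in>{2..}.
    (real p * (real p - 1)) *\<^sub>R ((\<beta> p \<otimes> \<beta> p) \<odot> A \<circ>^ (p - 2)))"

definition xi3 :: "(nat \<Rightarrow> real^'m) \<Rightarrow> real^'m^'m \<Rightarrow> real^'m^'m"
  where "xi3 \<beta> A = (\<Sum>\<^sub>\<infinity>p\<in>{3..}.
    (real p * (real p - 1) * (real p - 2)) *\<^sub>R ((\<beta> p \<otimes> \<beta> p) \<odot> A \<circ>^ (p - 3)))"

definition constraint_matrix :: "real^'m^'m \<Rightarrow> bool"
  where "constraint_matrix Q \<longleftrightarrow> Q \<in> psd \<and> (\<forall>i j. Q $ i $ j \<in> {-1..1}) \<and> (\<forall>i. Q $ i $ i = 1)"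

text \<open>Functions on \<open>[0,m]\<close> are total functions of which only the values on \<open>[0,m]\<close> matter.
  In \<open>order_fun\<close>, \<open>order_measure\<close> and \<open>order_top\<close> the real number \<open>m\<close> is the right end point.\<close>

definition order_fun :: "real \<Rightarrow> (real \<Rightarrow> real) \<Rightarrow> bool"
  where "order_fun m x \<longleftrightarrow> x ` {0..m} \<subseteq> {0..1} \<and> mono_on {0..m} x \<and>
    (\<forall>t\<in>{0..<m}. continuous (at_right t) x) \<and> x m = 1"

text \<open>The convention \<open>x(0\<^sup>-) = 0\<close> means that the measure has an atom of mass \<open>x 0\<close> at \<open>0\<close>; it is
  realized by extending the distribution function by \<open>0\<close> to the left of \<open>0\<close>.\<close>

definition order_measure :: "real \<Rightarrow> (real \<Rightarrow> real) \<Rightarrow> real measure"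
  where "order_measure m x =
    interval_measure (\<lambda>t. if t < 0 then 0 else if t \<le> m then x t else 1)"

lemma emeasure_order_measure:
  assumes x: "order_fun m x" and u: "u \<in> {0..m}"
  shows "emeasure (order_measure m x) {0..u} = ennreal (x u)"
    and "emeasure (order_measure m x) (- {0..m}) = 0"
proof -
  define F where "F = (\<lambda>t. if t < 0 then 0 else if t \<le> m then x t else (1::real))"
  have m: "0 \<le> m" using u by simp
  have rng: "0 \<le> x t" "x t \<le> 1" if "t \<in> {0..m}" for t
    using x that by (auto simp: order_fun_def image_subset_iff)
  have mon: "x s \<le> x t" if "s \<in> {0..m}" "t \<in> {0..m}" "s \<le> t" for s t
    using x that by (auto simp: order_fun_def mono_on_def)
  have mono: "F s \<le> F t" if "s \<le> t" for s t
    using that rng mon by (auto simp: F_def)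
  have rc: "continuous (at_right t) F" for t
  proof -
    consider "t < 0" | "t \<in> {0..<m}" | "m \<le> t" "0 \<le> t" by force
    then show ?thesis
    proof cases
      case 1
      have "eventually (\<lambda>s. s < 0) (at_right t)"
        using 1 eventually_at_right_field by blast
      then have "eventually (\<lambda>s. F s = 0) (at_right t)"
        by eventually_elim (simp add: F_def)
      then show ?thesis using 1
        by (auto simp: continuous_within F_def intro: tendsto_eventually)
    next
      case 2
      then have "(x \<longlongrightarrow> x t) (at_right t)"
        using x by (auto simp: order_fun_def continuous_within)
      moreover have "eventually (\<lambda>s. t < s \<and> s < m) (at_right t)"
        using 2 by (auto simp: eventually_at_right_field)
      then have "eventually (\<lambda>s. x s = F s) (at_right t)"
        using 2 by (elim eventually_mono) (auto simp: F_def)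
      ultimately have "(F \<longlongrightarrow> x t) (at_right t)"
        by (rule Lim_transform_eventually)
      then show ?thesis using 2
        by (simp add: continuous_within F_def)
    next
      case 3
      have "eventually (\<lambda>s. t < s) (at_right t)"
        by (auto simp: eventually_at_right_field intro: gt_ex)
      then have "eventually (\<lambda>s. F s = 1) (at_right t)"
        using 3 by (elim eventually_mono) (auto simp: F_def)
      moreover have "F t = 1" using 3 x by (auto simp: F_def order_fun_def)
      ultimately show ?thesis
        by (auto simp: continuous_within intro: tendsto_eventually)
    qed
  qed
  have Ioc: "emeasure (interval_measure F) {a<..b} = ennreal (F b - F a)" if "a \<le> b" for a b
    using emeasure_interval_measure_Ioc[OF that, of F] mono rc by blast
  have neg: "emeasure (interval_measure F) {..<0} = 0"
  proof -
    have "{..<0::real} = (\<Union>n. {- real (Suc n) <.. - (1 / real (Suc n))})" (is "_ = ?U")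
    proof safe
      fix t :: real assume t: "t < 0"
      obtain k where k: "- t < real k" using reals_Archimedean2 by blast
      obtain l where l: "inverse (real (Suc l)) < - t" using reals_Archimedean[of "- t"] t by auto
      define n where "n = max k l"
      have "- t < real (Suc n)" using k by (simp add: n_def)
      moreover have "1 / real (Suc n) \<le> 1 / real (Suc l)"
        by (rule divide_left_mono) (auto simp: n_def)
      then have "t \<le> - (1 / real (Suc n))" using l by (simp add: inverse_eq_divide)
      ultimately show "t \<in> ?U" by (intro UN_I[of n]) auto
    next
      fix t n assume "t \<in> {- real (Suc n) <.. - (1 / real (Suc n))}"
      moreover have "0 < 1 / real (Suc n)" by simp
      ultimately show "t < 0" unfolding greaterThanAtMost_iff by linarith
    qed
    moreover have "emeasure (interval_measure F) ?U = 0"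
    proof (rule emeasure_UN_eq_0)
      fix n
      have l: "- real (Suc n) \<le> - (1 / real (Suc n))" by (simp add: field_simps)
      have "- real (Suc n) < 0" "- (1 / real (Suc n)) < 0" by simp_all
      then have "F (- (1 / real (Suc n))) - F (- real (Suc n)) = 0"
        by (simp only: F_def if_True diff_self)
      then show "emeasure (interval_measure F) {- real (Suc n) <.. - (1 / real (Suc n))} = 0"
        using Ioc[OF l] by simp
    qed auto
    ultimately show ?thesis by simp
  qed
  have null: "{..<0} \<in> null_sets (interval_measure F)"
    by (auto simp: null_sets_def neg)
  have "emeasure (interval_measure F) {0..u} = emeasure (interval_measure F) ({0..u} \<union> {..<0})"
    by (simp add: emeasure_Un_null_set null)
  also have "{0..u} \<union> {..<0} = {-1<..u} \<union> {..<0}"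
    using u by auto
  also have "emeasure (interval_measure F) \<dots> = emeasure (interval_measure F) {-1<..u}"
    by (simp add: emeasure_Un_null_set null)
  also have "emeasure (interval_measure F) {-1<..u} = ennreal (x u)"
    using Ioc[of "-1" u] u by (simp add: F_def)
  finally show "emeasure (order_measure m x) {0..u} = ennreal (x u)"
    by (simp add: order_measure_def F_def)
  have "- {0..m} = {..<0} \<union> (\<Union>n. {m <.. m + real n})"
  proof -
    have "\<exists>n. t \<le> m + real n" for t
      using real_arch_simple[of "t - m"] by (auto simp: algebra_simps)
    then show ?thesis using m by (auto simp: not_le)
  qed
  moreover have "emeasure (interval_measure F) ({..<0} \<union> (\<Union>n. {m <.. m + real n})) = 0"
  proof -
    have "emeasure (interval_measure F) {m <.. m + real n} = 0" for n
      using Ioc[of m "m + real n"] m x by (simp add: F_def order_fun_def)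
    then have "(\<Union>n. {m <.. m + real n}) \<in> null_sets (interval_measure F)"
      by (intro null_sets_UN) (auto simp: null_sets_def)
    then show ?thesis
      using null by (metis null_sets.Un null_setsD1)
  qed
  ultimately show "emeasure (order_measure m x) (- {0..m}) = 0"
    by (simp add: order_measure_def F_def)
qed

definition measure_support :: "'a::topological_space measure \<Rightarrow> 'a set"
  where "measure_support M = {t. \<forall>U. open U \<longrightarrow> t \<in> U \<longrightarrow> 0 < emeasure M U}"

definition order_top :: "real \<Rightarrow> (real \<Rightarrow> real) \<Rightarrow> real"
  where "order_top m x = Inf {t\<in>{0..m}. x t = 1}"

definition path_deriv :: "(real \<Rightarrow> real^'m^'m) \<Rightarrow> real \<Rightarrow> real^'m^'m"
  where "path_deriv \<Phi> t = vector_derivative \<Phi> (at t within {0..real CARD('m)})"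

definition matrix_path :: "(real \<Rightarrow> real) \<Rightarrow> real^'m^'m \<Rightarrow> (real \<Rightarrow> real^'m^'m) \<Rightarrow> bool"
  where "matrix_path x Q \<Phi> \<longleftrightarrow>
    (\<forall>t\<in>{0..real CARD('m)}. \<Phi> t \<in> psd) \<and>
    (\<forall>t\<in>{0..real CARD('m)}. \<Phi> differentiable (at t within {0..real CARD('m)})) \<and>
    continuous_on {0..real CARD('m)} (path_deriv \<Phi>) \<and>
    (\<exists>L. L-lipschitz_on {0..real CARD('m)} \<Phi>) \<and>
    (\<exists>L. L-lipschitz_on {0..real CARD('m)} (path_deriv \<Phi>)) \<and>
    (\<forall>s\<in>{0..real CARD('m)}. \<forall>t\<in>{0..real CARD('m)}. s \<le> t \<longrightarrow> loewner_le (\<Phi> s) (\<Phi> t)) \<and>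
    \<Phi> 0 = 0 \<and> \<Phi> (real CARD('m)) = Q \<and>
    (\<forall>t\<in>measure_support (order_measure (real CARD('m)) x). trace (\<Phi> t) = t)"

definition admissible :: "real^'m^'m \<Rightarrow> (real \<Rightarrow> real) \<Rightarrow> (real \<Rightarrow> real^'m^'m) \<Rightarrow> bool"
  where "admissible Q x \<Phi> \<longleftrightarrow>
    order_fun (real CARD('m)) x \<and> matrix_path x Q \<Phi> \<and>
    det (Q - \<Phi> (order_top (real CARD('m)) x)) > 0"

definition path_hat :: "(real \<Rightarrow> real) \<Rightarrow> (real \<Rightarrow> real^'m^'m) \<Rightarrow> real \<Rightarrow> real^'m^'m"
  where "path_hat x \<Phi> t = integral {t..real CARD('m)} (\<lambda>s. x s *\<^sub>R path_deriv \<Phi> s)"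

definition crisanti_sommers_at ::
    "(nat \<Rightarrow> real^'m) \<Rightarrow> real^'m \<Rightarrow> real \<Rightarrow> (real \<Rightarrow> real) \<Rightarrow> (real \<Rightarrow> real^'m^'m) \<Rightarrow> real"
  where "crisanti_sommers_at \<beta> h T x \<Phi> = 1/2 *
    (integral {0..real CARD('m)} (\<lambda>t. x t * ((xi1 \<beta> (\<Phi> t) + h \<otimes> h) \<bullet> path_deriv \<Phi> t))
     + ln (det (\<Phi> (real CARD('m)) - \<Phi> T))
     + integral {0..T} (\<lambda>t. matrix_inv (path_hat x \<Phi> t) \<bullet> path_deriv \<Phi> t))"

text \<open>For admissible pairs the value does not depend on the choice of the truncation point.\<close>

definition crisanti_sommers ::
    "(nat \<Rightarrow> real^'m) \<Rightarrow> real^'m \<Rightarrow> (real \<Rightarrow> real) \<Rightarrow> (real \<Rightarrow> real^'m^'m) \<Rightarrow> real"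
  where "crisanti_sommers \<beta> h x \<Phi> = crisanti_sommers_at \<beta> h
    (SOME T. order_top (real CARD('m)) x < T \<and> T < real CARD('m) \<and>
       det (\<Phi> (real CARD('m)) - \<Phi> T) > 0) x \<Phi>"

definition crisanti_sommers_minimizer ::
    "(nat \<Rightarrow> real^'m) \<Rightarrow> real^'m \<Rightarrow> real^'m^'m \<Rightarrow> (real \<Rightarrow> real) \<Rightarrow> (real \<Rightarrow> real^'m^'m) \<Rightarrow> bool"
  where "crisanti_sommers_minimizer \<beta> h Q x \<Phi> \<longleftrightarrow> admissible Q x \<Phi> \<and>
    (\<forall>y \<Psi>. admissible Q y \<Psi> \<longrightarrow> crisanti_sommers \<beta> h x \<Phi> \<le> crisanti_sommers \<beta> h y \<Psi>)"

end

theory Submission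
  imports Defs
begin

text \<open>Write \<open>\<phi> = \<Phi>'\<close>, let \<open>hat\<close> be the path \<open>\<integral>\<^sub>t x \<phi>\<close> and \<open>X\<close> its inverse. The variational derivative of
  the functional in the direction of a perturbation of \<open>\<Phi>\<close> is given by
  \<open>D = \<xi>'(\<Phi>) + h \<otimes> h - \<integral>\<^sub>0 X \<phi> X\<close>. The trace constraint does not restrict the perturbation, because
  the functional is invariant under a change of time; the monotonicity constraint does, since \<open>\<phi>\<close> may
  be singular. The direction \<open>hat D hat\<close> is feasible, however: its derivative is
  \<open>hat (\<xi>''(\<Phi>) \<odot> \<phi>) hat - \<phi> - x (\<phi> D hat + hat D \<phi>)\<close>, where the first term is positive semidefinite by
  the Schur product theorem and the others preserve positivity to first order, as they rescale \<open>\<phi>\<close> and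
  transform it by congruence. Minimality then gives \<open>\<integral> D \<bullet> (hat D hat) d\<mu> \<le> 0\<close> up to the contribution
  of the atom at \<open>0\<close>, hence \<open>D = 0\<close> on the interval, and differentiating, \<open>\<xi>''(\<Phi>) \<odot> \<phi> = X \<phi> X\<close>.
  Comparing this identity at \<open>u\<close> and \<open>v\<close> and letting \<open>v\<close> decrease to \<open>u\<close> expresses \<open>\<xi>'''(\<Phi>) \<bullet> \<phi> \<circ>^ 3\<close> as
  \<open>2 x\<close> times the trace of the cube of \<open>X \<phi>\<close>. With \<open>R\<close> the square root of \<open>\<phi>\<close> one has
  \<open>R (\<xi>''(\<Phi>) \<odot> \<phi>) R = (R X R)\<^sup>2\<close>, so the power \<open>3/2\<close> in the formula is the cube of \<open>R X R\<close>.\<close>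

subsection \<open>Matrices and the Frobenius inner product\<close>

lemma norm_matrix_mult_le:
  fixes A :: "real^'n^'m" and B :: "real^'k^'n"
  shows "norm (A ** B) \<le> norm A * norm B"
proof -
  have row: "norm ((A ** B) $ i) \<le> norm (A $ i) * norm B" for i
  proof -
    have "(A ** B) $ i = (\<Sum>k\<in>UNIV. A $ i $ k *\<^sub>R B $ k)"
      by (simp add: matrix_matrix_mult_def vec_eq_iff)
    then have "norm ((A ** B) $ i) \<le> (\<Sum>k\<in>UNIV. \<bar>A $ i $ k\<bar> * norm (B $ k))"
      by (simp only:) (rule order.trans[OF norm_sum], simp)
    also have "\<dots> \<le> L2_set (\<lambda>k. A $ i $ k) UNIV * L2_set (\<lambda>k. norm (B $ k)) UNIV"
      using L2_set_mult_ineq[of "\<lambda>k. A $ i $ k" "\<lambda>k. norm (B $ k)" UNIV] by simp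
    also have "\<dots> = norm (A $ i) * norm B"
      by (simp add: norm_vec_def L2_set_def)
    finally show ?thesis .
  qed
  have "norm (A ** B) \<le> L2_set (\<lambda>i. norm (A $ i) * norm B) UNIV"
    unfolding norm_vec_def[of "A ** B"] by (rule L2_set_mono) (auto simp: row)
  also have "\<dots> = norm A * norm B"
    by (simp add: norm_vec_def[of A] L2_set_left_distrib)
  finally show ?thesis .
qed

lemma bounded_bilinear_matrix_mult:
  "bounded_bilinear ((**) :: real^'n^'m \<Rightarrow> real^'k^'n \<Rightarrow> real^'k^'m)"
proof
  show "\<exists>K. \<forall>(A::real^'n^'m) (B::real^'k^'n). norm (A ** B) \<le> norm A * norm B * K"
    using norm_matrix_mult_le by (intro exI[of _ 1]) auto
qed (auto simp: matrix_matrix_mult_def vec_eq_iff algebra_simps sum.distrib sum_distrib_left)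

interpretation mm: bounded_bilinear "(**) :: real^'n^'m \<Rightarrow> real^'k^'n \<Rightarrow> real^'k^'m"
  by (rule bounded_bilinear_matrix_mult)

lemmas mm_simps = mm.add_left mm.add_right mm.diff_left mm.diff_right mm.scaleR_left mm.scaleR_right
  mm.minus_left mm.minus_right matrix_mul_assoc

lemma bounded_linear_transpose: "bounded_linear (transpose :: real^'n^'m \<Rightarrow> real^'m^'n)"
  by (intro linear_conv_bounded_linear[THEN iffD1] linearI) (auto simp: transpose_def vec_eq_iff)

lemmas transpose_add = linear_add[OF bounded_linear.linear[OF bounded_linear_transpose]]
lemmas transpose_diff = linear_diff[OF bounded_linear.linear[OF bounded_linear_transpose]]
lemmas transpose_scaleR = linear_scale[OF bounded_linear.linear[OF bounded_linear_transpose]]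

lemma bounded_linear_mv: "bounded_linear (\<lambda>A :: real^'n^'m. A *v v)"
  by (intro linear_conv_bounded_linear[THEN iffD1] linearI)
     (auto simp: matrix_vector_mult_add_rdistrib scaleR_matrix_vector_assoc)

lemma bounded_linear_trace: "bounded_linear (trace :: real^'n^'n \<Rightarrow> real)"
  by (intro linear_conv_bounded_linear[THEN iffD1] linearI)
     (auto simp: trace_def sum.distrib sum_distrib_left)

lemma inner_matrix: "(A::real^'n^'m) \<bullet> B = (\<Sum>i\<in>UNIV. \<Sum>j\<in>UNIV. A $ i $ j * B $ i $ j)"
  by (simp add: inner_vec_def)

lemma inner_eq_trace: "(A::real^'n^'m) \<bullet> B = trace (transpose A ** B)"
  unfolding inner_matrix trace_def matrix_matrix_mult_def transpose_def
  by simp (rule sum.swap)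

lemma inner_transpose: "transpose A \<bullet> transpose B = (A::real^'n^'m) \<bullet> B"
  unfolding inner_matrix transpose_def by simp (rule sum.swap)

lemma inner_mult_left: "(A ** B) \<bullet> (C::real^'n^'m) = B \<bullet> (transpose A ** C)"
  by (simp add: inner_eq_trace matrix_transpose_mul matrix_mul_assoc)

lemma inner_mult_right: "(A ** B) \<bullet> (C::real^'n^'m) = A \<bullet> (C ** transpose B)"
  by (simp add: inner_eq_trace matrix_transpose_mul)
     (metis matrix_mul_assoc trace_mul_sym)

lemma inner_mat1: "mat 1 \<bullet> (A::real^'n^'n) = trace A"
  by (simp add: inner_eq_trace)

lemma dot_mv: "(A *v v) \<bullet> w = v \<bullet> (transpose (A::real^'n^'m) *v w)"
  by (simp add: dot_lmul_matrix inner_commute[of "A *v v"] ) (metis dot_lmul_matrix inner_commute transpose_matrix_vector transpose_transpose)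

lemma outer_mv: "(u \<otimes> v) *v w = (v \<bullet> w) *\<^sub>R u"
  by (simp add: outer_def matrix_vector_mult_def vec_eq_iff inner_vec_def sum_distrib_left sum_distrib_right mult_ac)

lemma transpose_outer: "transpose (u \<otimes> v) = v \<otimes> u"
  by (simp add: outer_def transpose_def vec_eq_iff mult.commute)

lemma inner_outer: "(u \<otimes> v) \<bullet> A = u \<bullet> (A *v v)"
  by (simp add: inner_matrix outer_def inner_vec_def matrix_vector_mult_def sum_distrib_left mult_ac)

subsection \<open>Positive semidefinite matrices and the spectral theorem\<close>

lemma psdI: "transpose A = A \<Longrightarrow> (\<And>v. 0 \<le> v \<bullet> (A *v v)) \<Longrightarrow> A \<in> psd"
  by (simp add: psd_def)
lemma psd_sym: "A \<in> psd \<Longrightarrow> transpose A = A" by (simp add: psd_def)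
lemma psd_nonneg: "A \<in> psd \<Longrightarrow> 0 \<le> v \<bullet> (A *v v)" by (simp add: psd_def)

lemma psd_0 [simp]: "0 \<in> psd" by (simp add: psd_def transpose_def vec_eq_iff)
lemma psd_add: "A \<in> psd \<Longrightarrow> B \<in> psd \<Longrightarrow> A + B \<in> psd"
  by (auto simp: psd_def transpose_add matrix_vector_mult_add_rdistrib inner_add_right)
lemma psd_scaleR: "A \<in> psd \<Longrightarrow> 0 \<le> c \<Longrightarrow> c *\<^sub>R A \<in> psd"
  by (auto simp: psd_def transpose_scaleR scaleR_matrix_vector_assoc[symmetric])
lemma psd_sum: "(\<And>i. i \<in> I \<Longrightarrow> A i \<in> psd) \<Longrightarrow> sum A I \<in> psd"
  by (induction I rule: infinite_finite_induct) (auto intro: psd_add)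
lemma psd_outer: "u \<otimes> u \<in> psd"
  by (rule psdI) (auto simp: transpose_outer outer_mv inner_commute)
lemma psd_mat1: "mat 1 \<in> psd" by (rule psdI) auto
lemma psd_congruence: "A \<in> psd \<Longrightarrow> B ** A ** transpose B \<in> psd"
proof (rule psdI)
  assume A: "A \<in> psd"
  show "transpose (B ** A ** transpose B) = B ** A ** transpose B"
    using psd_sym[OF A] by (simp add: matrix_transpose_mul matrix_mul_assoc)
  show "0 \<le> v \<bullet> ((B ** A ** transpose B) *v v)" for v
    using psd_nonneg[OF A, of "transpose B *v v"]
    by (metis dot_mv inner_commute matrix_vector_mul_assoc transpose_transpose)
qed
lemma closed_psd: "closed (psd :: (real^'n^'n) set)"
proof -
  have "psd = {A::real^'n^'n. transpose A = A} \<inter> (\<Inter>v. {A. 0 \<le> v \<bullet> (A *v v)})"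
    by (auto simp: psd_def)
  moreover have "closed {A::real^'n^'n. transpose A = A}"
    by (intro closed_Collect_eq bounded_linear.continuous_on[OF bounded_linear_transpose] continuous_on_id)
  moreover have "closed {A::real^'n^'n. 0 \<le> v \<bullet> (A *v v)}" for v
    by (intro closed_Collect_le continuous_intros bounded_linear.continuous_on[OF bounded_linear_mv])
  ultimately show ?thesis by (metis (no_types, lifting) closed_INT closed_Int)
qed

lemma symmetric_eigenbasis:
  fixes f :: "'a::euclidean_space \<Rightarrow> 'a"
  assumes lin: "linear f" and sym: "\<And>v w. f v \<bullet> w = v \<bullet> f w"
    and V: "subspace V" and inv: "\<And>v. v \<in> V \<Longrightarrow> f v \<in> V"
  shows "\<exists>B. B \<subseteq> V \<and> finite B \<and> card B = dim V \<and> pairwise orthogonal B \<and>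
     (\<forall>v\<in>B. norm v = 1) \<and> (\<forall>v\<in>B. \<exists>c. f v = c *\<^sub>R v)"
  using V inv
proof (induction "dim V" arbitrary: V)
  case 0
  then show ?case by (intro exI[of _ "{}"]) auto
next
  case (Suc k)
  define K where "K = V \<inter> sphere 0 1"
  have "compact K"
    unfolding K_def using closed_subspace[OF Suc.prems(1)] compact_sphere[of "0::'a" 1] by (simp add: closed_Int_compact)
  moreover have "K \<noteq> {}"
  proof -
    have "\<not> V \<subseteq> {0}" using Suc(2) dim_eq_0 by (metis nat.distinct(1))
    then obtain w where w: "w \<in> V" "w \<noteq> 0" by auto
    then have "(1 / norm w) *\<^sub>R w \<in> K"
      unfolding K_def using Suc.prems(1) by (simp add: subspace_scale)
    then show ?thesis by auto
  qed
  moreover have "continuous_on K (\<lambda>v. v \<bullet> f v)"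
    using lin by (intro continuous_intros linear_continuous_on) (simp add: linear_conv_bounded_linear)
  ultimately obtain v where v: "v \<in> K" and max: "\<And>w. w \<in> K \<Longrightarrow> w \<bullet> f w \<le> v \<bullet> f v"
    using continuous_attains_sup[of K "\<lambda>v. v \<bullet> f v"] by auto
  have vV: "v \<in> V" and nv: "norm v = 1" using v by (auto simp: K_def)
  then have vv: "v \<bullet> v = 1" by (simp add: norm_eq_1)
  define c where "c = v \<bullet> f v"
  have le: "w \<bullet> f w \<le> c * (w \<bullet> w)" if "w \<in> V" for w
  proof (cases "w = 0")
    case False
    then have "(1 / norm w) *\<^sub>R w \<in> K"
      unfolding K_def using Suc.prems(1) that by (simp add: subspace_scale)
    from max[OF this] have "(w \<bullet> f w) / (norm w)\<^sup>2 \<le> c"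
      using lin by (simp add: linear_scale c_def power2_eq_square)
    then show ?thesis using False
      by (simp add: divide_le_eq power2_norm_eq_inner)
  qed (simp add: linear_0[OF lin])
  have orth: "w \<bullet> f v = 0" if w: "w \<in> V" "w \<bullet> v = 0" for w
  proof (rule ccontr)
    assume neq: "w \<bullet> f v \<noteq> 0"
    define e where "e = w \<bullet> f w - c * (w \<bullet> w)"
    have "2 * t * (w \<bullet> f v) + t^2 * e \<le> 0" for t
    proof -
      have "v + t *\<^sub>R w \<in> V" using vV w Suc.prems(1) by (simp add: subspace_add subspace_scale)
      from le[OF this] have "v \<bullet> f v + t * (v \<bullet> f w) + t * (w \<bullet> f v) + t * t * (w \<bullet> f w)
          \<le> c * (1 + t * t * (w \<bullet> w))"
        using lin w(2) vv by (simp add: linear_add linear_scale inner_add_left inner_add_right inner_commute[of v w] algebra_simps)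
      moreover have "v \<bullet> f w = w \<bullet> f v" using sym[of v w] by (simp add: inner_commute)
      ultimately show ?thesis unfolding e_def c_def[symmetric]
        by (simp add: power2_eq_square algebra_simps)
    qed
    note * = this
    define s where "s = (w \<bullet> f v)"
    have "e < 0 \<or> e \<ge> 0" by auto
    then obtain t where "2 * t * s + t^2 * e > 0"
    proof
      assume "e \<ge> 0"
      moreover have "0 < s^2" using neq by (simp add: s_def)
      ultimately have "2 * s * s + s^2 * e > 0"
        by (simp add: power2_eq_square add_pos_nonneg)
      then show ?thesis using that by blast
    next
      assume e: "e < 0"
      have "2 * (s/(-e)) * s + (s/(-e))^2 * e = s^2/(-e)" using e
        by (simp add: field_simps power2_eq_square)
      moreover have "\<dots> > 0" using e neq by (intro divide_pos_pos) (auto simp: s_def)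
      ultimately show ?thesis using that by metis
    qed
    with *[of t] show False by (simp add: s_def)
  qed
  have fv: "f v = c *\<^sub>R v"
  proof -
    have "f v - c *\<^sub>R v \<in> V" using Suc.prems vV by (simp add: subspace_diff subspace_scale)
    moreover have "(f v - c *\<^sub>R v) \<bullet> v = 0"
      by (simp add: inner_diff_left vv c_def inner_commute[of "f v"])
    ultimately have "(f v - c *\<^sub>R v) \<bullet> f v = 0" "(f v - c *\<^sub>R v) \<bullet> v = 0" using orth by auto
    then have "(f v - c *\<^sub>R v) \<bullet> (f v - c *\<^sub>R v) = 0" by (simp add: inner_diff_right)
    then show ?thesis by simp
  qed
  define W where "W = {w \<in> V. orthogonal v w}"
  have W: "subspace W"
    using Suc.prems(1) unfolding W_def orthogonal_def subspace_def by (auto simp: inner_add_right)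
  have dimW: "k = dim W"
  proof -
    have "span {v} \<subseteq> V" using vV Suc.prems(1) by (simp add: span_minimal)
    then have "dim {y \<in> V. \<forall>x\<in>span {v}. orthogonal x y} + dim (span {v}) = dim V"
      using dim_subspace_orthogonal_to_vectors[OF subspace_span Suc.prems(1)] by blast
    moreover have "{y \<in> V. \<forall>x\<in>span {v}. orthogonal x y} = W"
      by (auto simp: W_def span_singleton orthogonal_def intro: exI[of _ 1] dest: spec[of _ 1])
    moreover have "v \<noteq> 0" using nv by auto
    then have "dim (span {v}) = 1" by (simp add: dim_singleton)
    ultimately show ?thesis using Suc(2) by simp
  qed
  have "\<And>w. w \<in> W \<Longrightarrow> f w \<in> W"
    unfolding W_def orthogonal_def using Suc.prems(2) by (auto simp: sym[symmetric] fv)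
  from Suc.hyps(1)[OF dimW W this] obtain B where B: "B \<subseteq> W" "finite B" "card B = dim W"
    "pairwise orthogonal B" "\<forall>v\<in>B. norm v = 1" "\<forall>v\<in>B. \<exists>c. f v = c *\<^sub>R v" by auto
  have "v \<notin> B" using B(1) vv by (auto simp: W_def orthogonal_def)
  moreover have "pairwise orthogonal (insert v B)"
    using B(1,4) unfolding pairwise_insert by (auto simp: W_def orthogonal_commute)
  ultimately show ?case
    using B vV nv fv Suc(2) dimW by (intro exI[of _ "insert v B"]) (auto simp: W_def)
qed

lemma diag_matrix_mult: "diag_matrix d ** diag_matrix e = diag_matrix (\<chi> i. d $ i * e $ i)"
  by (auto simp: diag_matrix_def matrix_matrix_mult_def vec_eq_iff if_distrib[of "\<lambda>z. z * _"] cong: if_cong)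

lemma mult_diag_matrix: "(P ** diag_matrix d) $ i $ j = P $ i $ j * d $ j"
  by (simp add: diag_matrix_def matrix_matrix_mult_def if_distrib[of "\<lambda>z. _ * z"] cong: if_cong)

lemma diag_matrix_mult_left: "(diag_matrix d ** P) $ i $ j = d $ i * P $ i $ j"
  by (simp add: diag_matrix_def matrix_matrix_mult_def if_distrib[of "\<lambda>z. z * _"] cong: if_cong)

lemma transpose_diag_matrix: "transpose (diag_matrix d) = diag_matrix d"
  by (auto simp: diag_matrix_def transpose_def vec_eq_iff)

lemma orthogonal_matrixD:
  assumes "orthogonal_matrix P"
  shows "transpose P ** P = mat 1" "P ** transpose P = mat 1"
  using assms by (auto simp: orthogonal_matrix_def)

theorem spectral_theorem:
  fixes A :: "real^'n^'n"
  assumes "transpose A = A"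
  obtains P d where "orthogonal_matrix P" "A = P ** diag_matrix d ** transpose P"
proof -
  have "(A *v v) \<bullet> w = v \<bullet> (A *v w)" for v w
    using dot_mv[of A v w] assms by simp
  then obtain B where B: "finite B" "card B = CARD('n)" "pairwise orthogonal B"
     "\<forall>v\<in>B. norm v = 1" "\<forall>v\<in>B. \<exists>c. A *v v = c *\<^sub>R v"
    using symmetric_eigenbasis[of "(*v) A" UNIV] by auto
  from B(1,2) obtain b where b: "bij_betw b (UNIV::'n set) B"
    by (metis finite_same_card_bij finite)
  define P where "P = (\<chi> i j. b j $ i)"
  have col: "column j P = b j" for j by (simp add: column_def P_def vec_eq_iff)
  have bB: "b j \<in> B" for j using b by (auto simp: bij_betw_def)
  have P: "orthogonal_matrix P"
    unfolding orthogonal_matrix_orthonormal_columns col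
    using B bB b by (auto simp: pairwise_def bij_betw_def inj_on_eq_iff)
  define d where "d = (\<chi> j. SOME c. A *v b j = c *\<^sub>R b j)"
  have d: "A *v b j = d $ j *\<^sub>R b j" for j
    unfolding d_def by simp (rule someI_ex, use B bB in blast)
  have "A ** P = P ** diag_matrix d"
  proof -
    have "(A ** P) $ i $ j = (A *v b j) $ i" for i j
      by (simp add: matrix_matrix_mult_def matrix_vector_mult_def P_def)
    then show ?thesis by (simp add: vec_eq_iff mult_diag_matrix d P_def)
  qed
  then have "A ** P ** transpose P = P ** diag_matrix d ** transpose P" by simp
  then have "A = P ** diag_matrix d ** transpose P"
    using orthogonal_matrixD[OF P] by (simp flip: matrix_mul_assoc)
  with P that show ?thesis by blast
qed

lemma quadratic_form_diag:
  assumes P: "orthogonal_matrix P" and A: "A = P ** diag_matrix d ** transpose P"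
  shows "(P *v axis i 1) \<bullet> (A *v (P *v axis i 1)) = d $ i"
proof -
  have "(P *v axis i 1) \<bullet> (A *v (P *v axis i 1))
     = axis i 1 \<bullet> ((transpose P ** P ** diag_matrix d ** (transpose P ** P)) *v axis i 1)"
    unfolding A dot_mv by (simp only: matrix_vector_mul_assoc matrix_mul_assoc)
  also have "\<dots> = d $ i"
    unfolding orthogonal_matrixD[OF P]
    by (simp add: inner_axis' matrix_vector_mul_component inner_axis diag_matrix_def)
  finally show ?thesis .
qed

lemma psd_spectral:
  assumes "A \<in> psd"
  obtains P d where "orthogonal_matrix P" "\<And>i. 0 \<le> d $ i" "A = P ** diag_matrix d ** transpose P"
proof -
  obtain P d where Pd: "orthogonal_matrix P" "A = P ** diag_matrix d ** transpose P"
    using spectral_theorem[OF psd_sym[OF assms]] by blast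
  have "0 \<le> d $ i" for i
    using quadratic_form_diag[OF Pd, of i] psd_nonneg[OF assms] by metis
  with Pd that show ?thesis by blast
qed

lemma psd_diag: "(\<And>i. 0 \<le> d $ i) \<Longrightarrow> diag_matrix d \<in> psd"
proof (rule psdI)
  assume d: "\<And>i. 0 \<le> d $ i"
  show "0 \<le> v \<bullet> (diag_matrix d *v v)" for v
  proof -
    have "(diag_matrix d *v v) $ i = d $ i * v $ i" for i
      by (simp add: diag_matrix_def matrix_vector_mult_def if_distrib[of "\<lambda>z. z * _"] cong: if_cong)
    then have "v \<bullet> (diag_matrix d *v v) = (\<Sum>i\<in>UNIV. d $ i * (v $ i)^2)"
      by (simp add: inner_vec_def power2_eq_square mult_ac)
    also have "\<dots> \<ge> 0" using d by (simp add: sum_nonneg)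
    finally show ?thesis .
  qed
qed (simp add: transpose_diag_matrix)

lemma spectral_calculus_unique:
  assumes P: "orthogonal_matrix P" and P': "orthogonal_matrix P'"
    and eq: "P ** diag_matrix d ** transpose P = P' ** diag_matrix e ** transpose P'"
  shows "P ** diag_matrix (\<chi> i. f (d $ i)) ** transpose P = P' ** diag_matrix (\<chi> i. f (e $ i)) ** transpose P'"
proof -
  define W where "W = transpose P' ** P"
  have *: "P ** X ** transpose P = P' ** Y ** transpose P' \<longleftrightarrow> W ** X = Y ** W" for X Y
  proof
    assume "P ** X ** transpose P = P' ** Y ** transpose P'"
    then have "transpose P' ** (P ** X ** transpose P) ** P = transpose P' ** (P' ** Y ** transpose P') ** P" by simp
    then have "W ** X ** (transpose P ** P) = (transpose P' ** P') ** Y ** W" by (simp add: W_def matrix_mul_assoc)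
    then show "W ** X = Y ** W" using orthogonal_matrixD[OF P] orthogonal_matrixD[OF P'] by simp
  next
    assume "W ** X = Y ** W"
    then have "P' ** (W ** X) ** transpose P = P' ** (Y ** W) ** transpose P" by simp
    then have "(P' ** transpose P') ** P ** X ** transpose P = P' ** Y ** transpose P' ** (P ** transpose P)"
      by (simp add: W_def matrix_mul_assoc)
    then show "P ** X ** transpose P = P' ** Y ** transpose P'"
      using orthogonal_matrixD[OF P] orthogonal_matrixD[OF P'] by simp
  qed
  have "W $ i $ j * d $ j = e $ i * W $ i $ j" for i j
    using eq unfolding * by (metis mult_diag_matrix diag_matrix_mult_left)
  then have "W $ i $ j = 0 \<or> d $ j = e $ i" for i j
    by (metis mult.commute mult_right_cancel)
  then have "W $ i $ j * f (d $ j) = f (e $ i) * W $ i $ j" for i j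
    by (metis mult.commute mult_zero_left)
  then show ?thesis unfolding *
    by (simp add: vec_eq_iff mult_diag_matrix diag_matrix_mult_left)
qed

lemma psd_powr_eq:
  assumes "orthogonal_matrix P" "\<And>i. 0 \<le> d $ i"
  shows "psd_powr (P ** diag_matrix d ** transpose P) r = P ** diag_matrix (\<chi> i. (d $ i) powr r) ** transpose P"
  unfolding psd_powr_def
proof (rule the_equality)
  fix B assume "\<exists>P' e. orthogonal_matrix P' \<and> (\<forall>i. 0 \<le> e $ i) \<and>
    P ** diag_matrix d ** transpose P = P' ** diag_matrix e ** transpose P' \<and>
    B = P' ** diag_matrix (\<chi> i. (e $ i) powr r) ** transpose P'"
  then show "B = P ** diag_matrix (\<chi> i. (d $ i) powr r) ** transpose P"
    using spectral_calculus_unique[OF assms(1), of _ d _ "\<lambda>z. z powr r"] by metis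
qed (use assms in blast)

lemma conj_diag_mult:
  assumes "orthogonal_matrix P"
  shows "(P ** diag_matrix d ** transpose P) ** (P ** diag_matrix e ** transpose P)
     = P ** diag_matrix (\<chi> i. d $ i * e $ i) ** transpose P"
proof -
  have "(P ** diag_matrix d ** transpose P) ** (P ** diag_matrix e ** transpose P)
      = P ** diag_matrix d ** (transpose P ** P) ** diag_matrix e ** transpose P"
    by (simp add: matrix_mul_assoc)
  then show ?thesis unfolding orthogonal_matrixD[OF assms]
    by (simp add: diag_matrix_mult flip: matrix_mul_assoc)
qed

lemma psd_conj_diag: "(\<And>i. 0 \<le> d $ i) \<Longrightarrow> P ** diag_matrix d ** transpose P \<in> psd"
  by (simp add: psd_congruence psd_diag)

lemma psd_sqrt:
  assumes "A \<in> psd"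
  shows "psd_powr A (1/2) \<in> psd" "psd_powr A (1/2) ** psd_powr A (1/2) = A"
proof -
  obtain P d where Pd: "orthogonal_matrix P" "\<And>i. 0 \<le> d $ i" "A = P ** diag_matrix d ** transpose P"
    using psd_spectral[OF assms] by blast
  have eq: "psd_powr A (1/2) = P ** diag_matrix (\<chi> i. (d $ i) powr (1/2)) ** transpose P"
    unfolding Pd(3) by (rule psd_powr_eq) (use Pd in auto)
  show "psd_powr A (1/2) \<in> psd" unfolding eq by (rule psd_conj_diag) auto
  show "psd_powr A (1/2) ** psd_powr A (1/2) = A"
    unfolding eq conj_diag_mult[OF Pd(1)] using Pd
    by (simp add: powr_half_sqrt)
qed

lemma psd_powr_square:
  assumes "Y \<in> psd"
  shows "psd_powr (Y ** Y) (3/2) = Y ** Y ** Y"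
proof -
  obtain P d where Pd: "orthogonal_matrix P" "\<And>i. 0 \<le> d $ i" "Y = P ** diag_matrix d ** transpose P"
    using psd_spectral[OF assms] by blast
  have "(z * z) powr (3/2) = z * z * z" if "0 \<le> z" for z :: real
  proof (cases "z = 0")
    case False
    then have "(z * z) powr (3/2) = (z powr 2) powr (3/2)" using that by (simp add: power2_eq_square)
    also have "\<dots> = z powr 3" by (simp add: powr_powr)
    also have "\<dots> = z * z * z" using that False by (simp add: power3_eq_cube)
    finally show ?thesis .
  qed simp
  then show ?thesis
    unfolding Pd(3) conj_diag_mult[OF Pd(1)]
    using Pd by (subst psd_powr_eq) auto
qed

lemma psd_factor:
  assumes "A \<in> psd" obtains R where "R \<in> psd" "R ** R = A"
  using psd_sqrt[OF assms] that by blast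

lemma psd_inner_nonneg:
  assumes "A \<in> psd" "B \<in> psd" shows "0 \<le> A \<bullet> B"
proof -
  obtain R where R: "R \<in> psd" "R ** R = A" using psd_factor[OF assms(1)] by blast
  have "A \<bullet> B = mat 1 \<bullet> (R ** B ** R)"
    unfolding R(2)[symmetric] using psd_sym[OF R(1)]
    by (metis inner_mult_left inner_mult_right matrix_mul_lid)
  also have "\<dots> = trace (R ** B ** transpose R)" using psd_sym[OF R(1)] by (simp add: inner_mat1)
  also have "\<dots> \<ge> 0"
  proof -
    have "R ** B ** transpose R \<in> psd" by (rule psd_congruence[OF assms(2)])
    from psd_nonneg[OF this, of "axis _ 1"] show ?thesis
      unfolding trace_def by (intro sum_nonneg) (simp add: inner_axis' matrix_vector_mul_component inner_axis)
  qed
  finally show ?thesis .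
qed

lemma psd_diag_nonneg: "A \<in> psd \<Longrightarrow> 0 \<le> A $ i $ i"
  using psd_nonneg[of A "axis i 1"] by (simp add: inner_axis' matrix_vector_mul_component inner_axis)

lemma psd_entry_le:
  assumes "A \<in> psd" shows "\<bar>A $ i $ j\<bar> \<le> (A $ i $ i + A $ j $ j) / 2"
proof -
  have s: "A $ j $ i = A $ i $ j" using psd_sym[OF assms] 
    by (simp add: transpose_def vec_eq_iff)
  have "0 \<le> (axis i 1 + c *\<^sub>R axis j 1) \<bullet> (A *v (axis i 1 + c *\<^sub>R axis j 1))" for c
    by (rule psd_nonneg[OF assms])
  then have "0 \<le> A $ i $ i + 2 * c * A $ i $ j + c^2 * A $ j $ j" for c
    by (simp add: inner_axis' matrix_vector_mul_component inner_axis inner_add_left inner_add_right s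
        matrix_vector_right_distrib matrix_vector_mult_scaleR power2_eq_square algebra_simps)
  from this[of 1] this[of "-1"] show ?thesis by auto
qed

lemma hadamard_psd:
  assumes "A \<in> psd" "B \<in> psd" shows "A \<odot> B \<in> psd"
proof (rule psdI)
  show "transpose (A \<odot> B) = A \<odot> B"
    using psd_sym[OF assms(1)] psd_sym[OF assms(2)] by (simp add: hadamard_def transpose_def vec_eq_iff)
  obtain R where R: "R \<in> psd" "R ** R = A" using psd_factor[OF assms(1)] by blast
  have A: "A $ i $ j = (\<Sum>k\<in>UNIV. R $ i $ k * R $ j $ k)" for i j
  proof -
    have "A = R ** transpose R" using R psd_sym[OF R(1)] by simp
    then show ?thesis by (simp add: matrix_matrix_mult_def transpose_def)
  qed
  show "0 \<le> v \<bullet> ((A \<odot> B) *v v)" for v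
  proof -
    have "v \<bullet> ((A \<odot> B) *v v) = (\<Sum>i\<in>UNIV. \<Sum>j\<in>UNIV. \<Sum>k\<in>UNIV. (R $ i $ k * v $ i) * (B $ i $ j * (R $ j $ k * v $ j)))"
      by (simp add: inner_vec_def matrix_vector_mult_def hadamard_def A sum_distrib_left sum_distrib_right mult_ac)
    also have "\<dots> = (\<Sum>k\<in>UNIV. \<Sum>i\<in>UNIV. \<Sum>j\<in>UNIV. (R $ i $ k * v $ i) * (B $ i $ j * (R $ j $ k * v $ j)))"
      by (subst sum.swap[of _ UNIV]) (subst (2) sum.swap, rule sum.cong, auto intro: sum.swap)
    also have "\<dots> = (\<Sum>k\<in>UNIV. (\<chi> i. R $ i $ k * v $ i) \<bullet> (B *v (\<chi> i. R $ i $ k * v $ i)))"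
      by (simp add: inner_vec_def matrix_vector_mult_def sum_distrib_left)
    also have "\<dots> \<ge> 0" by (intro sum_nonneg psd_nonneg assms)
    finally show ?thesis .
  qed
qed

lemma matrix_inv_mult:
  fixes A :: "real^'n^'n"
  assumes "invertible A"
  shows "A ** matrix_inv A = mat 1" "matrix_inv A ** A = mat 1"
  using someI_ex[OF assms[unfolded invertible_def]] by (auto simp: matrix_inv_def)

lemma matrix_inv_unique:
  fixes A :: "real^'n^'n"
  assumes "A ** B = mat 1"
  shows "matrix_inv A = B"
proof -
  have "invertible A" using assms by (metis invertible_right_inverse)
  then show ?thesis using assms matrix_inv_mult(2) by (metis matrix_mul_assoc matrix_mul_lid matrix_mul_rid)
qed

lemma matrix_inv_diff:
  fixes A :: "real^'n^'n"
  assumes "invertible A" "invertible B"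
  shows "matrix_inv A - matrix_inv B = matrix_inv B ** (B - A) ** matrix_inv A"
proof -
  have "matrix_inv B ** (B - A) ** matrix_inv A
      = (matrix_inv B ** B) ** matrix_inv A - matrix_inv B ** (A ** matrix_inv A)"
    by (simp only: mm_simps)
  then show ?thesis using assms by (simp add: matrix_inv_mult)
qed

subsection \<open>Positive definite matrices\<close>

definition pd :: "real \<Rightarrow> real^'n^'n \<Rightarrow> bool"
  where "pd c A \<longleftrightarrow> A - c *\<^sub>R mat 1 \<in> psd"

lemma pd_mono: "pd c A \<Longrightarrow> B - A \<in> psd \<Longrightarrow> pd c B"
  using psd_add[of "B - A" "A - c *\<^sub>R mat 1"] by (simp add: pd_def)

lemma pd_psd:
  assumes "pd c A" "0 \<le> c" shows "A \<in> psd"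
  using psd_add[OF assms(1)[unfolded pd_def] psd_scaleR[OF psd_mat1 assms(2)]] by simp

lemma pd_quadratic_form:
  assumes "pd c A" shows "c * (norm v)\<^sup>2 \<le> v \<bullet> (A *v v)"
  using psd_nonneg[OF assms[unfolded pd_def], of v]
  by (simp add: matrix_vector_mult_diff_rdistrib scaleR_matrix_vector_assoc[symmetric] inner_diff_right
      power2_norm_eq_inner)

lemma pd_norm_mv:
  assumes "pd c A" shows "c * norm v \<le> norm (A *v v)"
proof (cases "v = 0")
  case False
  have "c * (norm v)\<^sup>2 \<le> norm v * norm (A *v v)"
    using pd_quadratic_form[OF assms, of v] norm_cauchy_schwarz[of v "A *v v"] by linarith
  then show ?thesis using False by (simp add: power2_eq_square mult.left_commute[of c])
qed simp

lemma pd_invertible: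
  assumes "pd c A" "0 < c" shows "invertible A"
proof -
  have "A *v v = 0 \<Longrightarrow> v = 0" for v
    using pd_norm_mv[OF assms(1), of v] assms(2) by (simp add: mult_le_0_iff)
  then show ?thesis
    using invertible_left_inverse[of A] matrix_left_invertible_ker[of A] by blast
qed

lemma psd_det_nonneg:
  assumes "A \<in> psd" shows "0 \<le> det A"
proof -
  obtain R where R: "R \<in> psd" "R ** R = A" using psd_factor[OF assms] by blast
  then have "det A = (det R)\<^sup>2" by (metis det_mul power2_eq_square)
  then show ?thesis by simp
qed

lemma pd_det: "pd c A \<Longrightarrow> 0 < c \<Longrightarrow> 0 < det A"
  using pd_invertible[of c A] psd_det_nonneg[of A] pd_psd[of c A] invertible_det_nz[of A] by fastforce

lemma det_conj_diag:
  assumes "orthogonal_matrix P"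
  shows "det (P ** diag_matrix d ** transpose P) = (\<Prod>i\<in>UNIV. d $ i)"
proof -
  have "det P * det P = 1" using orthogonal_matrixD(2)[OF assms] by (metis det_I det_mul det_transpose)
  moreover have "det (diag_matrix d) = (\<Prod>i\<in>UNIV. d $ i)"
    using det_diagonal[of "diag_matrix d"] by (simp add: diag_matrix_def)
  ultimately show ?thesis by (simp add: det_mul det_transpose)
qed

lemma trace_conj_diag:
  assumes "orthogonal_matrix P"
  shows "trace (P ** diag_matrix d ** transpose P) = (\<Sum>i\<in>UNIV. d $ i)"
proof -
  have "trace (P ** diag_matrix d ** transpose P) = trace (transpose P ** P ** diag_matrix d)"
    by (metis matrix_mul_assoc trace_mul_sym)
  then show ?thesis using orthogonal_matrixD[OF assms] by (simp add: trace_def diag_matrix_def)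
qed

lemma psd_det_pd:
  assumes "A \<in> psd" "det A \<noteq> 0"
  obtains c where "0 < c" "pd c A"
proof -
  obtain P d where Pd: "orthogonal_matrix P" "\<And>i. 0 \<le> d $ i" "A = P ** diag_matrix d ** transpose P"
    using psd_spectral[OF assms(1)] by blast
  have "d $ i > 0" for i
  proof -
    have "(\<Prod>i\<in>UNIV. d $ i) \<noteq> 0" using det_conj_diag[OF Pd(1)] assms(2) Pd(3) by metis
    then have "d $ i \<noteq> 0" by simp
    then show ?thesis using Pd(2)[of i] by linarith
  qed
  then have c: "Min (range (($) d)) > 0" by (subst Min_gr_iff) auto
  define c where "c = Min (range (($) d))"
  have "A - c *\<^sub>R mat 1 = P ** diag_matrix (\<chi> i. d $ i - c) ** transpose P"
  proof -
    have "diag_matrix (\<chi> i. d $ i - c) = diag_matrix d - c *\<^sub>R mat 1"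
      by (auto simp: diag_matrix_def mat_def vec_eq_iff)
    then show ?thesis using orthogonal_matrixD[OF Pd(1)] by (simp add: Pd(3) mm_simps)
  qed
  moreover have "P ** diag_matrix (\<chi> i. d $ i - c) ** transpose P \<in> psd"
    by (rule psd_conj_diag) (simp add: c_def)
  ultimately show ?thesis using that[of c] c by (simp add: pd_def c_def)
qed

lemma matrix_inv_psd:
  assumes "A \<in> psd" "invertible A" shows "matrix_inv A \<in> psd"
proof -
  have "matrix_inv A ** A ** transpose (matrix_inv A) \<in> psd" by (rule psd_congruence[OF assms(1)])
  then have t: "transpose (matrix_inv A) \<in> psd" using matrix_inv_mult[OF assms(2)] by simp
  then show ?thesis using psd_sym[OF t] by simp
qed

lemma norm_matrix_le_onorm:
  fixes A :: "real^'n^'n"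
  assumes "\<And>v. norm (A *v v) \<le> c * norm v"
  shows "norm A \<le> real CARD('n) * c"
proof -
  have "norm A = norm (transpose A)"
    by (metis inner_transpose norm_eq_sqrt_inner)
  also have "\<dots> \<le> (\<Sum>i\<in>UNIV. norm (transpose A $ i))" by (simp add: norm_vec_def L2_set_le_sum)
  also have "\<dots> \<le> (\<Sum>i\<in>(UNIV::'n set). c)"
  proof (rule sum_mono)
    fix i :: 'n
    have "transpose A $ i = A *v axis i 1"
      by (simp add: matrix_vector_mult_basis column_def transpose_def vec_eq_iff)
    then show "norm (transpose A $ i) \<le> c" using assms[of "axis i 1"] by simp
  qed
  finally show ?thesis by simp
qed

lemma pd_norm_inv:
  fixes A :: "real^'n^'n"
  assumes "pd c A" "0 < c" shows "norm (matrix_inv A) \<le> real CARD('n) / c"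
proof -
  have "norm (matrix_inv A *v v) \<le> 1/c * norm v" for v
    using pd_norm_mv[OF assms(1), of "matrix_inv A *v v"] assms(2)
    by (simp add: matrix_vector_mul_assoc matrix_inv_mult pd_invertible[OF assms] field_simps)
  from norm_matrix_le_onorm[OF this] show ?thesis by simp
qed

lemma ln_det_concave:
  fixes A B :: "real^'n^'n"
  assumes A: "A \<in> psd" "0 < det A" and B: "B \<in> psd" "0 < det B"
  shows "ln (det A) \<le> ln (det B) + matrix_inv B \<bullet> (A - B)"
proof -
  obtain R where R: "R \<in> psd" "R ** R = B" using psd_factor[OF B(1)] by blast
  then have dR: "det R * det R = det B" by (metis det_mul)
  then have iR: "invertible R" using B(2) by (auto simp: invertible_det_nz)
  define S where "S = matrix_inv R"
  have S: "S ** R = mat 1" "R ** S = mat 1" "transpose S = S"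
    using matrix_inv_mult[OF iR] psd_sym[OF matrix_inv_psd[OF R(1) iR]] by (auto simp: S_def)
  have invB: "matrix_inv B = S ** S"
    by (rule matrix_inv_unique) (metis R(2) S(2) matrix_mul_assoc matrix_mul_rid)
  define N where "N = S ** A ** S"
  have N: "N \<in> psd" unfolding N_def using psd_congruence[OF A(1), of S] S(3) by simp
  have "det S * det R = 1" using S(1) by (metis det_I det_mul)
  then have dS: "det S * det S * det B = 1" using dR by (metis mult.assoc mult.left_commute mult_1)
  have dN: "det N * det B = det A" by (simp add: N_def det_mul) (metis dS mult.assoc mult.commute mult_1)
  then have dN0: "0 < det N" using A(2) B(2) by (metis zero_less_mult_pos2)
  obtain P d where Pd: "orthogonal_matrix P" "\<And>i. 0 \<le> d $ i" "N = P ** diag_matrix d ** transpose P"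
    using psd_spectral[OF N] by blast
  have dprod: "det N = (\<Prod>i\<in>UNIV. d $ i)" using det_conj_diag[OF Pd(1)] Pd(3) by metis
  have pos: "d $ i > 0" for i
  proof -
    have "d $ i \<noteq> 0" using dprod dN0 by (metis finite UNIV_I less_irrefl prod_zero)
    then show ?thesis using Pd(2)[of i] by linarith
  qed
  have "ln (det N) = (\<Sum>i\<in>UNIV. ln (d $ i))" unfolding dprod using pos by (intro ln_prod) (auto simp: less_le)
  also have "\<dots> \<le> (\<Sum>i\<in>UNIV. d $ i - 1)"
    by (intro sum_mono ln_le_minus_one pos)
  also have "\<dots> = trace N - trace (mat 1 :: real^'n^'n)"
    using trace_conj_diag[OF Pd(1)] Pd(3) by (simp add: sum_subtractf trace_I)
  also have "trace N = matrix_inv B \<bullet> A"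
  proof -
    have "trace N = trace (S ** (S ** A))" unfolding N_def by (metis trace_mul_sym)
    then show ?thesis unfolding invB by (simp add: inner_eq_trace matrix_transpose_mul S matrix_mul_assoc)
  qed
  also have "trace (mat 1 :: real^'n^'n) = matrix_inv B \<bullet> B"
  proof -
    have "invertible B" using B(2) by (simp add: invertible_det_nz)
    then show ?thesis
      using psd_sym[OF matrix_inv_psd[OF B(1)]] by (simp add: inner_eq_trace matrix_inv_mult)
  qed
  finally have "ln (det N) \<le> matrix_inv B \<bullet> (A - B)" by (simp add: inner_diff_right)
  moreover have "ln (det A) = ln (det N) + ln (det B)"
    using dN dN0 B(2) by (metis ln_mult_pos)
  ultimately show ?thesis by simp
qed

subsection \<open>Bounded Lipschitz functions\<close>

text \<open>Boundedness is part of the definition, so that products stay in the class.\<close>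

definition lip_on :: "real set \<Rightarrow> (real \<Rightarrow> 'a::real_normed_vector) \<Rightarrow> bool"
  where "lip_on S f \<longleftrightarrow> bounded (f ` S) \<and> (\<exists>L. \<forall>s\<in>S. \<forall>t\<in>S. norm (f t - f s) \<le> L * \<bar>t - s\<bar>)"

lemma lip_onI:
  assumes "\<And>t. t \<in> S \<Longrightarrow> norm (f t) \<le> B" "\<And>s t. s \<in> S \<Longrightarrow> t \<in> S \<Longrightarrow> s \<le> t \<Longrightarrow> norm (f t - f s) \<le> L * (t - s)"
  shows "lip_on S f"
proof -
  have "norm (f t - f s) \<le> L * \<bar>t - s\<bar>" if "s \<in> S" "t \<in> S" for s t
    using assms(2)[OF that] assms(2)[OF that(2,1)] by (cases "s \<le> t") (auto simp: norm_minus_commute)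
  then show ?thesis using assms(1) by (force simp: lip_on_def bounded_iff)
qed

lemma lip_onE:
  assumes "lip_on S f"
  obtains B L where "0 < B" "0 < L" "\<And>t. t \<in> S \<Longrightarrow> norm (f t) \<le> B"
    "\<And>s t. s \<in> S \<Longrightarrow> t \<in> S \<Longrightarrow> norm (f t - f s) \<le> L * \<bar>t - s\<bar>"
proof -
  obtain B L where B: "\<And>t. t \<in> S \<Longrightarrow> norm (f t) \<le> B"
    and L: "\<And>s t. s \<in> S \<Longrightarrow> t \<in> S \<Longrightarrow> norm (f t - f s) \<le> L * \<bar>t - s\<bar>"
    using assms unfolding lip_on_def bounded_iff by (metis imageI)
  show ?thesis
  proof (rule that[of "max B 1" "max L 1"])
    fix s t assume "s \<in> S" "t \<in> S"
    have "L * \<bar>t - s\<bar> \<le> max L 1 * \<bar>t - s\<bar>" by (rule mult_right_mono) auto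
    then show "norm (f t - f s) \<le> max L 1 * \<bar>t - s\<bar>" using L[OF \<open>s \<in> S\<close> \<open>t \<in> S\<close>] by linarith
  qed (use B in \<open>auto simp: le_max_iff_disj\<close>)
qed

lemma lip_on_subset: "lip_on S f \<Longrightarrow> R \<subseteq> S \<Longrightarrow> lip_on R f"
  unfolding lip_on_def by (meson bounded_subset image_mono subsetD)

lemma lip_on_cong: "(\<And>t. t \<in> S \<Longrightarrow> f t = g t) \<Longrightarrow> lip_on S f = lip_on S g"
  by (simp add: lip_on_def image_def bounded_iff)

lemma lip_on_const: "lip_on S (\<lambda>_. c)" by (rule lip_onI[of _ _ "norm c" 0]) auto

lemma lip_on_continuous: "lip_on S f \<Longrightarrow> continuous_on S f"
proof (erule lip_onE)
  fix B L :: real assume L: "0 < L" "\<And>s t. s \<in> S \<Longrightarrow> t \<in> S \<Longrightarrow> norm (f t - f s) \<le> L * \<bar>t - s\<bar>"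
  have "L-lipschitz_on S f"
    by (rule lipschitz_onI) (use L in \<open>auto simp: dist_norm\<close>)
  then show ?thesis by (rule lipschitz_on_continuous_on)
qed

lemma lip_on_linear: assumes "bounded_linear h" "lip_on S f" shows "lip_on S (\<lambda>t. h (f t))"
proof -
  obtain B L where f: "0 < B" "0 < L" "\<And>t. t \<in> S \<Longrightarrow> norm (f t) \<le> B"
    "\<And>s t. s \<in> S \<Longrightarrow> t \<in> S \<Longrightarrow> norm (f t - f s) \<le> L * \<bar>t - s\<bar>" using lip_onE[OF assms(2)] by metis
  obtain K where K: "K > 0" "\<And>v. norm (h v) \<le> norm v * K" using bounded_linear.pos_bounded[OF assms(1)] by blast
  show ?thesis
  proof (rule lip_onI)
    show "norm (h (f t)) \<le> B * K" if "t \<in> S" for t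
      using K(2)[of "f t"] mult_right_mono[OF f(3)[OF that], of K] K(1) by linarith
    show "norm (h (f t) - h (f s)) \<le> L * K * (t - s)" if "s \<in> S" "t \<in> S" "s \<le> t" for s t
    proof -
      have "norm (h (f t) - h (f s)) \<le> norm (f t - f s) * K"
        using K(2)[of "f t - f s"] by (simp add: linear_diff[OF bounded_linear.linear[OF assms(1)]])
      also have "\<dots> \<le> (L * (t - s)) * K" using f(4)[OF that(1,2)] K(1) that(3) by (intro mult_right_mono) auto
      finally show ?thesis by (simp add: mult_ac)
    qed
  qed
qed

lemma lip_on_add: assumes "lip_on S f" "lip_on S g" shows "lip_on S (\<lambda>t. f t + g t)"
proof -
  obtain B L where f: "\<And>t. t \<in> S \<Longrightarrow> norm (f t) \<le> B"
    "\<And>s t. s \<in> S \<Longrightarrow> t \<in> S \<Longrightarrow> norm (f t - f s) \<le> L * \<bar>t - s\<bar>" using lip_onE[OF assms(1)] by metis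
  obtain B' L' where g: "\<And>t. t \<in> S \<Longrightarrow> norm (g t) \<le> B'"
    "\<And>s t. s \<in> S \<Longrightarrow> t \<in> S \<Longrightarrow> norm (g t - g s) \<le> L' * \<bar>t - s\<bar>" using lip_onE[OF assms(2)] by metis
  show ?thesis
  proof (rule lip_onI)
    show "norm (f t + g t) \<le> B + B'" if "t \<in> S" for t
      using norm_triangle_ineq[of "f t" "g t"] f(1)[OF that] g(1)[OF that] by linarith
    show "norm (f t + g t - (f s + g s)) \<le> (L + L') * (t - s)" if "s \<in> S" "t \<in> S" "s \<le> t" for s t
      using norm_diff_triangle_ineq[of "f t" "g t" "f s" "g s"] f(2)[OF that(1,2)] g(2)[OF that(1,2)] that(3)
      by (simp add: algebra_simps)
  qed
qed

lemma lip_on_bilinear: assumes "bounded_bilinear h" "lip_on S f" "lip_on S g"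
  shows "lip_on S (\<lambda>t. h (f t) (g t))"
proof -
  obtain B L where f: "0 < B" "0 < L" "\<And>t. t \<in> S \<Longrightarrow> norm (f t) \<le> B"
    "\<And>s t. s \<in> S \<Longrightarrow> t \<in> S \<Longrightarrow> norm (f t - f s) \<le> L * \<bar>t - s\<bar>" using lip_onE[OF assms(2)] by metis
  obtain B' L' where g: "0 < B'" "0 < L'" "\<And>t. t \<in> S \<Longrightarrow> norm (g t) \<le> B'"
    "\<And>s t. s \<in> S \<Longrightarrow> t \<in> S \<Longrightarrow> norm (g t - g s) \<le> L' * \<bar>t - s\<bar>" using lip_onE[OF assms(3)] by metis
  obtain K where K: "K > 0" "\<And>v w. norm (h v w) \<le> norm v * norm w * K" using bounded_bilinear.pos_bounded[OF assms(1)] by blast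
  have bnd: "norm (h v w) \<le> a * b * K" if "norm v \<le> a" "norm w \<le> b" for v w a b
    using order.trans[OF norm_ge_zero that(1)] K(1)
    by (intro order.trans[OF K(2)] mult_right_mono mult_mono that) auto
  show ?thesis
  proof (rule lip_onI)
    show "norm (h (f t) (g t)) \<le> B * B' * K" if "t \<in> S" for t
      by (rule bnd) (use f g that in auto)
    show "norm (h (f t) (g t) - h (f s) (g s)) \<le> (L * B' * K + B * L' * K) * (t - s)"
      if st: "s \<in> S" "t \<in> S" "s \<le> t" for s t
    proof -
      have "h (f t) (g t) - h (f s) (g s) = h (f t - f s) (g t) + h (f s) (g t - g s)"
        by (simp add: bounded_bilinear.diff_left[OF assms(1)] bounded_bilinear.diff_right[OF assms(1)])
      also have "norm \<dots> \<le> L * (t - s) * B' * K + B * (L' * (t - s)) * K"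
        using bnd[of "f t - f s" "L * (t - s)" "g t" B'] bnd[of "f s" B "g t - g s" "L' * (t - s)"]
          f(3)[OF st(1)] g(3)[OF st(2)] f(4)[OF st(1,2)] g(4)[OF st(1,2)] st(3)
        by (intro norm_triangle_le add_mono) auto
      finally show ?thesis by (simp add: algebra_simps)
    qed
  qed
qed

lemma lip_on_scaleR: "lip_on S f \<Longrightarrow> lip_on S (\<lambda>t. c *\<^sub>R f t)"
  by (rule lip_on_linear[OF bounded_linear_scaleR_right])
lemma lip_on_diff: "lip_on S f \<Longrightarrow> lip_on S g \<Longrightarrow> lip_on S (\<lambda>t. f t - g t)"
  using lip_on_add[of S f "\<lambda>t. (-1) *\<^sub>R g t"] lip_on_scaleR[of S g "-1"] by simp
lemma lip_on_mult: "lip_on S f \<Longrightarrow> lip_on S g \<Longrightarrow> lip_on S (\<lambda>t. f t * g t :: real)"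
  by (rule lip_on_bilinear[OF bounded_bilinear_mult])
lemma lip_on_scaleR2: "lip_on S f \<Longrightarrow> lip_on S g \<Longrightarrow> lip_on S (\<lambda>t. f t *\<^sub>R g t)"
  by (rule lip_on_bilinear[OF bounded_bilinear_scaleR])
lemma lip_on_inner: "lip_on S f \<Longrightarrow> lip_on S g \<Longrightarrow> lip_on S (\<lambda>t. f t \<bullet> g t)"
  by (rule lip_on_bilinear[OF bounded_bilinear_inner])
lemma lip_on_mm: "lip_on S f \<Longrightarrow> lip_on S g \<Longrightarrow> lip_on S (\<lambda>t. f t ** g t :: real^'n^'m)"
  by (rule lip_on_bilinear[OF bounded_bilinear_matrix_mult])
lemmas lip_intros = lip_on_const lip_on_add lip_on_scaleR lip_on_diff lip_on_mult lip_on_scaleR2 lip_on_inner lip_on_mm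

lemma lip_on_id: "bounded S \<Longrightarrow> lip_on S (\<lambda>t. t)"
  unfolding bounded_iff by (elim exE) (rule lip_onI[of _ _ _ 1], auto)

lemma lip_on_max: assumes "lip_on S f" shows "lip_on S (\<lambda>t. max c (f t) :: real)"
proof -
  obtain B L where f: "0 < B" "0 < L" "\<And>t. t \<in> S \<Longrightarrow> norm (f t) \<le> B"
    "\<And>s t. s \<in> S \<Longrightarrow> t \<in> S \<Longrightarrow> norm (f t - f s) \<le> L * \<bar>t - s\<bar>" using lip_onE[OF assms] by metis
  show ?thesis
  proof (rule lip_onI)
    show "norm (max c (f t)) \<le> \<bar>c\<bar> + B" if "t \<in> S" for t using f(3)[OF that] by (auto simp: max_def)
    show "norm (max c (f t) - max c (f s)) \<le> L * (t - s)" if "s \<in> S" "t \<in> S" "s \<le> t" for s t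
      using f(4)[OF that(1,2)] that(3) by (auto simp: max_def)
  qed
qed

lemma lip_on_vec:
  fixes f :: "real \<Rightarrow> 'a::real_normed_vector^'n"
  assumes "\<And>i. lip_on S (\<lambda>t. f t $ i)" shows "lip_on S f"
proof -
  have "\<exists>B L. (\<forall>t\<in>S. norm (f t $ i) \<le> B) \<and> (\<forall>s\<in>S. \<forall>t\<in>S. norm (f t $ i - f s $ i) \<le> L * \<bar>t - s\<bar>)" for i
    using lip_onE[OF assms[of i]] by metis
  then obtain B L where B: "\<And>i t. t \<in> S \<Longrightarrow> norm (f t $ i) \<le> B i"
    and L: "\<And>i s t. s \<in> S \<Longrightarrow> t \<in> S \<Longrightarrow> norm (f t $ i - f s $ i) \<le> L i * \<bar>t - s\<bar>" by metis
  have n: "norm v \<le> (\<Sum>i\<in>UNIV. norm (v $ i))" for v :: "'a^'n" by (simp add: norm_vec_def L2_set_le_sum)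
  show ?thesis
  proof (rule lip_onI)
    show "norm (f t) \<le> (\<Sum>i\<in>UNIV. B i)" if "t \<in> S" for t
      by (rule order.trans[OF n]) (intro sum_mono B that)
    show "norm (f t - f s) \<le> (\<Sum>i\<in>UNIV. L i) * (t - s)" if "s \<in> S" "t \<in> S" "s \<le> t" for s t
    proof -
      have "norm ((f t - f s) $ i) \<le> L i * (t - s)" for i using L[OF that(1,2), of i] that(3) by simp
      then show ?thesis unfolding sum_distrib_right by (intro order.trans[OF n] sum_mono)
    qed
  qed
qed

lemma lip_on_union:
  assumes "lip_on {a..c} f" "lip_on {c..b} f" "a \<le> c" "c \<le> b"
  shows "lip_on {a..b::real} f"
proof -
  obtain B L where f: "0 < B" "0 < L" "\<And>t. t \<in> {a..c} \<Longrightarrow> norm (f t) \<le> B"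
    "\<And>s t. s \<in> {a..c} \<Longrightarrow> t \<in> {a..c} \<Longrightarrow> norm (f t - f s) \<le> L * \<bar>t - s\<bar>" using lip_onE[OF assms(1)] by metis
  obtain B' L' where g: "0 < B'" "0 < L'" "\<And>t. t \<in> {c..b} \<Longrightarrow> norm (f t) \<le> B'"
    "\<And>s t. s \<in> {c..b} \<Longrightarrow> t \<in> {c..b} \<Longrightarrow> norm (f t - f s) \<le> L' * \<bar>t - s\<bar>" using lip_onE[OF assms(2)] by metis
  show ?thesis
  proof (rule lip_onI)
    show "norm (f t) \<le> max B B'" if "t \<in> {a..b}" for t
      using f(3)[of t] g(3)[of t] that by (cases "t \<le> c") auto
    show "norm (f t - f s) \<le> (L + L') * (t - s)" if "s \<in> {a..b}" "t \<in> {a..b}" "s \<le> t" for s t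
    proof -
      consider "t \<le> c" | "c \<le> s" | "s \<le> c" "c \<le> t" by linarith
      then show ?thesis
      proof cases
        case 1
        then have "norm (f t - f s) \<le> L * (t - s)" using f(4)[of s t] that by auto
        then show ?thesis using mult_nonneg_nonneg[of L' "t - s"] g(2) that(3) unfolding distrib_right by linarith
      next
        case 2
        then have "norm (f t - f s) \<le> L' * (t - s)" using g(4)[of s t] that by auto
        then show ?thesis using mult_nonneg_nonneg[of L "t - s"] f(2) that(3) unfolding distrib_right by linarith
      next
        case 3
        have "norm (f t - f s) \<le> norm (f t - f c) + norm (f c - f s)"
          using norm_triangle_ineq[of "f t - f c" "f c - f s"] by simp
        also have "\<dots> \<le> L' * (t - c) + L * (c - s)"
          using f(4)[of s c] g(4)[of c t] that 3 by auto
        also have "\<dots> \<le> L' * (t - s) + L * (t - s)"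
          using 3 f(2) g(2) by (intro add_mono mult_left_mono) auto
        finally show ?thesis by (simp add: algebra_simps)
      qed
    qed
  qed
qed

subsection \<open>Integrals with a monotone weight\<close>

lemma integral_norm_le:
  fixes f :: "real \<Rightarrow> 'a::banach"
  assumes "f integrable_on {a..b}" "\<And>t. t \<in> {a..b} \<Longrightarrow> norm (f t) \<le> B" "a \<le> b"
  shows "norm (integral {a..b} f) \<le> B * (b - a)"
proof -
  have "0 \<le> B" using assms(2)[of a] assms(3) norm_ge_zero[of "f a"] by (auto intro: order.trans[OF norm_ge_zero])
  then show ?thesis
    using has_integral_bound_real[OF _ _ integrable_integral[OF assms(1)], of B "{}"] assms by auto
qed

lemma integral_diff_interval:
  fixes f :: "real \<Rightarrow> 'a::banach"
  assumes "f integrable_on {a..b}" "a \<le> s" "s \<le> t" "t \<le> b"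
  shows "integral {a..t} f - integral {a..s} f = integral {s..t} f"
    and "integral {s..b} f - integral {t..b} f = integral {s..t} f"
proof -
  have "f integrable_on {a..t}" "f integrable_on {s..b}"
    using assms by (auto intro: integrable_subinterval_real)
  then show "integral {a..t} f - integral {a..s} f = integral {s..t} f"
    "integral {s..b} f - integral {t..b} f = integral {s..t} f"
    using Henstock_Kurzweil_Integration.integral_combine[of a s t f] Henstock_Kurzweil_Integration.integral_combine[of s t b f] assms by (auto simp: algebra_simps)
qed

lemma lip_on_integral:
  fixes f :: "real \<Rightarrow> 'a::banach"
  assumes "f integrable_on {a..b}" "\<And>t. t \<in> {a..b} \<Longrightarrow> norm (f t) \<le> B"
  shows "lip_on {a..b} (\<lambda>t. integral {a..t} f)" "lip_on {a..b} (\<lambda>t. integral {t..b} f)"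
proof -
  have B0: "0 \<le> B" if "t \<in> {a..b}" for t using order.trans[OF norm_ge_zero assms(2)[OF that]] .
  have I: "norm (integral {s..t} f) \<le> B * (t - s)" if "a \<le> s" "s \<le> t" "t \<le> b" for s t
    using that assms by (intro integral_norm_le integrable_subinterval_real[OF assms(1)]) auto
  show "lip_on {a..b} (\<lambda>t. integral {a..t} f)"
  proof (rule lip_onI)
    show "norm (integral {a..t} f) \<le> B * (b - a)" if "t \<in> {a..b}" for t
      using I[of a t] that B0[OF that] mult_left_mono[of "t - a" "b - a" B] by auto
    show "norm (integral {a..t} f - integral {a..s} f) \<le> B * (t - s)" if "s \<in> {a..b}" "t \<in> {a..b}" "s \<le> t" for s t
      using that I integral_diff_interval(1)[OF assms(1)] by auto
  qed
  show "lip_on {a..b} (\<lambda>t. integral {t..b} f)"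
  proof (rule lip_onI)
    show "norm (integral {t..b} f) \<le> B * (b - a)" if "t \<in> {a..b}" for t
      using I[of t b] that B0[OF that] mult_left_mono[of "b - t" "b - a" B] by auto
    show "norm (integral {t..b} f - integral {s..b} f) \<le> B * (t - s)" if "s \<in> {a..b}" "t \<in> {a..b}" "s \<le> t" for s t
      using that I integral_diff_interval(2)[OF assms(1), of s t] by (metis atLeastAtMost_iff norm_minus_commute)
  qed
qed

lemma has_vector_derivative_quadratic:
  fixes f :: "real \<Rightarrow> 'a::real_normed_vector"
  assumes "\<And>v. v \<in> S \<Longrightarrow> norm (f v - f u - (v - u) *\<^sub>R d) \<le> C * (v - u)\<^sup>2"
  shows "(f has_vector_derivative d) (at u within S)"
  unfolding has_vector_derivative_def has_derivative_within_alt
proof (intro conjI allI impI)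
  show "bounded_linear (\<lambda>x. x *\<^sub>R d)" by (rule bounded_linear_scaleR_left)
  fix e :: real assume e: "0 < e"
  define D where "D = e / (\<bar>C\<bar> + 1)"
  have "norm (f y - f u - (y - u) *\<^sub>R d) \<le> e * norm (y - u)" if y: "y \<in> S" "norm (y - u) < D" for y
  proof -
    have "\<bar>C\<bar> * \<bar>y - u\<bar> \<le> e"
    proof -
      have "\<bar>C\<bar> * \<bar>y - u\<bar> \<le> (\<bar>C\<bar> + 1) * D" using y(2) by (intro mult_mono) auto
      then show ?thesis by (simp add: D_def)
    qed
    then have "\<bar>C\<bar> * \<bar>y - u\<bar> * \<bar>y - u\<bar> \<le> e * \<bar>y - u\<bar>" by (rule mult_right_mono) simp
    moreover have "C * (y - u)\<^sup>2 \<le> \<bar>C\<bar> * \<bar>y - u\<bar> * \<bar>y - u\<bar>"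
      by (metis (no_types, opaque_lifting) abs_ge_self abs_mult abs_power2 mult.assoc power2_eq_square)
    ultimately show ?thesis using assms[OF y(1)] by simp
  qed
  then show "\<exists>D>0. \<forall>y\<in>S. norm (y - u) < D \<longrightarrow> norm (f y - f u - (y - u) *\<^sub>R d) \<le> e * norm (y - u)"
    using e by (intro exI[of _ D]) (auto simp: D_def)
qed

text \<open>Replaces the fundamental theorem of calculus where integrands have countably many jumps.\<close>

lemma quadratic_increments_constant:
  fixes f :: "real \<Rightarrow> 'a::banach"
  assumes "\<And>s t. a \<le> s \<Longrightarrow> s \<le> t \<Longrightarrow> t \<le> b \<Longrightarrow> norm (f t - f s) \<le> C * (t - s)\<^sup>2"
    and "t \<in> {a..b}"
  shows "f t = f a"
proof -
  have "(f has_vector_derivative 0) (at u within {a..b})" if "u \<in> {a..b}" for u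
  proof (rule has_vector_derivative_quadratic[where C = C])
    fix v assume "v \<in> {a..b}"
    then show "norm (f v - f u - (v - u) *\<^sub>R 0) \<le> C * (v - u)\<^sup>2"
      using assms(1)[of u v] assms(1)[of v u] that by (cases "u \<le> v") (auto simp: norm_minus_commute power2_commute)
  qed
  then obtain c where "\<And>u. u \<in> {a..b} \<Longrightarrow> f u = c"
    using has_vector_derivative_zero_constant[of "{a..b}" f] by auto
  then show ?thesis using assms(2) by auto
qed

lemma mono_scaleR_integrable:
  fixes f :: "real \<Rightarrow> 'a::euclidean_space"
  assumes x: "mono_on {a..b} x" and f: "continuous_on {a..b} f"
  shows "(\<lambda>t. x t *\<^sub>R f t) integrable_on {a..b::real}"
proof (cases "a \<le> b")
  case True
  show ?thesis
  proof (subst integrable_componentwise_iff, intro ballI)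
    fix i :: 'a assume "i \<in> Basis"
    have "(\<lambda>t. f t \<bullet> i) integrable_on {a..b}"
      by (intro integrable_continuous_real continuous_intros f)
    moreover have "\<And>u v. a \<le> u \<Longrightarrow> u \<le> v \<Longrightarrow> v \<le> b \<Longrightarrow> x u \<le> x v" using x by (auto simp: mono_on_def)
    ultimately obtain c where "((\<lambda>t. x t * (f t \<bullet> i)) has_integral x a * integral {a..c} (\<lambda>t. f t \<bullet> i) + x b * integral {c..b} (\<lambda>t. f t \<bullet> i)) {a..b}"
      using second_mean_value_theorem_full[of "\<lambda>t. f t \<bullet> i" a b x] True by metis
    then show "(\<lambda>t. (x t *\<^sub>R f t) \<bullet> i) integrable_on {a..b}"
      by (auto simp: integrable_on_def)
  qed
qed (simp add: integrable_on_empty)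

lemma mono_mult_integrable:
  fixes f :: "real \<Rightarrow> real"
  assumes "mono_on {a..b} x" "continuous_on {a..b} f"
  shows "(\<lambda>t. x t * f t) integrable_on {a..b}"
  using mono_scaleR_integrable[OF assms] by simp

lemma mono_integrable: "mono_on {a..b} x \<Longrightarrow> x integrable_on {a..b::real}" for x :: "real \<Rightarrow> real"
  using mono_mult_integrable[of a b x "\<lambda>_. 1"] by simp

text \<open>Stieltjes integration by parts: \<open>c\<close> is the point of the second mean value theorem.\<close>

lemma mono_integral_derivative:
  fixes r :: "real \<Rightarrow> real"
  assumes x: "mono_on {a..b} x" and ab: "a \<le> b"
    and r: "\<And>t. t \<in> {a..b} \<Longrightarrow> (r has_vector_derivative r' t) (at t within {a..b})"
    and r': "continuous_on {a..b} r'"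
  obtains c where "c \<in> {a..b}"
    "integral {a..b} (\<lambda>t. x t * r' t) = x b * r b - x a * r a - (x b - x a) * r c"
proof -
  have "r' integrable_on {a..b}" by (rule integrable_continuous_real[OF r'])
  then obtain c where c: "c \<in> {a..b}"
    and eq: "integral {a..b} (\<lambda>t. x t * r' t) = x a * integral {a..c} r' + x b * integral {c..b} r'"
    using second_mean_value_theorem[of r' a b x] ab x by (auto simp: mono_on_def)
  have ftc: "integral {u..v} r' = r v - r u" if "a \<le> u" "u \<le> v" "v \<le> b" for u v
  proof (intro integral_unique fundamental_theorem_of_calculus that)
    fix z assume "z \<in> {u..v}"
    then show "(r has_vector_derivative r' z) (at z within {u..v})"
      using that by (intro has_vector_derivative_within_subset[OF r]) auto
  qed
  have "integral {a..c} r' = r c - r a" "integral {c..b} r' = r b - r c" using c ftc by auto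
  then show ?thesis by (intro that[OF c]) (simp add: eq, simp add: algebra_simps)
qed

lemma continuous_on_Icc_bounded:
  fixes f :: "real \<Rightarrow> 'a::real_normed_vector"
  assumes "continuous_on {a..b} f"
  obtains B where "0 < B" "\<And>t. t \<in> {a..b} \<Longrightarrow> norm (f t) \<le> B"
  using compact_imp_bounded[OF compact_continuous_image[OF assms compact_Icc]]
  by (auto simp: bounded_pos)

lemma mono_integral_by_parts:
  fixes f g :: "real \<Rightarrow> 'a::euclidean_space"
  assumes x: "mono_on {a..b} x" "\<And>t. t \<in> {a..b} \<Longrightarrow> \<bar>x t\<bar> \<le> 1" and ab: "a \<le> b"
    and f: "continuous_on {a..b} f" and g: "continuous_on {a..b} g"
  shows "integral {a..b} (\<lambda>t. f t \<bullet> integral {t..b} (\<lambda>s. x s *\<^sub>R g s))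
    = integral {a..b} (\<lambda>s. x s * (integral {a..s} f \<bullet> g s))"
proof -
  define G where "G t = integral {t..b} (\<lambda>s. x s *\<^sub>R g s)" for t
  define F where "F t = integral {a..t} f" for t
  obtain Bf where Bf: "\<And>t. t \<in> {a..b} \<Longrightarrow> norm (f t) \<le> Bf"
    using continuous_on_Icc_bounded[OF f] by metis
  obtain Bg where Bg: "\<And>t. t \<in> {a..b} \<Longrightarrow> norm (g t) \<le> Bg"
    using continuous_on_Icc_bounded[OF g] by metis
  have xg: "(\<lambda>s. x s *\<^sub>R g s) integrable_on {a..b}" by (rule mono_scaleR_integrable[OF x(1) g])
  have xgb: "norm (x t *\<^sub>R g t) \<le> Bg" if "t \<in> {a..b}" for t
    using mult_mono[OF x(2)[OF that] Bg[OF that]] by simp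
  have Bg0: "0 \<le> Bg" and Bf0: "0 \<le> Bf"
    using order.trans[OF norm_ge_zero Bg[of a]] order.trans[OF norm_ge_zero Bf[of a]] ab by auto
  have fi: "f integrable_on {a..b}" by (rule integrable_continuous_real[OF f])
  have cG: "continuous_on {a..b} G" unfolding G_def
    by (rule lip_on_continuous[OF lip_on_integral(2)[OF xg xgb]])
  have cF: "continuous_on {a..b} F" unfolding F_def
    by (rule lip_on_continuous[OF lip_on_integral(1)[OF fi Bf]])
  have i1: "(\<lambda>t. f t \<bullet> G t) integrable_on {a..b}"
    by (intro integrable_continuous_real continuous_intros f cG)
  have i2: "(\<lambda>s. x s * (F s \<bullet> g s)) integrable_on {a..b}"
    by (intro mono_mult_integrable x continuous_intros cF g)
  define E where "E t = integral {a..t} (\<lambda>t. f t \<bullet> G t) - integral {a..t} (\<lambda>s. x s * (F s \<bullet> g s)) - F t \<bullet> G t" for t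
  have "E b = E a"
  proof (rule quadratic_increments_constant[where C = "2 * Bf * Bg" and f = E and a = a and b = b])
    fix s t assume st: "a \<le> s" "s \<le> t" "t \<le> b"
    have sub: "{s..t} \<subseteq> {a..b}" using st by auto
    have Ft: "F t = F s + integral {s..t} f"
      using integral_diff_interval(1)[OF fi st] unfolding F_def by (simp add: algebra_simps)
    have Gs: "G s = G t + integral {s..t} (\<lambda>s. x s *\<^sub>R g s)"
      using integral_diff_interval(2)[OF xg st] unfolding G_def by (simp add: algebra_simps)
    have fst: "f integrable_on {s..t}" and gst: "(\<lambda>s. x s *\<^sub>R g s) integrable_on {s..t}"
      using fi xg sub by (auto intro: integrable_subinterval_real)
    have j1: "(\<lambda>u. f u \<bullet> (G u - G t)) integrable_on {s..t}"
      by (intro integrable_continuous_real continuous_intros continuous_on_subset[OF f sub] continuous_on_subset[OF cG sub])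
    have j2: "(\<lambda>u. x u * ((F u - F s) \<bullet> g u)) integrable_on {s..t}"
      by (intro mono_mult_integrable mono_on_subset[OF x(1) sub] continuous_intros continuous_on_subset[OF cF sub] continuous_on_subset[OF g sub])
    have e1: "integral {s..t} (\<lambda>u. f u \<bullet> G u) = integral {s..t} (\<lambda>u. f u \<bullet> (G u - G t)) + integral {s..t} f \<bullet> G t"
    proof -
      have "integral {s..t} (\<lambda>u. f u \<bullet> G t) = integral {s..t} f \<bullet> G t"
        using integral_linear[OF fst bounded_linear_inner_left[of "G t"]] by (simp add: o_def)
      moreover have "(\<lambda>u. f u \<bullet> G t) integrable_on {s..t}"
        using integrable_linear[OF fst bounded_linear_inner_left[of "G t"]] by (simp add: o_def)
      ultimately show ?thesis using integral_add[OF j1, of "\<lambda>u. f u \<bullet> G t"]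
        by (simp add: inner_diff_right)
    qed
    have e2: "integral {s..t} (\<lambda>u. x u * (F u \<bullet> g u)) = integral {s..t} (\<lambda>u. x u * ((F u - F s) \<bullet> g u)) + F s \<bullet> integral {s..t} (\<lambda>s. x s *\<^sub>R g s)"
    proof -
      have "integral {s..t} (\<lambda>u. x u * (F s \<bullet> g u)) = F s \<bullet> integral {s..t} (\<lambda>s. x s *\<^sub>R g s)"
        using integral_linear[OF gst bounded_linear_inner_right[of "F s"]] by (simp add: o_def)
      moreover have "(\<lambda>u. x u * (F s \<bullet> g u)) integrable_on {s..t}"
        using integrable_linear[OF gst bounded_linear_inner_right[of "F s"]] by (simp add: o_def)
      ultimately show ?thesis using integral_add[OF j2, of "\<lambda>u. x u * (F s \<bullet> g u)"]
        by (simp add: inner_diff_left algebra_simps)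
    qed
    have "E t - E s = integral {s..t} (\<lambda>u. f u \<bullet> G u) - integral {s..t} (\<lambda>u. x u * (F u \<bullet> g u)) - (F t \<bullet> G t - F s \<bullet> G s)"
      using integral_diff_interval(1)[OF i1 st] integral_diff_interval(1)[OF i2 st] by (simp add: E_def)
    also have "F t \<bullet> G t - F s \<bullet> G s = integral {s..t} f \<bullet> G t - F s \<bullet> integral {s..t} (\<lambda>s. x s *\<^sub>R g s)"
      by (simp add: Ft Gs inner_add_left inner_add_right)
    finally have eq: "E t - E s = integral {s..t} (\<lambda>u. f u \<bullet> (G u - G t)) - integral {s..t} (\<lambda>u. x u * ((F u - F s) \<bullet> g u))"
      unfolding e1 e2 by simp
    have Gd: "norm (G u - G t) \<le> Bg * (t - s)" if "u \<in> {s..t}" for u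
    proof -
      have "G u - G t = integral {u..t} (\<lambda>s. x s *\<^sub>R g s)"
        using integral_diff_interval(2)[OF xg, of u t] that st unfolding G_def by auto
      also have "norm \<dots> \<le> Bg * (t - u)"
        using that sub xgb by (intro integral_norm_le integrable_subinterval_real[OF xg]) auto
      also have "\<dots> \<le> Bg * (t - s)" using that Bg0 by (intro mult_left_mono) auto
      finally show ?thesis .
    qed
    have Fd: "norm (F u - F s) \<le> Bf * (t - s)" if "u \<in> {s..t}" for u
    proof -
      have "F u - F s = integral {s..u} f"
        using integral_diff_interval(1)[OF fi, of s u] that st unfolding F_def by auto
      also have "norm \<dots> \<le> Bf * (u - s)"
        using that sub Bf by (intro integral_norm_le integrable_subinterval_real[OF fi]) auto
      also have "\<dots> \<le> Bf * (t - s)" using that Bf0 by (intro mult_left_mono) auto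
      finally show ?thesis .
    qed
    have "norm (integral {s..t} (\<lambda>u. f u \<bullet> (G u - G t))) \<le> (Bf * (Bg * (t - s))) * (t - s)"
    proof (rule integral_norm_le[OF j1 _ st(2)])
      fix u assume u: "u \<in> {s..t}"
      show "norm (f u \<bullet> (G u - G t)) \<le> Bf * (Bg * (t - s))"
        using Cauchy_Schwarz_ineq2[of "f u" "G u - G t"] mult_mono[OF Bf[of u] Gd[OF u]] u sub Bf0
        by (auto intro: order.trans)
    qed
    moreover have "norm (integral {s..t} (\<lambda>u. x u * ((F u - F s) \<bullet> g u))) \<le> (Bf * (t - s) * Bg) * (t - s)"
    proof (rule integral_norm_le[OF j2 _ st(2)])
      fix u assume u: "u \<in> {s..t}"
      have "\<bar>(F u - F s) \<bullet> g u\<bar> \<le> Bf * (t - s) * Bg"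
        using Cauchy_Schwarz_ineq2[of "F u - F s" "g u"] mult_mono[OF Fd[OF u] Bg[of u]] u sub Bf0 st
        by (auto intro: order.trans)
      moreover have "\<bar>x u\<bar> \<le> 1" using x(2) u sub by auto
      ultimately show "norm (x u * ((F u - F s) \<bullet> g u)) \<le> Bf * (t - s) * Bg"
        using mult_mono[of "\<bar>x u\<bar>" 1 "\<bar>(F u - F s) \<bullet> g u\<bar>" "Bf * (t - s) * Bg"] by (simp add: abs_mult)
    qed
    ultimately show "norm (E t - E s) \<le> 2 * Bf * Bg * (t - s)\<^sup>2"
      unfolding eq using norm_triangle_ineq4[of "integral {s..t} (\<lambda>u. f u \<bullet> (G u - G t))" "integral {s..t} (\<lambda>u. x u * ((F u - F s) \<bullet> g u))"]
      by (simp add: power2_eq_square algebra_simps)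
  qed (use ab in auto)
  moreover have "E a = 0" "E b = integral {a..b} (\<lambda>t. f t \<bullet> G t) - integral {a..b} (\<lambda>s. x s * (F s \<bullet> g s))"
    by (simp_all add: E_def F_def G_def)
  ultimately show ?thesis by (simp add: F_def G_def)
qed

text \<open>The approximation is a moving average of \<open>x\<close>.\<close>

lemma mono_lipschitz_approximation:
  fixes x :: "real \<Rightarrow> real"
  assumes x: "mono_on {0..M} x" "\<And>t. t \<in> {0..M} \<Longrightarrow> x t \<in> {0..1}" and T: "0 < T" "T < M" and e: "0 < e"
  obtains g where "lip_on {0..T} g" "\<And>t. t \<in> {0..T} \<Longrightarrow> x t \<le> g t" "\<And>t. t \<in> {0..T} \<Longrightarrow> g t \<le> 1"
    "integral {0..T} g \<le> integral {0..T} x + e"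
proof -
  define d where "d = min e (M - T)"
  have d: "0 < d" "d \<le> e" "T + d \<le> M" using T e by (auto simp: d_def)
  have xi: "x integrable_on {0..M}" by (rule mono_integrable[OF x(1)])
  have xb: "norm (x t) \<le> 1" if "t \<in> {0..M}" for t using x(2)[OF that] by auto
  define X where "X t = integral {0..t} x" for t
  have lX: "lip_on {0..M} X" unfolding X_def by (rule lip_on_integral[OF xi xb])
  have Xd: "X t - X s = integral {s..t} x" if "0 \<le> s" "s \<le> t" "t \<le> M" for s t
    unfolding X_def using integral_diff_interval(1)[OF xi that] .
  have Xup: "X t - X s \<le> (t - s) * x t" "(t - s) * x s \<le> X t - X s" if "0 \<le> s" "s \<le> t" "t \<le> M" for s t
  proof -
    have xst: "x integrable_on {s..t}" using that by (intro integrable_subinterval_real[OF xi]) auto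
    have "integral {s..t} x \<le> integral {s..t} (\<lambda>_. x t)"
      by (rule integral_le[OF xst]) (use that x in \<open>auto simp: mono_on_def\<close>)
    then show "X t - X s \<le> (t - s) * x t" using Xd[OF that] that by simp
    have "integral {s..t} (\<lambda>_. x s) \<le> integral {s..t} x"
      by (rule integral_le[OF _ xst]) (use that x in \<open>auto simp: mono_on_def\<close>)
    then show "(t - s) * x s \<le> X t - X s" using Xd[OF that] that by simp
  qed
  define g where "g t = (1 / d) *\<^sub>R (X (t + d) - X t)" for t
  obtain BX LX where BX: "\<And>t. t \<in> {0..M} \<Longrightarrow> norm (X t) \<le> BX"
    "\<And>s t. s \<in> {0..M} \<Longrightarrow> t \<in> {0..M} \<Longrightarrow> norm (X t - X s) \<le> LX * \<bar>t - s\<bar>" using lip_onE[OF lX] by metis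
  have lXd: "lip_on {0..T} (\<lambda>t. X (t + d))"
  proof (rule lip_onI)
    show "norm (X (t + d)) \<le> BX" if "t \<in> {0..T}" for t using that d by (intro BX) auto
    show "norm (X (t + d) - X (s + d)) \<le> LX * (t - s)" if "s \<in> {0..T}" "t \<in> {0..T}" "s \<le> t" for s t
      using BX(2)[of "s + d" "t + d"] that d by auto
  qed
  have lX0: "lip_on {0..T} X" by (rule lip_on_subset[OF lX]) (use T in auto)
  have lg: "lip_on {0..T} g" unfolding g_def by (intro lip_intros lXd lX0)
  have cX: "continuous_on {0..M} X" by (rule lip_on_continuous[OF lX])
  have Xi: "X integrable_on {0..M}" by (rule integrable_continuous_real[OF cX])
  have i1: "(\<lambda>t. X (t + d)) integrable_on {0..T}" "X integrable_on {0..T}"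
    using lip_on_continuous[OF lXd] lip_on_continuous[OF lX0] by (auto intro: integrable_continuous_real)
  have "integral {0..T} (\<lambda>t. X (t + d)) = integral {d..T+d} X"
    using integral_shift_real_ivl[of d d "T + d" X] by simp
  moreover have "integral {0..d} X + integral {d..T+d} X = integral {0..T} X + integral {T..T+d} X"
    using Henstock_Kurzweil_Integration.integral_combine[of 0 d "T+d" X] Henstock_Kurzweil_Integration.integral_combine[of 0 T "T+d" X] d T
      integrable_subinterval_real[OF Xi, of 0 "T + d"] by auto
  moreover have "0 \<le> integral {0..d} X"
  proof (rule integral_nonneg)
    show "X integrable_on {0..d}" using d T by (intro integrable_subinterval_real[OF Xi]) auto
    show "0 \<le> X t" if "t \<in> {0..d}" for t
      using Xup(2)[of 0 t] x(2)[of 0] that d T by (auto simp: X_def intro: order.trans[rotated])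
  qed
  moreover have "integral {T..T+d} X \<le> integral {T..T+d} (\<lambda>_. X T + d)"
  proof (rule integral_le)
    show "X integrable_on {T..T+d}" using d T by (intro integrable_subinterval_real[OF Xi]) auto
    fix t assume t: "t \<in> {T..T+d}"
    have "(t - T) * x t \<le> d * 1" using t x(2)[of t] d T by (intro mult_mono) auto
    then show "X t \<le> X T + d" using Xup(1)[of T t] t d T by auto
  qed auto
  ultimately have "integral {0..T} (\<lambda>t. X (t + d)) - integral {0..T} X \<le> d * (X T + d)" using d by simp
  moreover have "integral {0..T} g = (integral {0..T} (\<lambda>t. X (t + d)) - integral {0..T} X) / d"
    unfolding g_def using i1 by (simp add: integral_diff)
  ultimately have "integral {0..T} g \<le> X T + d" using d by (simp add: divide_le_eq mult.commute)
  show ?thesis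
  proof (rule that[OF lg])
    show "x t \<le> g t" if "t \<in> {0..T}" for t
      using Xup(2)[of t "t + d"] that d T by (simp add: g_def le_divide_eq mult.commute)
    show "g t \<le> 1" if "t \<in> {0..T}" for t
    proof -
      have "X (t + d) - X t \<le> d * x (t + d)" using Xup(1)[of t "t + d"] that d T by simp
      also have "\<dots> \<le> d * 1" using x(2)[of "t + d"] that d T by (intro mult_left_mono) auto
      finally show ?thesis using d by (simp add: g_def divide_le_eq)
    qed
    show "integral {0..T} g \<le> integral {0..T} x + e"
      using \<open>integral {0..T} g \<le> X T + d\<close> d by (simp add: X_def)
  qed
qed

subsection \<open>The mixture functions entrywise\<close>

definition xi_coeff :: "(nat \<Rightarrow> real^'m) \<Rightarrow> 'm \<Rightarrow> 'm \<Rightarrow> nat \<Rightarrow> real"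
  where "xi_coeff \<beta> i j n = (if 2 \<le> n then \<beta> n $ i * \<beta> n $ j else 0)"

definition xi_fun :: "nat \<Rightarrow> (nat \<Rightarrow> real^'m) \<Rightarrow> 'm \<Rightarrow> 'm \<Rightarrow> real \<Rightarrow> real"
  where "xi_fun k \<beta> i j s = (\<Sum>n. (diffs ^^ k) (xi_coeff \<beta> i j) n * s ^ n)"

lemma xi_coeff_summable:
  assumes "mixture \<beta>" "\<bar>s\<bar> < 2"
  shows "summable (\<lambda>n. (diffs ^^ k) (xi_coeff \<beta> i j) n * s ^ n)"
  using assms(2)
proof (induction k arbitrary: s)
  case 0
  have sm: "summable (\<lambda>p. 2 ^ (p + 2) * (\<beta> (p + 2) $ j)\<^sup>2)" for j
  proof -
    have "(\<lambda>p. 2 ^ p * (\<beta> p $ j)\<^sup>2) summable_on {2..}" using assms(1) by (auto simp: mixture_def)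
    moreover have "bij_betw (\<lambda>p. p + 2) UNIV {2::nat..}"
      by (rule bij_betwI[of _ _ _ "\<lambda>p. p - 2"]) auto
    ultimately have "(\<lambda>p. 2 ^ (p + 2) * (\<beta> (p + 2) $ j)\<^sup>2) summable_on UNIV"
      using summable_on_reindex_bij_betw[of "\<lambda>p. p + 2" UNIV "{2..}" "\<lambda>p. 2 ^ p * (\<beta> p $ j)\<^sup>2"] by simp
    then show ?thesis by (rule summable_on_imp_summable)
  qed
  have "summable (\<lambda>p. xi_coeff \<beta> i j (p + 2) * 2 ^ (p + 2))"
  proof (rule summable_comparison_test'[OF summable_add[OF sm[of i] sm[of j]]])
    fix p
    have "2 * \<bar>\<beta> (p + 2) $ i * \<beta> (p + 2) $ j\<bar> \<le> (\<beta> (p + 2) $ i)\<^sup>2 + (\<beta> (p + 2) $ j)\<^sup>2"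
      using sum_squares_bound[of "\<bar>\<beta> (p + 2) $ i\<bar>" "\<bar>\<beta> (p + 2) $ j\<bar>"] by (simp add: abs_mult)
    then have "\<bar>\<beta> (p + 2) $ i * \<beta> (p + 2) $ j\<bar> \<le> (\<beta> (p + 2) $ i)\<^sup>2 + (\<beta> (p + 2) $ j)\<^sup>2"
      using abs_ge_zero[of "\<beta> (p + 2) $ i * \<beta> (p + 2) $ j"] by linarith
    from mult_left_mono[OF this, of "2 ^ (p + 2)"]
    show "norm (xi_coeff \<beta> i j (p + 2) * 2 ^ (p + 2)) \<le> 2 ^ (p + 2) * (\<beta> (p + 2) $ i)\<^sup>2 + 2 ^ (p + 2) * (\<beta> (p + 2) $ j)\<^sup>2"
      by (simp add: xi_coeff_def abs_mult algebra_simps)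
  qed
  then have "summable (\<lambda>n. xi_coeff \<beta> i j n * 2 ^ n)" by (subst (asm) summable_iff_shift)
  from powser_inside[OF this] show ?case using 0 by simp
next
  case (Suc k)
  then show ?case using termdiff_converges[of s 2 "(diffs ^^ k) (xi_coeff \<beta> i j)"] by simp
qed

lemma xi_fun_derivative:
  assumes "mixture \<beta>" "\<bar>s\<bar> < 2"
  shows "(xi_fun k \<beta> i j has_field_derivative xi_fun (Suc k) \<beta> i j s) (at s)"
  unfolding xi_fun_def
  using termdiffs_strong'[of 2 "(diffs ^^ k) (xi_coeff \<beta> i j)" s] xi_coeff_summable[OF assms(1)] assms(2) by simp

lemma xi_fun_has_sum:
  assumes "mixture \<beta>" "\<bar>s\<bar> < 2"
  shows "((\<lambda>p. (diffs ^^ k) (xi_coeff \<beta> i j) (p - k) * s ^ (p - k)) has_sum xi_fun k \<beta> i j s) {k..}"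
proof -
  define d where "d = (diffs ^^ k) (xi_coeff \<beta> i j)"
  have r: "\<bar>s\<bar> < \<bar>(\<bar>s\<bar> + 2) / 2\<bar>" "\<bar>(\<bar>s\<bar> + 2) / 2\<bar> < 2" using assms(2) by auto
  have "summable (\<lambda>n. norm (d n * s ^ n))"
    by (rule powser_insidea[OF xi_coeff_summable[OF assms(1) r(2), of k i j, folded d_def]]) (use r in simp)
  moreover have "(\<lambda>n. d n * s ^ n) sums xi_fun k \<beta> i j s"
    unfolding xi_fun_def d_def using xi_coeff_summable[OF assms] by (rule summable_sums)
  ultimately have "((\<lambda>n. d n * s ^ n) has_sum xi_fun k \<beta> i j s) UNIV" by (rule norm_summable_imp_has_sum)
  also have "?this \<longleftrightarrow> ?thesis"
    unfolding d_def by (rule has_sum_reindex_bij_witness[of _ "\<lambda>p. p - k" "\<lambda>n. n + k"]) auto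
  finally show ?thesis .
qed

lemma has_sum_vecI:
  fixes f :: "'z \<Rightarrow> 'a::{real_normed_vector}^'n"
  assumes "\<And>i. ((\<lambda>a. f a $ i) has_sum (l $ i)) A" shows "(f has_sum l) A"
  using assms unfolding has_sum_def
  by (intro vec_tendstoI) (simp add: sum_component)

lemma xi_has_sum:
  assumes "mixture \<beta>" "\<And>i j. \<bar>A $ i $ j\<bar> < 2"
  shows "((\<lambda>p. real p *\<^sub>R ((\<beta> p \<otimes> \<beta> p) \<odot> A \<circ>^ (p - 1))) has_sum (\<chi> i j. xi_fun 1 \<beta> i j (A $ i $ j))) {2..}"
    "((\<lambda>p. (real p * (real p - 1)) *\<^sub>R ((\<beta> p \<otimes> \<beta> p) \<odot> A \<circ>^ (p - 2))) has_sum (\<chi> i j. xi_fun 2 \<beta> i j (A $ i $ j))) {2..}"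
    "((\<lambda>p. (real p * (real p - 1) * (real p - 2)) *\<^sub>R ((\<beta> p \<otimes> \<beta> p) \<odot> A \<circ>^ (p - 3))) has_sum (\<chi> i j. xi_fun 3 \<beta> i j (A $ i $ j))) {3..}"
proof -
  show "((\<lambda>p. real p *\<^sub>R ((\<beta> p \<otimes> \<beta> p) \<odot> A \<circ>^ (p - 1))) has_sum (\<chi> i j. xi_fun 1 \<beta> i j (A $ i $ j))) {2..}"
  proof (intro has_sum_vecI)
    fix i j
    show "((\<lambda>p. (real p *\<^sub>R ((\<beta> p \<otimes> \<beta> p) \<odot> A \<circ>^ (p - 1))) $ i $ j) has_sum (\<chi> i j. xi_fun 1 \<beta> i j (A $ i $ j)) $ i $ j) {2..}"
      using xi_fun_has_sum[OF assms, of 1 i j i j]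
      by (subst has_sum_cong_neutral[where T = "{1..}" and g = "\<lambda>p. (diffs ^^ 1) (xi_coeff \<beta> i j) (p - 1) * (A $ i $ j) ^ (p - 1)"])
         (auto simp: diffs_def xi_coeff_def hadamard_def outer_def hadamard_power_def of_nat_diff)
  qed
  show "((\<lambda>p. (real p * (real p - 1)) *\<^sub>R ((\<beta> p \<otimes> \<beta> p) \<odot> A \<circ>^ (p - 2))) has_sum (\<chi> i j. xi_fun 2 \<beta> i j (A $ i $ j))) {2..}"
  proof (intro has_sum_vecI)
    fix i j
    show "((\<lambda>p. ((real p * (real p - 1)) *\<^sub>R ((\<beta> p \<otimes> \<beta> p) \<odot> A \<circ>^ (p - 2))) $ i $ j) has_sum (\<chi> i j. xi_fun 2 \<beta> i j (A $ i $ j)) $ i $ j) {2..}"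
      using xi_fun_has_sum[OF assms, of 2 i j i j]
      by (subst has_sum_cong[where g = "\<lambda>p. (diffs ^^ 2) (xi_coeff \<beta> i j) (p - 2) * (A $ i $ j) ^ (p - 2)"])
         (auto simp: diffs_def xi_coeff_def hadamard_def outer_def hadamard_power_def of_nat_diff numeral_2_eq_2 Suc_diff_Suc)
  qed
  show "((\<lambda>p. (real p * (real p - 1) * (real p - 2)) *\<^sub>R ((\<beta> p \<otimes> \<beta> p) \<odot> A \<circ>^ (p - 3))) has_sum (\<chi> i j. xi_fun 3 \<beta> i j (A $ i $ j))) {3..}"
  proof (intro has_sum_vecI)
    fix i j
    show "((\<lambda>p. ((real p * (real p - 1) * (real p - 2)) *\<^sub>R ((\<beta> p \<otimes> \<beta> p) \<odot> A \<circ>^ (p - 3))) $ i $ j) has_sum (\<chi> i j. xi_fun 3 \<beta> i j (A $ i $ j)) $ i $ j) {3..}"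
      using xi_fun_has_sum[OF assms, of 3 i j i j]
      by (subst has_sum_cong[where g = "\<lambda>p. (diffs ^^ 3) (xi_coeff \<beta> i j) (p - 3) * (A $ i $ j) ^ (p - 3)"])
         (auto simp: diffs_def xi_coeff_def hadamard_def outer_def hadamard_power_def of_nat_diff numeral_3_eq_3 Suc_diff_Suc)
  qed
qed

lemma xi_eq:
  assumes "mixture \<beta>" "\<And>i j. \<bar>A $ i $ j\<bar> < 2"
  shows "xi1 \<beta> A = (\<chi> i j. xi_fun 1 \<beta> i j (A $ i $ j))"
    "xi2 \<beta> A = (\<chi> i j. xi_fun 2 \<beta> i j (A $ i $ j))"
    "xi3 \<beta> A = (\<chi> i j. xi_fun 3 \<beta> i j (A $ i $ j))"
  unfolding xi1_def xi2_def xi3_def by (rule infsumI xi_has_sum assms)+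

lemma hadamard_power_psd: "A \<in> psd \<Longrightarrow> A \<circ>^ n \<in> psd"
proof (induction n)
  case 0
  have "A \<circ>^ 0 = 1 \<otimes> 1" by (simp add: hadamard_power_def outer_def vec_eq_iff)
  then show ?case by (simp add: psd_outer)
next
  case (Suc n)
  have "A \<circ>^ Suc n = A \<odot> A \<circ>^ n" by (simp add: hadamard_power_def hadamard_def vec_eq_iff)
  then show ?case using Suc by (simp add: hadamard_psd)
qed

lemma xi2_psd:
  assumes \<beta>: "mixture \<beta>" and A: "A \<in> psd" "\<And>i j. \<bar>A $ i $ j\<bar> < 2"
  shows "xi2 \<beta> A \<in> psd"
proof -
  have "(real p * (real p - 1)) *\<^sub>R ((\<beta> p \<otimes> \<beta> p) \<odot> A \<circ>^ (p - 2)) \<in> psd" for p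
    by (cases p) (auto intro!: psd_scaleR hadamard_psd psd_outer hadamard_power_psd A)
  then have "\<forall>\<^sub>F F in finite_subsets_at_top {2..}. (\<Sum>p\<in>F. (real p * (real p - 1)) *\<^sub>R ((\<beta> p \<otimes> \<beta> p) \<odot> A \<circ>^ (p - 2))) \<in> psd"
    by (intro always_eventually allI psd_sum)
  from Lim_in_closed_set[OF closed_psd this _ xi_has_sum(2)[OF \<beta> A(2), unfolded has_sum_def]]
  show ?thesis by (simp add: xi_eq[OF \<beta> A(2)])
qed

lemma xi_fun_bounds:
  assumes "mixture \<beta>"
  obtains B where "0 < B" "\<And>i j s. \<bar>s\<bar> \<le> 1 \<Longrightarrow> \<bar>xi_fun k \<beta> i j s\<bar> \<le> B"
    "\<And>i j s t. \<bar>s\<bar> \<le> 1 \<Longrightarrow> \<bar>t\<bar> \<le> 1 \<Longrightarrow> \<bar>xi_fun k \<beta> i j t - xi_fun k \<beta> i j s\<bar> \<le> B * \<bar>t - s\<bar>"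
proof -
  have cont: "continuous_on {-1..1} (xi_fun k \<beta> i j)" for k i j
    by (intro continuous_at_imp_continuous_on ballI DERIV_isCont[OF xi_fun_derivative[OF assms]]) auto
  have "\<exists>B. \<forall>s. \<bar>s\<bar> \<le> 1 \<longrightarrow> \<bar>xi_fun k \<beta> i j s\<bar> \<le> B" for k i j
  proof -
    obtain B where "\<And>s. s \<in> {-1..1} \<Longrightarrow> norm (xi_fun k \<beta> i j s) \<le> B"
      using continuous_on_Icc_bounded[OF cont] by metis
    then have "\<bar>xi_fun k \<beta> i j s\<bar> \<le> B" if "\<bar>s\<bar> \<le> 1" for s using that by (simp add: abs_le_iff)
    then show ?thesis by blast
  qed
  note ex = this
  define b where "b k i j = (SOME B. \<forall>s. \<bar>s\<bar> \<le> 1 \<longrightarrow> \<bar>xi_fun k \<beta> i j s\<bar> \<le> B)" for k i j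
  have b: "\<bar>xi_fun k \<beta> i j s\<bar> \<le> b k i j" if "\<bar>s\<bar> \<le> 1" for k i j s
    using someI_ex[OF ex, of k i j] that unfolding b_def by blast
  define B where "B = 1 + (\<Sum>i\<in>UNIV. \<Sum>j\<in>UNIV. b k i j + b (Suc k) i j)"
  have b0: "0 \<le> b k i j" for k i j using order.trans[OF abs_ge_zero b[of 0 k i j]] by simp
  have s1: "b k i j + b (Suc k) i j \<le> (\<Sum>j\<in>UNIV. b k i j + b (Suc k) i j)" for i j
    by (rule member_le_sum[where f = "\<lambda>j. b k i j + b (Suc k) i j"]) (simp_all add: b0 add_nonneg_nonneg)
  have s2: "(\<Sum>j\<in>UNIV. b k i j + b (Suc k) i j) \<le> (\<Sum>i\<in>UNIV. \<Sum>j\<in>UNIV. b k i j + b (Suc k) i j)" for i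
    by (rule member_le_sum[where f = "\<lambda>i. \<Sum>j\<in>UNIV. b k i j + b (Suc k) i j"])
      (simp_all add: sum_nonneg b0 add_nonneg_nonneg)
  have le: "b k i j + b (Suc k) i j \<le> B" for i j
    using order.trans[OF s1 s2, of i j] unfolding B_def by linarith
  have B1: "b k i j \<le> B" "b (Suc k) i j \<le> B" for i j using le[of i j] b0[of k i j] b0[of "Suc k" i j] by linarith+
  show ?thesis
  proof (rule that[of B])
    show "0 < B" unfolding B_def by (intro add_pos_nonneg sum_nonneg) (auto simp: b0 add_nonneg_nonneg)
    show "\<bar>xi_fun k \<beta> i j s\<bar> \<le> B" if "\<bar>s\<bar> \<le> 1" for i j s by (rule order.trans[OF b[OF that] B1(1)])
    fix i j s t assume st: "\<bar>s::real\<bar> \<le> 1" "\<bar>t::real\<bar> \<le> 1"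
    have "norm (xi_fun k \<beta> i j t - xi_fun k \<beta> i j s) \<le> B * norm (t - s)"
    proof (rule field_differentiable_bound[where S = "{-1..1}" and f' = "xi_fun (Suc k) \<beta> i j"])
      fix z :: real assume z: "z \<in> {-1..1}"
      then show "(xi_fun k \<beta> i j has_field_derivative xi_fun (Suc k) \<beta> i j z) (at z within {-1..1})"
        by (intro has_field_derivative_at_within[OF xi_fun_derivative[OF assms]]) auto
      have "\<bar>z\<bar> \<le> 1" using z by (simp add: abs_le_iff)
      from order.trans[OF b[OF this] B1(2)] show "norm (xi_fun (Suc k) \<beta> i j z) \<le> B" unfolding real_norm_def .
    qed (use st in \<open>simp_all add: abs_le_iff\<close>)
    then show "\<bar>xi_fun k \<beta> i j t - xi_fun k \<beta> i j s\<bar> \<le> B * \<bar>t - s\<bar>" by simp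
  qed
qed

lemma xi_fun_taylor:
  assumes "mixture \<beta>"
  obtains B where "0 < B" "\<And>i j s t. \<bar>s\<bar> \<le> 1 \<Longrightarrow> \<bar>t\<bar> \<le> 1 \<Longrightarrow>
    \<bar>xi_fun k \<beta> i j t - xi_fun k \<beta> i j s - xi_fun (Suc k) \<beta> i j s * (t - s)\<bar> \<le> B * (t - s)\<^sup>2"
proof -
  obtain B where B: "0 < B" "\<And>i j s t. \<bar>s\<bar> \<le> 1 \<Longrightarrow> \<bar>t\<bar> \<le> 1 \<Longrightarrow> \<bar>xi_fun (Suc k) \<beta> i j t - xi_fun (Suc k) \<beta> i j s\<bar> \<le> B * \<bar>t - s\<bar>"
    using xi_fun_bounds[OF assms, of "Suc k"] by metis
  show ?thesis
  proof (rule that[OF B(1)])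
    fix i j and s t :: real assume st: "\<bar>s\<bar> \<le> 1" "\<bar>t\<bar> \<le> 1"
    define f where "f z = xi_fun k \<beta> i j z - xi_fun (Suc k) \<beta> i j s * z" for z
    have "norm (f t - f s) \<le> (B * \<bar>t - s\<bar>) * norm (t - s)"
    proof (rule field_differentiable_bound[where S = "{min s t..max s t}" and f' = "\<lambda>z. xi_fun (Suc k) \<beta> i j z - xi_fun (Suc k) \<beta> i j s"])
      fix z :: real assume z: "z \<in> {min s t..max s t}"
      have z1: "\<bar>z\<bar> \<le> 1" using z st by auto
      show "(f has_field_derivative xi_fun (Suc k) \<beta> i j z - xi_fun (Suc k) \<beta> i j s) (at z within {min s t..max s t})"
        unfolding f_def using z1
        by (auto intro!: derivative_eq_intros has_field_derivative_at_within[OF xi_fun_derivative[OF assms]])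
      have "\<bar>z - s\<bar> \<le> \<bar>t - s\<bar>" using z by auto
      then show "norm (xi_fun (Suc k) \<beta> i j z - xi_fun (Suc k) \<beta> i j s) \<le> B * \<bar>t - s\<bar>"
        using B(2)[OF st(1) z1, of i j] B(1) by (auto intro: order.trans mult_left_mono)
    qed auto
    then show "\<bar>xi_fun k \<beta> i j t - xi_fun k \<beta> i j s - xi_fun (Suc k) \<beta> i j s * (t - s)\<bar> \<le> B * (t - s)\<^sup>2"
      by (simp add: f_def power2_eq_square abs_mult[symmetric] algebra_simps)
  qed
qed

subsection \<open>Monotone matrix paths\<close>

lemma psd_integral:
  fixes f :: "real \<Rightarrow> real^'n^'n"
  assumes f: "f integrable_on {a..b}" and psd: "\<And>t. t \<in> {a..b} \<Longrightarrow> f t \<in> psd"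
  shows "integral {a..b} f \<in> psd"
proof (rule psdI)
  have "transpose (integral {a..b} f) = integral {a..b} (\<lambda>t. transpose (f t))"
    using integral_linear[OF f bounded_linear_transpose] by (simp add: o_def)
  also have "\<dots> = integral {a..b} f" by (rule integral_cong) (simp add: psd psd_sym)
  finally show "transpose (integral {a..b} f) = integral {a..b} f" .
  fix v
  have bl: "bounded_linear (\<lambda>A :: real^'n^'n. v \<bullet> (A *v v))"
    by (rule bounded_linear_compose[OF bounded_linear_inner_right bounded_linear_mv])
  have "v \<bullet> (integral {a..b} f *v v) = integral {a..b} (\<lambda>t. v \<bullet> (f t *v v))"
    using integral_linear[OF f bl] by (simp add: o_def)
  also have "\<dots> \<ge> 0"
    using integrable_linear[OF f bl] by (intro integral_nonneg) (auto simp: o_def psd psd_nonneg)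
  finally show "0 \<le> v \<bullet> (integral {a..b} f *v v)" .
qed

lemma has_vector_derivative_matrixI:
  fixes f :: "real \<Rightarrow> real^'n^'m"
  assumes "\<And>i j. ((\<lambda>t. f t $ i $ j) has_field_derivative f' $ i $ j) (at t within I)"
  shows "(f has_vector_derivative f') (at t within I)"
  using assms unfolding has_real_derivative_iff_has_vector_derivative has_vector_derivative_def has_derivative_within
  by (auto intro!: vec_tendstoI bounded_linear_scaleR_left)

definition Xi :: "(nat \<Rightarrow> real^'m) \<Rightarrow> real^'m \<Rightarrow> real^'m^'m \<Rightarrow> real"
  where "Xi \<beta> h A = (\<Sum>i\<in>UNIV. \<Sum>j\<in>UNIV. xi_fun 0 \<beta> i j (A $ i $ j)) + (h \<otimes> h) \<bullet> A"

locale increasing_path =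
  fixes M :: real and \<beta> :: "nat \<Rightarrow> real^'m" and h :: "real^'m" and Q :: "real^'m^'m"
    and x :: "real \<Rightarrow> real" and \<Phi> \<phi> :: "real \<Rightarrow> real^'m^'m"
  assumes M: "M = real CARD('m)"
    and \<beta>: "mixture \<beta>" and Q: "constraint_matrix Q" and x: "order_fun M x"
    and \<Phi>_0: "\<Phi> 0 = 0" and \<Phi>_M: "\<Phi> M = Q"
    and deriv: "t \<in> {0..M} \<Longrightarrow> (\<Phi> has_vector_derivative \<phi> t) (at t within {0..M})"
    and lip_\<phi>: "lip_on {0..M} \<phi>"
    and psd_\<phi>: "t \<in> {0..M} \<Longrightarrow> \<phi> t \<in> psd"
begin

lemma M_pos: "0 < M" by (simp add: M)

lemma x_mono: "0 \<le> s \<Longrightarrow> s \<le> t \<Longrightarrow> t \<le> M \<Longrightarrow> x s \<le> x t"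
  using x by (auto simp: order_fun_def mono_on_def)

lemma x_range: "t \<in> {0..M} \<Longrightarrow> 0 \<le> x t \<and> x t \<le> 1"
  using x by (auto simp: order_fun_def image_subset_iff)

lemma x_mono_on: "0 \<le> a \<Longrightarrow> b \<le> M \<Longrightarrow> mono_on {a..b} x"
  using x_mono by (auto simp: mono_on_def)

lemma cont_\<phi>: "continuous_on {0..M} \<phi>" by (rule lip_on_continuous[OF lip_\<phi>])

lemma int_\<phi>: "\<phi> integrable_on {0..M}" by (rule integrable_continuous_real[OF cont_\<phi>])

lemma \<Phi>_diff:
  assumes "0 \<le> s" "s \<le> t" "t \<le> M" shows "\<Phi> t - \<Phi> s = integral {s..t} \<phi>"
proof -
  have "(\<phi> has_integral \<Phi> t - \<Phi> s) {s..t}"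
  proof (rule fundamental_theorem_of_calculus[OF assms(2)])
    fix u assume "u \<in> {s..t}"
    then show "(\<Phi> has_vector_derivative \<phi> u) (at u within {s..t})"
      using assms by (intro has_vector_derivative_within_subset[OF deriv]) auto
  qed
  then show ?thesis by (simp add: integral_unique)
qed

lemma \<Phi>_integral: "t \<in> {0..M} \<Longrightarrow> \<Phi> t = integral {0..t} \<phi>"
  using \<Phi>_diff[of 0 t] \<Phi>_0 by simp

lemma \<Phi>_increasing:
  assumes "0 \<le> s" "s \<le> t" "t \<le> M" shows "\<Phi> t - \<Phi> s \<in> psd"
  unfolding \<Phi>_diff[OF assms]
  using assms by (intro psd_integral integrable_subinterval_real[OF int_\<phi>] psd_\<phi>) auto

lemma \<Phi>_psd: "t \<in> {0..M} \<Longrightarrow> \<Phi> t \<in> psd"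
  using \<Phi>_increasing[of 0 t] \<Phi>_0 by simp

lemma lip_\<Phi>: "lip_on {0..M} \<Phi>"
proof -
  obtain B where "\<And>t. t \<in> {0..M} \<Longrightarrow> norm (\<phi> t) \<le> B" using continuous_on_Icc_bounded[OF cont_\<phi>] by metis
  from lip_on_integral(1)[OF int_\<phi> this] show ?thesis
    by (subst lip_on_cong[OF \<Phi>_integral]) auto
qed

lemma \<Phi>_entries:
  assumes "t \<in> {0..M}" shows "\<bar>\<Phi> t $ i $ j\<bar> \<le> 1"
proof -
  have "\<Phi> t $ i $ i \<le> 1" for i
    using psd_diag_nonneg[OF \<Phi>_increasing[of t M], of i] assms Q by (simp add: \<Phi>_M constraint_matrix_def)
  from add_mono[OF this[of i] this[of j]] show ?thesis
    by (intro order.trans[OF psd_entry_le[OF \<Phi>_psd[OF assms], of i j]]) simp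
qed

lemma path_deriv_eq: "t \<in> {0..M} \<Longrightarrow> path_deriv \<Phi> t = \<phi> t"
  unfolding path_deriv_def M[symmetric]
  using M_pos by (intro vector_derivative_within_closed_interval) (auto intro: deriv)

lemma xi_entries:
  assumes "t \<in> {0..M}"
  shows "xi1 \<beta> (\<Phi> t) = (\<chi> i j. xi_fun 1 \<beta> i j (\<Phi> t $ i $ j))"
    "xi2 \<beta> (\<Phi> t) = (\<chi> i j. xi_fun 2 \<beta> i j (\<Phi> t $ i $ j))"
    "xi3 \<beta> (\<Phi> t) = (\<chi> i j. xi_fun 3 \<beta> i j (\<Phi> t $ i $ j))"
proof -
  have *: "\<bar>\<Phi> t $ i $ j\<bar> < 2" for i j using \<Phi>_entries[OF assms, of i j] by linarith
  show "xi1 \<beta> (\<Phi> t) = (\<chi> i j. xi_fun 1 \<beta> i j (\<Phi> t $ i $ j))"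
    "xi2 \<beta> (\<Phi> t) = (\<chi> i j. xi_fun 2 \<beta> i j (\<Phi> t $ i $ j))"
    "xi3 \<beta> (\<Phi> t) = (\<chi> i j. xi_fun 3 \<beta> i j (\<Phi> t $ i $ j))"
    by (rule xi_eq[OF \<beta> *])+
qed

lemma lip_xi_fun: "lip_on {0..M} (\<lambda>t. xi_fun k \<beta> i j (\<Phi> t $ i $ j))"
proof -
  obtain B where B: "0 < B" "\<And>i j s. \<bar>s\<bar> \<le> 1 \<Longrightarrow> \<bar>xi_fun k \<beta> i j s\<bar> \<le> B"
    "\<And>i j s t. \<bar>s\<bar> \<le> 1 \<Longrightarrow> \<bar>t\<bar> \<le> 1 \<Longrightarrow> \<bar>xi_fun k \<beta> i j t - xi_fun k \<beta> i j s\<bar> \<le> B * \<bar>t - s\<bar>"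
    using xi_fun_bounds[OF \<beta>] by metis
  obtain L where L: "\<And>s t. s \<in> {0..M} \<Longrightarrow> t \<in> {0..M} \<Longrightarrow> norm (\<Phi> t - \<Phi> s) \<le> L * \<bar>t - s\<bar>"
    using lip_onE[OF lip_\<Phi>] by metis
  show ?thesis
  proof (rule lip_onI)
    show "norm (xi_fun k \<beta> i j (\<Phi> t $ i $ j)) \<le> B" if "t \<in> {0..M}" for t
      using B(2)[OF \<Phi>_entries[OF that]] by simp
    fix s t assume st: "s \<in> {0..M}" "t \<in> {0..M}" "s \<le> t"
    have "\<bar>\<Phi> t $ i $ j - \<Phi> s $ i $ j\<bar> \<le> norm (\<Phi> t - \<Phi> s)"
      using order.trans[OF component_le_norm_cart Finite_Cartesian_Product.norm_nth_le, of "\<Phi> t - \<Phi> s" i j] by simp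
    also have "\<dots> \<le> L * (t - s)" using L[OF st(1,2)] st(3) by simp
    finally have "B * \<bar>\<Phi> t $ i $ j - \<Phi> s $ i $ j\<bar> \<le> B * (L * (t - s))" using B(1) by simp
    then show "norm (xi_fun k \<beta> i j (\<Phi> t $ i $ j) - xi_fun k \<beta> i j (\<Phi> s $ i $ j)) \<le> B * L * (t - s)"
      using B(3)[OF \<Phi>_entries[OF st(1), of i j] \<Phi>_entries[OF st(2), of i j], of i j] by (simp add: mult.assoc)
  qed
qed

lemma xi_fun_commute: "xi_fun k \<beta> i j = xi_fun k \<beta> j i"
proof -
  have "xi_coeff \<beta> i j = xi_coeff \<beta> j i" by (simp add: xi_coeff_def fun_eq_iff mult.commute)
  then show ?thesis by (intro ext) (simp only: xi_fun_def)
qed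

definition p :: "real \<Rightarrow> real^'m^'m" where "p t = xi1 \<beta> (\<Phi> t) + h \<otimes> h"

definition S :: "real \<Rightarrow> real^'m^'m" where "S t = xi2 \<beta> (\<Phi> t) \<odot> \<phi> t"

lemma entry_deriv:
  assumes "t \<in> {0..M}"
  shows "((\<lambda>t. \<Phi> t $ i $ j) has_field_derivative \<phi> t $ i $ j) (at t within {0..M})"
proof -
  have "bounded_linear (\<lambda>A :: real^'m^'m. A $ i $ j)"
    by (rule bounded_linear_compose[OF bounded_linear_vec_nth bounded_linear_vec_nth])
  from bounded_linear.has_vector_derivative[OF this deriv[OF assms]]
  show ?thesis by (simp add: has_real_derivative_iff_has_vector_derivative)
qed

lemma xi_fun_deriv:
  assumes "t \<in> {0..M}"
  shows "((\<lambda>t. xi_fun k \<beta> i j (\<Phi> t $ i $ j)) has_field_derivative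
    xi_fun (Suc k) \<beta> i j (\<Phi> t $ i $ j) * \<phi> t $ i $ j) (at t within {0..M})"
proof -
  have "\<bar>\<Phi> t $ i $ j\<bar> < 2" using \<Phi>_entries[OF assms, of i j] by linarith
  from DERIV_chain2[OF xi_fun_derivative[OF \<beta> this] entry_deriv[OF assms]] show ?thesis .
qed

lemma p_deriv:
  assumes "t \<in> {0..M}"
  shows "(p has_vector_derivative S t) (at t within {0..M})"
proof -
  have "((\<lambda>t. (\<chi> i j. xi_fun 1 \<beta> i j (\<Phi> t $ i $ j)) + h \<otimes> h) has_vector_derivative S t) (at t within {0..M})"
  proof (rule has_vector_derivative_matrixI)
    fix i j
    show "((\<lambda>t. ((\<chi> i j. xi_fun 1 \<beta> i j (\<Phi> t $ i $ j)) + h \<otimes> h) $ i $ j) has_field_derivative S t $ i $ j) (at t within {0..M})"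
      using xi_fun_deriv[OF assms, of 1 i j]
      by (auto intro!: derivative_eq_intros simp: S_def hadamard_def xi_entries[OF assms] numeral_2_eq_2)
  qed
  then show ?thesis
    by (rule has_vector_derivative_transform[OF assms, rotated]) (simp add: p_def xi_entries)
qed

lemma lip_p: "lip_on {0..M} p"
  unfolding p_def
proof (rule lip_on_add[OF _ lip_on_const])
  show "lip_on {0..M} (\<lambda>t. xi1 \<beta> (\<Phi> t))"
    by (subst lip_on_cong[OF xi_entries(1)]) (auto intro!: lip_on_vec lip_xi_fun[unfolded One_nat_def])
qed

lemma lip_S: "lip_on {0..M} S"
proof -
  have *: "lip_on {0..M} (\<lambda>t. \<phi> t $ i $ j)" for i j
    by (rule lip_on_linear[OF bounded_linear_compose[OF bounded_linear_vec_nth bounded_linear_vec_nth] lip_\<phi>])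
  show ?thesis
    unfolding S_def hadamard_def
    by (subst lip_on_cong[where g = "\<lambda>t. \<chi> i j. xi_fun 2 \<beta> i j (\<Phi> t $ i $ j) * \<phi> t $ i $ j"])
       (auto simp: xi_entries intro!: lip_on_vec lip_on_mult lip_xi_fun *)
qed

lemma S_psd: "t \<in> {0..M} \<Longrightarrow> S t \<in> psd"
  unfolding S_def
proof (intro hadamard_psd psd_\<phi> xi2_psd \<beta> \<Phi>_psd)
  fix i j assume "t \<in> {0..M}"
  from \<Phi>_entries[OF this, of i j] show "\<bar>\<Phi> t $ i $ j\<bar> < 2" by linarith
qed

lemma p_sym:
  assumes "t \<in> {0..M}" shows "transpose (p t) = p t"
proof -
  have "\<Phi> t $ i $ j = \<Phi> t $ j $ i" for i j
    using psd_sym[OF \<Phi>_psd[OF assms]] by (simp add: transpose_def vec_eq_iff)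
  then show ?thesis
    by (simp add: p_def xi_entries[OF assms] transpose_add transpose_outer)
       (simp add: transpose_def vec_eq_iff, metis xi_fun_commute)
qed

lemma Xi_deriv:
  assumes "t \<in> {0..M}"
  shows "((\<lambda>t. Xi \<beta> h (\<Phi> t)) has_vector_derivative p t \<bullet> \<phi> t) (at t within {0..M})"
proof -
  have d: "((\<lambda>t. (h \<otimes> h) \<bullet> \<Phi> t) has_field_derivative (h \<otimes> h) \<bullet> \<phi> t) (at t within {0..M})"
    using bounded_linear.has_vector_derivative[OF bounded_linear_inner_right deriv[OF assms]]
    by (simp add: has_real_derivative_iff_has_vector_derivative)
  have "((\<lambda>t. Xi \<beta> h (\<Phi> t)) has_field_derivative
    (\<Sum>i\<in>UNIV. \<Sum>j\<in>UNIV. xi_fun 1 \<beta> i j (\<Phi> t $ i $ j) * \<phi> t $ i $ j) + (h \<otimes> h) \<bullet> \<phi> t) (at t within {0..M})"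
    unfolding Xi_def using xi_fun_deriv[OF assms, of 0]
    by (intro DERIV_add DERIV_sum d) auto
  then show ?thesis
    by (simp add: has_real_derivative_iff_has_vector_derivative p_def inner_add_left xi_entries[OF assms] inner_matrix sum.distrib distrib_right)
qed

lemma Xi_diff:
  assumes "0 \<le> s" "s \<le> t" "t \<le> M"
  shows "integral {s..t} (\<lambda>u. p u \<bullet> \<phi> u) = Xi \<beta> h (\<Phi> t) - Xi \<beta> h (\<Phi> s)"
proof -
  have "((\<lambda>u. p u \<bullet> \<phi> u) has_integral Xi \<beta> h (\<Phi> t) - Xi \<beta> h (\<Phi> s)) {s..t}"
  proof (rule fundamental_theorem_of_calculus[OF assms(2)])
    fix u assume "u \<in> {s..t}"
    then show "((\<lambda>t. Xi \<beta> h (\<Phi> t)) has_vector_derivative p u \<bullet> \<phi> u) (at u within {s..t})"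
      using assms by (intro has_vector_derivative_within_subset[OF Xi_deriv]) auto
  qed
  then show ?thesis by (simp add: integral_unique)
qed

end

locale truncated_path = increasing_path M \<beta> h Q x \<Phi> \<phi>
  for M :: real and \<beta> :: "nat \<Rightarrow> real^'m" and h :: "real^'m" and Q :: "real^'m^'m"
    and x :: "real \<Rightarrow> real" and \<Phi> \<phi> :: "real \<Rightarrow> real^'m^'m" +
  fixes T c :: real
  assumes T: "\<exists>t\<in>{0..<T}. x t = 1" "T < M" and c: "0 < c" "pd c (Q - \<Phi> T)"
begin

lemma T_pos: "0 < T" using T by auto

lemma x_1: "t \<in> {T..M} \<Longrightarrow> x t = 1"
proof -
  assume t: "t \<in> {T..M}"
  obtain s where "s \<in> {0..<T}" "x s = 1" using T by auto
  then show "x t = 1" using x_mono[of s t] x_range[of t] t by force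
qed

lemma x_T: "x T = 1" using x_1 T by simp

definition hat :: "real \<Rightarrow> real^'m^'m" where "hat t = Q - \<Phi> T + integral {t..T} (\<lambda>s. x s *\<^sub>R \<phi> s)"

definition X :: "real \<Rightarrow> real^'m^'m" where "X t = matrix_inv (hat t)"

lemma int_x\<phi>: "0 \<le> a \<Longrightarrow> b \<le> M \<Longrightarrow> (\<lambda>s. x s *\<^sub>R \<phi> s) integrable_on {a..b}"
  by (intro mono_scaleR_integrable x_mono_on continuous_on_subset[OF cont_\<phi>]) auto

lemma path_hat_eq:
  assumes "t \<in> {0..T}" shows "path_hat x \<Phi> t = hat t"
proof -
  have "path_hat x \<Phi> t = integral {t..M} (\<lambda>s. x s *\<^sub>R \<phi> s)"
    unfolding path_hat_def M[symmetric]
    using assms by (intro integral_cong) (simp add: path_deriv_eq)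
  also have "\<dots> = integral {t..T} (\<lambda>s. x s *\<^sub>R \<phi> s) + integral {T..M} (\<lambda>s. x s *\<^sub>R \<phi> s)"
    using Henstock_Kurzweil_Integration.integral_combine[OF _ _ int_x\<phi>[of t M], of T] assms T by auto
  also have "integral {T..M} (\<lambda>s. x s *\<^sub>R \<phi> s) = integral {T..M} \<phi>"
    by (rule integral_cong) (simp add: x_1)
  also have "\<dots> = Q - \<Phi> T" using \<Phi>_diff[of T M] T T_pos \<Phi>_M by simp
  finally show ?thesis by (simp add: hat_def add.commute)
qed

lemma hat_diff:
  assumes "0 \<le> s" "s \<le> t" "t \<le> T"
  shows "hat s - hat t = integral {s..t} (\<lambda>s. x s *\<^sub>R \<phi> s)"
  using integral_diff_interval(2)[OF int_x\<phi>[of 0 T] assms] T unfolding hat_def by simp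

lemma hat_decreasing:
  assumes "0 \<le> s" "s \<le> t" "t \<le> T" shows "hat s - hat t \<in> psd"
  unfolding hat_diff[OF assms]
  using assms T by (intro psd_integral int_x\<phi> psd_scaleR psd_\<phi>) (auto simp: x_range)

lemma hat_T: "hat T = Q - \<Phi> T" by (simp add: hat_def)

lemma pd_hat: "t \<in> {0..T} \<Longrightarrow> pd c (hat t)"
  using hat_decreasing[of t T] by (intro pd_mono[OF c(2)]) (auto simp: hat_T)

lemma hat_psd: "t \<in> {0..T} \<Longrightarrow> hat t \<in> psd"
  using pd_psd[OF pd_hat] c by simp

lemma hat_invertible: "t \<in> {0..T} \<Longrightarrow> invertible (hat t)"
  using pd_invertible[OF pd_hat] c by simp

lemma X_hat: "t \<in> {0..T} \<Longrightarrow> X t ** hat t = mat 1" "t \<in> {0..T} \<Longrightarrow> hat t ** X t = mat 1"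
  by (simp_all add: X_def matrix_inv_mult hat_invertible)

lemma X_psd: "t \<in> {0..T} \<Longrightarrow> X t \<in> psd"
  unfolding X_def by (intro matrix_inv_psd hat_psd hat_invertible)

lemma lip_hat: "lip_on {0..T} hat"
proof -
  obtain B where "0 < B" "\<And>t. t \<in> {0..M} \<Longrightarrow> norm (\<phi> t) \<le> B" using continuous_on_Icc_bounded[OF cont_\<phi>] by metis
  then have "norm (x t *\<^sub>R \<phi> t) \<le> B" if "t \<in> {0..T}" for t
    using mult_mono[of "\<bar>x t\<bar>" 1 "norm (\<phi> t)" B] x_range[of t] that T by simp
  from lip_on_integral(2)[OF int_x\<phi> this]
  show ?thesis unfolding hat_def using T by (intro lip_intros) auto
qed

lemma X_diff:
  assumes "s \<in> {0..T}" "t \<in> {0..T}" shows "X t - X s = X s ** (hat s - hat t) ** X t"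
  unfolding X_def using assms by (intro matrix_inv_diff hat_invertible)

lemma lip_X: "lip_on {0..T} X"
proof -
  obtain L where L: "\<And>s t. s \<in> {0..T} \<Longrightarrow> t \<in> {0..T} \<Longrightarrow> norm (hat t - hat s) \<le> L * \<bar>t - s\<bar>"
    using lip_onE[OF lip_hat] by metis
  have B: "norm (X t) \<le> M / c" if "t \<in> {0..T}" for t
    unfolding X_def M using pd_norm_inv[OF pd_hat[OF that]] c by simp
  show ?thesis
  proof (rule lip_onI[OF B])
    fix s t assume st: "s \<in> {0..T}" "t \<in> {0..T}" "s \<le> t"
    have "norm (X t - X s) \<le> norm (X s) * norm (hat s - hat t) * norm (X t)"
      unfolding X_diff[OF st(1,2)]
      by (rule order.trans[OF norm_matrix_mult_le mult_right_mono[OF norm_matrix_mult_le norm_ge_zero]])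
    also have "\<dots> \<le> (M / c) * (L * (t - s)) * (M / c)"
      using B[OF st(1)] B[OF st(2)] L[OF st(1,2)] st(3) M_pos c(1) order.trans[OF norm_ge_zero L[OF st(1,2)]]
      by (intro mult_mono) (auto simp: norm_minus_commute)
    finally show "norm (X t - X s) \<le> (M / c) * L * (M / c) * (t - s)" by (simp add: mult_ac)
  qed
qed

lemma \<phi>_sub: "lip_on {0..T} \<phi>" "lip_on {0..T} \<Phi>" "lip_on {0..T} p" "lip_on {0..T} S"
  using lip_\<phi> lip_\<Phi> lip_p lip_S T by (auto intro: lip_on_subset)

definition J :: real where
  "J = integral {0..T} (\<lambda>t. x t * (p t \<bullet> \<phi> t)) - Xi \<beta> h (\<Phi> T) + ln (det (Q - \<Phi> T))
     + integral {0..T} (\<lambda>t. X t \<bullet> \<phi> t)"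

lemma crisanti_sommers_at_eq: "crisanti_sommers_at \<beta> h T x \<Phi> = 1/2 * (Xi \<beta> h Q + J)"
proof -
  have i: "(\<lambda>t. x t * (p t \<bullet> \<phi> t)) integrable_on {0..M}"
    by (intro mono_mult_integrable x_mono_on continuous_intros lip_on_continuous[OF lip_p] cont_\<phi>) auto
  have "integral {0..real CARD('m)} (\<lambda>t. x t * ((xi1 \<beta> (\<Phi> t) + h \<otimes> h) \<bullet> path_deriv \<Phi> t)) = integral {0..M} (\<lambda>t. x t * (p t \<bullet> \<phi> t))"
    unfolding M[symmetric] by (rule integral_cong) (simp add: path_deriv_eq p_def)
  also have "\<dots> = integral {0..T} (\<lambda>t. x t * (p t \<bullet> \<phi> t)) + integral {T..M} (\<lambda>t. x t * (p t \<bullet> \<phi> t))"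
    using Henstock_Kurzweil_Integration.integral_combine[OF _ _ i, of T] T T_pos by auto
  also have "integral {T..M} (\<lambda>t. x t * (p t \<bullet> \<phi> t)) = integral {T..M} (\<lambda>t. p t \<bullet> \<phi> t)"
    by (rule integral_cong) (simp add: x_1)
  also have "\<dots> = Xi \<beta> h Q - Xi \<beta> h (\<Phi> T)" using Xi_diff[of T M] T T_pos by (simp add: \<Phi>_M)
  finally have 1: "integral {0..real CARD('m)} (\<lambda>t. x t * ((xi1 \<beta> (\<Phi> t) + h \<otimes> h) \<bullet> path_deriv \<Phi> t))
    = integral {0..T} (\<lambda>t. x t * (p t \<bullet> \<phi> t)) + (Xi \<beta> h Q - Xi \<beta> h (\<Phi> T))" .
  have 2: "integral {0..T} (\<lambda>t. matrix_inv (path_hat x \<Phi> t) \<bullet> path_deriv \<Phi> t) = integral {0..T} (\<lambda>t. X t \<bullet> \<phi> t)"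
    using T by (intro integral_cong) (simp add: path_deriv_eq path_hat_eq X_def)
  show ?thesis unfolding crisanti_sommers_at_def 1 2 unfolding M[symmetric] \<Phi>_M J_def by simp
qed

lemma crisanti_sommers_at_independent:
  assumes T1: "0 \<le> T1" "T1 \<le> T" "x T1 = 1"
  shows "crisanti_sommers_at \<beta> h T1 x \<Phi> = crisanti_sommers_at \<beta> h T x \<Phi>"
proof -
  have x1: "x t = 1" if "t \<in> {T1..T}" for t
    using x_mono[of T1 t] x_range[of t] T1 T that by force
  have hat: "hat t = Q - \<Phi> t" if "t \<in> {T1..T}" for t
  proof -
    have "integral {t..T} (\<lambda>s. x s *\<^sub>R \<phi> s) = integral {t..T} \<phi>"
      using that by (intro integral_cong) (simp add: x1)
    also have "\<dots> = \<Phi> T - \<Phi> t" using \<Phi>_diff[of t T] that T1 T by simp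
    finally show ?thesis by (simp add: hat_def)
  qed
  have sub: "{T1..T} \<subseteq> {0..T}" using T1 by auto
  obtain BX L where BX: "\<And>t. t \<in> {0..T} \<Longrightarrow> norm (X t) \<le> BX" "0 < L"
    "\<And>s t. s \<in> {0..T} \<Longrightarrow> t \<in> {0..T} \<Longrightarrow> norm (X t - X s) \<le> L * \<bar>t - s\<bar>" using lip_onE[OF lip_X] by metis
  obtain B where B: "0 < B" "\<And>t. t \<in> {0..T} \<Longrightarrow> norm (\<phi> t) \<le> B"
    using continuous_on_Icc_bounded[OF lip_on_continuous[OF \<phi>_sub(1)]] by metis
  have cont: "continuous_on {0..T} X" "continuous_on {0..T} \<phi>"
    by (auto intro: lip_on_continuous lip_X \<phi>_sub)
  have i: "(\<lambda>t. X t \<bullet> \<phi> t) integrable_on {0..T}"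
    by (intro integrable_continuous_real continuous_intros cont)
  define LL where "LL t = ln (det (Q - \<Phi> t))" for t
  define E where "E t = LL t + integral {0..t} (\<lambda>t. X t \<bullet> \<phi> t)" for t
  have "E T = E T1"
  proof (rule quadratic_increments_constant[where f = E and a = T1 and b = T and C = "2 * L * B"])
    fix s t assume st: "T1 \<le> s" "s \<le> t" "t \<le> T"
    have m: "s \<in> {0..T}" "t \<in> {0..T}" "s \<in> {T1..T}" "t \<in> {T1..T}" using st T1 by auto
    have pos: "0 < det (hat u)" if "u \<in> {0..T}" for u using pd_det[OF pd_hat[OF that] c(1)] .
    have d1: "LL t \<le> LL s + X s \<bullet> (\<Phi> s - \<Phi> t)"
      using ln_det_concave[OF hat_psd[OF m(2)] pos[OF m(2)] hat_psd[OF m(1)] pos[OF m(1)]]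
      by (simp add: LL_def hat[OF m(3)] hat[OF m(4)] X_def)
    have d2: "LL s \<le> LL t + X t \<bullet> (\<Phi> t - \<Phi> s)"
      using ln_det_concave[OF hat_psd[OF m(1)] pos[OF m(1)] hat_psd[OF m(2)] pos[OF m(2)]]
      by (simp add: LL_def hat[OF m(3)] hat[OF m(4)] X_def)
    have f: "\<phi> integrable_on {s..t}" using st T1 T by (intro integrable_subinterval_real[OF int_\<phi>]) auto
    have \<Phi>d: "\<Phi> t - \<Phi> s = integral {s..t} \<phi>" using \<Phi>_diff[of s t] st T1 T by simp
    have n\<Phi>: "norm (\<Phi> t - \<Phi> s) \<le> B * (t - s)"
      unfolding \<Phi>d using st T1 by (intro integral_norm_le f B) auto
    have j: "(\<lambda>u. (X u - X s) \<bullet> \<phi> u) integrable_on {s..t}"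
      using st T1 by (intro integrable_continuous_real continuous_intros continuous_on_subset[OF cont(1)] continuous_on_subset[OF cont(2)]) auto
    have "integral {s..t} (\<lambda>t. X t \<bullet> \<phi> t) = X s \<bullet> (\<Phi> t - \<Phi> s) + integral {s..t} (\<lambda>u. (X u - X s) \<bullet> \<phi> u)"
    proof -
      have "integral {s..t} (\<lambda>u. X s \<bullet> \<phi> u) = X s \<bullet> integral {s..t} \<phi>"
        using integral_linear[OF f bounded_linear_inner_right[of "X s"]] by (simp add: o_def)
      moreover have "(\<lambda>u. X s \<bullet> \<phi> u) integrable_on {s..t}"
        using integrable_linear[OF f bounded_linear_inner_right[of "X s"]] by (simp add: o_def)
      ultimately show ?thesis using integral_add[OF j, of "\<lambda>u. X s \<bullet> \<phi> u"] by (simp add: inner_diff_left \<Phi>d)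
    qed
    then have E: "E t - E s = LL t - LL s + X s \<bullet> (\<Phi> t - \<Phi> s) + integral {s..t} (\<lambda>u. (X u - X s) \<bullet> \<phi> u)"
      using integral_diff_interval(1)[OF i, of s t] st T1 unfolding E_def by simp
    have "\<bar>(X t - X s) \<bullet> (\<Phi> t - \<Phi> s)\<bar> \<le> (L * (t - s)) * (B * (t - s))"
      using Cauchy_Schwarz_ineq2[of "X t - X s" "\<Phi> t - \<Phi> s"] mult_mono[OF BX(3)[OF m(1,2)] n\<Phi>] st BX(2)
      by (auto intro: order.trans)
    moreover have "norm (integral {s..t} (\<lambda>u. (X u - X s) \<bullet> \<phi> u)) \<le> (L * (t - s) * B) * (t - s)"
    proof (rule integral_norm_le[OF j _ st(2)])
      fix u assume u: "u \<in> {s..t}"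
      have "\<bar>u - s\<bar> \<le> t - s" using u by auto
      then have "norm (X u - X s) \<le> L * (t - s)"
        using BX(3)[of s u] mult_left_mono[of "\<bar>u - s\<bar>" "t - s" L] BX(2) u st T1 by (auto intro: order.trans)
      then show "norm ((X u - X s) \<bullet> \<phi> u) \<le> L * (t - s) * B"
        using Cauchy_Schwarz_ineq2[of "X u - X s" "\<phi> u"] mult_mono[of "norm (X u - X s)" "L * (t - s)" "norm (\<phi> u)" B]
          B(2)[of u] u st T1 BX(2) by (auto intro: order.trans)
    qed
    moreover have "\<bar>LL t - LL s + X s \<bullet> (\<Phi> t - \<Phi> s)\<bar> \<le> \<bar>(X t - X s) \<bullet> (\<Phi> t - \<Phi> s)\<bar>"
      using d1 d2 by (simp add: inner_diff_left inner_diff_right)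
    ultimately have "norm (E t - E s) \<le> (L * (t - s)) * (B * (t - s)) + (L * (t - s) * B) * (t - s)"
      unfolding E by (intro order.trans[OF norm_triangle_ineq add_mono]) auto
    then show "norm (E t - E s) \<le> 2 * L * B * (t - s)\<^sup>2"
      by (simp add: power2_eq_square algebra_simps)
  qed (use T1 in auto)
  then have "ln (det (Q - \<Phi> T1)) = ln (det (Q - \<Phi> T)) + integral {T1..T} (\<lambda>t. X t \<bullet> \<phi> t)"
    using integral_diff_interval(1)[OF i, of T1 T] T1 by (simp add: E_def LL_def algebra_simps)
  moreover have "integral {0..t} (\<lambda>t. matrix_inv (path_hat x \<Phi> t) \<bullet> path_deriv \<Phi> t) = integral {0..t} (\<lambda>t. X t \<bullet> \<phi> t)"
    if "t \<le> T" for t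
    using T that by (intro integral_cong) (simp add: path_deriv_eq path_hat_eq X_def)
  ultimately show ?thesis
    using integral_diff_interval(1)[OF i, of T1 T] T1
    unfolding crisanti_sommers_at_def M[symmetric] \<Phi>_M by simp
qed

end

lemma order_top_less_iff:
  assumes "order_fun m x" "0 \<le> m" "T \<le> m"
  shows "order_top m x < T \<longleftrightarrow> (\<exists>t\<in>{0..<T}. x t = 1)"
proof -
  have ne: "{t \<in> {0..m}. x t = 1} \<noteq> {}" using assms by (auto simp: order_fun_def intro: exI[of _ m])
  have "bdd_below {t \<in> {0..m}. x t = 1}" by (rule bdd_belowI[of _ 0]) auto
  from cInf_less_iff[OF ne this, of T] show ?thesis
    unfolding order_top_def using assms(3) by auto
qed

context truncated_path
begin

lemma crisanti_sommers_eq: "crisanti_sommers \<beta> h x \<Phi> = 1/2 * (Xi \<beta> h Q + J)"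
proof -
  let ?P = "\<lambda>T. order_top M x < T \<and> T < M \<and> det (\<Phi> M - \<Phi> T) > 0"
  define T' where "T' = (SOME T. ?P T)"
  have "?P T" using T order_top_less_iff[OF x, of T] M_pos pd_det[OF c(2,1)] by (simp add: \<Phi>_M)
  then have P: "?P T'" unfolding T'_def by (rule someI)
  then have ex: "\<exists>t\<in>{0..<T'}. x t = 1" using order_top_less_iff[OF x, of T'] M_pos by simp
  then have T'0: "0 < T'" by auto
  have "crisanti_sommers \<beta> h x \<Phi> = crisanti_sommers_at \<beta> h T' x \<Phi>"
    unfolding crisanti_sommers_def T'_def M by simp
  also have "\<dots> = crisanti_sommers_at \<beta> h T x \<Phi>"
  proof (cases "T' \<le> T")
    case True
    obtain s where "s \<in> {0..<T'}" "x s = 1" using ex by auto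
    then have "x T' = 1" using x_mono[of s T'] x_range[of T'] P by force
    then show ?thesis using crisanti_sommers_at_independent True T'0 by simp
  next
    case False
    obtain c' where c': "0 < c'" "pd c' (Q - \<Phi> T')"
      using psd_det_pd[of "Q - \<Phi> T'"] \<Phi>_increasing[of T' M] P T'0 by (auto simp: \<Phi>_M)
    interpret T': truncated_path M \<beta> h Q x \<Phi> \<phi> T' c'
      by unfold_locales (use ex P c' in auto)
    show ?thesis using T'.crisanti_sommers_at_independent[of T] False T_pos x_T by simp
  qed
  finally show ?thesis using crisanti_sommers_at_eq by simp
qed

end

subsection \<open>Change of time\<close>

definition order_ext :: "real \<Rightarrow> (real \<Rightarrow> real) \<Rightarrow> real \<Rightarrow> real"
  where "order_ext m x t = (if t < 0 then 0 else if t \<le> m then x t else 1)"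

lemma order_ext_mono:
  assumes "order_fun m x" "s \<le> t" shows "order_ext m x s \<le> order_ext m x t"
proof -
  have "x u \<in> {0..1}" if "u \<in> {0..m}" for u using assms(1) that by (auto simp: order_fun_def image_subset_iff)
  moreover have "x u \<le> x v" if "0 \<le> u" "u \<le> v" "v \<le> m" for u v
    using assms(1) that by (auto simp: order_fun_def mono_on_def)
  ultimately show ?thesis using assms(2) by (auto simp: order_ext_def)
qed

lemma order_ext_right_continuous:
  assumes "order_fun m x" "0 \<le> m" shows "continuous (at_right t) (order_ext m x)"
proof -
  consider "t < 0" | "0 \<le> t" "t < m" | "m \<le> t" by linarith
  then have "(order_ext m x \<longlongrightarrow> order_ext m x t) (at_right t)"
  proof cases
    case 1
    have "\<forall>\<^sub>F s in at_right t. order_ext m x s = 0"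
      using eventually_at_right_real[OF 1] by eventually_elim (simp add: order_ext_def)
    then show ?thesis using 1 by (simp add: order_ext_def tendsto_eventually)
  next
    case 2
    then have "(x \<longlongrightarrow> x t) (at_right t)" using assms by (auto simp: order_fun_def continuous_within)
    moreover have "\<forall>\<^sub>F s in at_right t. x s = order_ext m x s"
      using eventually_at_right_real[OF 2(2)] by eventually_elim (use 2 in \<open>simp add: order_ext_def\<close>)
    ultimately have "(order_ext m x \<longlongrightarrow> x t) (at_right t)" by (rule Lim_transform_eventually)
    then show ?thesis using 2 by (simp add: order_ext_def)
  next
    case 3
    have "\<forall>\<^sub>F s in at_right t. order_ext m x s = 1"
      using eventually_at_right_less[of t] by eventually_elim (use 3 assms in \<open>simp add: order_ext_def\<close>)
    moreover have "order_ext m x t = 1" using 3 assms by (auto simp: order_ext_def order_fun_def)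
    ultimately show ?thesis by (simp add: tendsto_eventually)
  qed
  then show ?thesis by (simp add: continuous_within)
qed

lemma emeasure_order_measure_Ioc:
  assumes "order_fun m x" "0 \<le> m" "a \<le> b"
  shows "emeasure (order_measure m x) {a<..b} = ennreal (order_ext m x b - order_ext m x a)"
proof -
  have "order_measure m x = interval_measure (order_ext m x)"
    unfolding order_measure_def by (rule arg_cong[where f = interval_measure]) (simp add: order_ext_def fun_eq_iff)
  then show ?thesis
    using emeasure_interval_measure_Ioc[OF assms(3) order_ext_mono[OF assms(1)] order_ext_right_continuous[OF assms(1,2)]] by simp
qed

lemma measure_support_order:
  assumes "order_fun m x" "0 \<le> m"
  shows "t \<in> measure_support (order_measure m x) \<longleftrightarrow> (\<forall>c d. c < t \<longrightarrow> t < d \<longrightarrow> order_ext m x c < order_ext m x d)"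
proof safe
  fix c d assume t: "t \<in> measure_support (order_measure m x)" "c < t" "t < d"
  have sets: "sets (order_measure m x) = sets borel" by (simp add: order_measure_def)
  have "0 < emeasure (order_measure m x) {c<..<d}" using t by (auto simp: measure_support_def)
  also have "\<dots> \<le> emeasure (order_measure m x) {c<..d}"
    by (rule emeasure_mono) (auto simp: sets)
  finally show "order_ext m x c < order_ext m x d"
    using emeasure_order_measure_Ioc[OF assms, of c d] t by simp
next
  assume *: "\<forall>c d. c < t \<longrightarrow> t < d \<longrightarrow> order_ext m x c < order_ext m x d"
  have sets: "sets (order_measure m x) = sets borel" by (simp add: order_measure_def)
  show "t \<in> measure_support (order_measure m x)"
    unfolding measure_support_def
  proof safe
    fix U :: "real set" assume U: "open U" "t \<in> U"
    then obtain e where e: "0 < e" "ball t e \<subseteq> U" using open_contains_ball by blast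
    have "0 < order_ext m x (t + e/2) - order_ext m x (t - e/2)" using * e by simp
    then have "0 < emeasure (order_measure m x) {t - e/2<..t + e/2}"
      using emeasure_order_measure_Ioc[OF assms, of "t - e/2" "t + e/2"] e by simp
    also have "\<dots> \<le> emeasure (order_measure m x) U"
      using e U by (intro emeasure_mono) (auto simp: sets dist_real_def subset_iff)
    finally show "0 < emeasure (order_measure m x) U" .
  qed
qed

lemma lip_on_lipschitz: "lip_on S f \<Longrightarrow> \<exists>L. L-lipschitz_on S f"
proof (erule lip_onE)
  fix B L :: real assume L: "0 < L" "\<And>s t. s \<in> S \<Longrightarrow> t \<in> S \<Longrightarrow> norm (f t - f s) \<le> L * \<bar>t - s\<bar>"
  have "L-lipschitz_on S f"
    by (rule lipschitz_onI) (use L in \<open>auto simp: dist_norm\<close>)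
  then show ?thesis ..
qed

context truncated_path
begin

lemma measure_support_subset: "measure_support (order_measure M x) \<subseteq> {0..T}"
proof
  fix t assume "t \<in> measure_support (order_measure M x)"
  then have *: "\<And>c d. c < t \<Longrightarrow> t < d \<Longrightarrow> order_ext M x c < order_ext M x d"
    using measure_support_order[OF x] M_pos by auto
  have "0 \<le> t"
  proof (rule ccontr)
    assume "\<not> 0 \<le> t"
    then have "order_ext M x (t - 1) = 0" "order_ext M x (t / 2) = 0" by (auto simp: order_ext_def)
    then show False using *[of "t - 1" "t / 2"] \<open>\<not> 0 \<le> t\<close> by auto
  qed
  moreover have "t \<le> T"
  proof (rule ccontr)
    assume t: "\<not> t \<le> T"
    then have "order_ext M x T = 1" "order_ext M x (t + M) = 1"
      using x_T T T_pos by (auto simp: order_ext_def)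
    then show False using *[of T "t + M"] t M_pos by auto
  qed
  ultimately show "t \<in> {0..T}" by simp
qed

lemma admissible:
  assumes "\<And>t. t \<in> measure_support (order_measure M x) \<Longrightarrow> trace (\<Phi> t) = t"
  shows "admissible Q x \<Phi>"
  unfolding admissible_def M[symmetric]
proof (intro conjI)
  show "order_fun M x" by (rule x)
  have eq: "lip_on {0..M} (path_deriv \<Phi>)" using lip_\<phi> by (subst lip_on_cong[OF path_deriv_eq]) auto
  show "matrix_path x Q \<Phi>"
    unfolding matrix_path_def M[symmetric] loewner_le_def
  proof (intro conjI ballI impI)
    show "\<Phi> t \<in> psd" if "t \<in> {0..M}" for t using \<Phi>_psd[OF that] .
    show "\<Phi> differentiable at t within {0..M}" if "t \<in> {0..M}" for t
      using deriv[OF that] by (rule differentiableI_vector)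
    show "continuous_on {0..M} (path_deriv \<Phi>)" by (rule lip_on_continuous[OF eq])
    show "\<exists>L. L-lipschitz_on {0..M} \<Phi>" by (rule lip_on_lipschitz[OF lip_\<Phi>])
    show "\<exists>L. L-lipschitz_on {0..M} (path_deriv \<Phi>)" by (rule lip_on_lipschitz[OF eq])
    show "\<Phi> t - \<Phi> s \<in> psd" if "s \<in> {0..M}" "t \<in> {0..M}" "s \<le> t" for s t
      using \<Phi>_increasing[of s t] that by auto
  qed (use \<Phi>_0 \<Phi>_M assms in auto)
  have "order_top M x < T" using T order_top_less_iff[OF x, of T] M_pos by simp
  moreover have "0 \<le> order_top M x"
    unfolding order_top_def using x M_pos by (intro cInf_greatest) (auto simp: order_fun_def intro: exI[of _ M])
  ultimately have "\<Phi> T - \<Phi> (order_top M x) \<in> psd" using T by (intro \<Phi>_increasing) auto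
  then have "pd c (Q - \<Phi> (order_top M x))"
    by (intro pd_mono[OF c(2)]) simp
  then show "0 < det (Q - \<Phi> (order_top M x))" using pd_det c(1) by blast
qed

end

locale time_change = truncated_path M \<beta> h Q x \<Phi> \<phi> T c
  for M :: real and \<beta> :: "nat \<Rightarrow> real^'m" and h :: "real^'m" and Q :: "real^'m^'m"
    and x :: "real \<Rightarrow> real" and \<Phi> \<phi> :: "real \<Rightarrow> real^'m^'m" and T c :: real +
  fixes k :: "real \<Rightarrow> real"
  assumes lip_k: "lip_on {0..M} k" and k_bound: "t \<in> {0..M} \<Longrightarrow> \<bar>k t\<bar> \<le> 1/2"
    and int_k: "integral {0..M} k = 0"
begin

definition \<theta> where "\<theta> t = (if t \<in> {0..M} then t + integral {0..t} k else t)"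
definition \<kappa> where "\<kappa> t = 1 + k t"

lemma k_integrable: "k integrable_on {0..M}"
  by (rule integrable_continuous_real[OF lip_on_continuous[OF lip_k]])

lemma \<theta>_ends: "\<theta> 0 = 0" "\<theta> M = M" using int_k M_pos by (auto simp: \<theta>_def)

lemma \<kappa>_bounds: "t \<in> {0..M} \<Longrightarrow> 1/2 \<le> \<kappa> t \<and> \<kappa> t \<le> 3/2" using k_bound[of t] by (auto simp: \<kappa>_def abs_le_iff)

lemma \<theta>_diff:
  assumes "0 \<le> s" "s \<le> t" "t \<le> M" shows "\<theta> t - \<theta> s = (t - s) + integral {s..t} k"
  using integral_diff_interval(1)[OF k_integrable assms] assms by (auto simp: \<theta>_def)

lemma \<theta>_diff_bounds:
  assumes "0 \<le> s" "s \<le> t" "t \<le> M" shows "(t - s) / 2 \<le> \<theta> t - \<theta> s"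
proof -
  have "norm (integral {s..t} k) \<le> 1/2 * (t - s)"
    using assms k_bound by (intro integral_norm_le integrable_subinterval_real[OF k_integrable]) auto
  then show ?thesis using \<theta>_diff[OF assms] by (simp add: abs_le_iff)
qed

lemma \<theta>_mono: assumes "s < t" shows "\<theta> s < \<theta> t"
proof -
  have in_range: "0 \<le> \<theta> u \<and> \<theta> u \<le> M" if "u \<in> {0..M}" for u
    using \<theta>_diff_bounds[of 0 u] \<theta>_diff_bounds[of u M] that \<theta>_ends by auto
  consider "0 \<le> s" "t \<le> M" | "s < 0" "t \<in> {0..M}" | "s \<in> {0..M}" "M < t" | "s \<notin> {0..M}" "t \<notin> {0..M}"
    using assms by force
  then show ?thesis
  proof cases
    case 1 then show ?thesis using \<theta>_diff_bounds[of s t] assms by auto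
  next
    case 2 then show ?thesis using in_range[of t] by (simp add: \<theta>_def)
  next
    case 3 then show ?thesis using in_range[of s] by (simp add: \<theta>_def)
  next
    case 4 then show ?thesis using assms by (auto simp: \<theta>_def)
  qed
qed

lemma \<theta>_le_iff: "\<theta> s \<le> \<theta> t \<longleftrightarrow> s \<le> t" "\<theta> s < \<theta> t \<longleftrightarrow> s < t"
  using \<theta>_mono[of s t] \<theta>_mono[of t s] by (cases s t rule: linorder_cases; auto)+

lemma \<theta>_deriv:
  assumes "t \<in> {0..M}" shows "(\<theta> has_vector_derivative \<kappa> t) (at t within {0..M})"
proof -
  have "((\<lambda>t. t + integral {0..t} k) has_vector_derivative \<kappa> t) (at t within {0..M})"
    unfolding \<kappa>_def
    by (intro has_vector_derivative_add has_vector_derivative_id integral_has_vector_derivative lip_on_continuous lip_k assms)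
  then show ?thesis by (rule has_vector_derivative_transform[OF assms, rotated]) (simp add: \<theta>_def)
qed

lemma \<theta>_image:
  assumes "0 \<le> a" "a \<le> b" "b \<le> M" shows "\<theta> ` {a..b} = {\<theta> a..\<theta> b}"
proof
  show "\<theta> ` {a..b} \<subseteq> {\<theta> a..\<theta> b}" by (auto simp: \<theta>_le_iff)
  have "continuous_on {a..b} \<theta>"
  proof (rule continuous_on_subset)
    show "continuous_on {0..M} \<theta>"
      unfolding continuous_on_eq_continuous_within
      by (intro ballI has_vector_derivative_continuous[OF \<theta>_deriv])
  qed (use assms in auto)
  then show "{\<theta> a..\<theta> b} \<subseteq> \<theta> ` {a..b}"
    using IVT'[of \<theta> a _ b] assms(2) by (fastforce simp: image_iff)
qed

lemma \<theta>_surj: "\<exists>t. \<theta> t = u"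
proof (cases "u \<in> {0..M}")
  case True
  then have "u \<in> \<theta> ` {0..M}" using \<theta>_image[of 0 M] M_pos by (simp add: \<theta>_ends)
  then show ?thesis by blast
next
  case False then show ?thesis by (intro exI[of _ u]) (auto simp: \<theta>_def)
qed

definition \<sigma> where "\<sigma> = inv \<theta>"

lemma \<theta>_inj: "inj \<theta>"
  by (rule injI) (metis \<theta>_le_iff(1) order_antisym order_refl)

lemma \<sigma>_\<theta> [simp]: "\<sigma> (\<theta> t) = t" unfolding \<sigma>_def by (rule inv_f_f[OF \<theta>_inj])
lemma \<theta>_\<sigma> [simp]: "\<theta> (\<sigma> u) = u" unfolding \<sigma>_def by (rule f_inv_into_f) (use \<theta>_surj in \<open>auto simp: image_iff, metis\<close>)

lemma \<sigma>_le_iff: "\<sigma> u \<le> \<sigma> v \<longleftrightarrow> u \<le> v" "\<sigma> u < \<sigma> v \<longleftrightarrow> u < v"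
  using \<theta>_le_iff[of "\<sigma> u" "\<sigma> v"] by simp_all

lemma \<sigma>_ends: "\<sigma> 0 = 0" "\<sigma> M = M" using \<sigma>_\<theta>[of 0] \<sigma>_\<theta>[of M] by (simp_all only: \<theta>_ends)

lemma \<sigma>_range: "u \<in> {0..M} \<Longrightarrow> \<sigma> u \<in> {0..M}"
  using \<sigma>_le_iff(1)[of 0 u] \<sigma>_le_iff(1)[of u M] by (simp add: \<sigma>_ends)

lemma \<sigma>_lip:
  assumes "u \<in> {0..M}" "v \<in> {0..M}" "u \<le> v" shows "\<sigma> v - \<sigma> u \<le> 2 * (v - u)"
  using \<theta>_diff_bounds[of "\<sigma> u" "\<sigma> v"] \<sigma>_range[OF assms(1)] \<sigma>_range[OF assms(2)] assms(3) by (simp add: \<sigma>_le_iff)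

lemma lip_\<sigma>_comp:
  fixes f :: "real \<Rightarrow> 'a::real_normed_vector"
  assumes "lip_on {0..M} f" shows "lip_on {0..M} (\<lambda>u. f (\<sigma> u))"
proof -
  obtain B L where f: "\<And>t. t \<in> {0..M} \<Longrightarrow> norm (f t) \<le> B" "0 < L"
    "\<And>s t. s \<in> {0..M} \<Longrightarrow> t \<in> {0..M} \<Longrightarrow> norm (f t - f s) \<le> L * \<bar>t - s\<bar>" using lip_onE[OF assms] by metis
  show ?thesis
  proof (rule lip_onI)
    show "norm (f (\<sigma> u)) \<le> B" if "u \<in> {0..M}" for u using f(1) \<sigma>_range[OF that] by blast
    fix u v assume uv: "u \<in> {0..M}" "v \<in> {0..M}" "u \<le> v"
    have "norm (f (\<sigma> v) - f (\<sigma> u)) \<le> L * \<bar>\<sigma> v - \<sigma> u\<bar>" using f(3) \<sigma>_range uv by blast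
    also have "\<dots> \<le> L * (2 * (v - u))"
      using \<sigma>_lip[OF uv] f(2) uv(3) by (intro mult_left_mono) (auto simp: \<sigma>_le_iff)
    finally show "norm (f (\<sigma> v) - f (\<sigma> u)) \<le> (L * 2) * (v - u)" by (simp add: algebra_simps)
  qed
qed

lemma \<sigma>_continuous: "continuous_on {0..M} \<sigma>"
  by (rule lip_on_continuous[OF lip_\<sigma>_comp]) (simp add: lip_on_id)


lemma \<sigma>_deriv:
  assumes u: "u \<in> {0..M}" shows "(\<sigma> has_vector_derivative 1 / \<kappa> (\<sigma> u)) (at u within {0..M})"
proof -
  obtain L where L: "0 < L" "\<And>s t. s \<in> {0..M} \<Longrightarrow> t \<in> {0..M} \<Longrightarrow> norm (k t - k s) \<le> L * \<bar>t - s\<bar>"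
    using lip_onE[OF lip_k] by metis
  have taylor: "\<bar>\<theta> t - \<theta> s - (t - s) * \<kappa> r\<bar> \<le> L * (t - s)\<^sup>2"
    if "0 \<le> s" "s \<le> t" "t \<le> M" "r \<in> {s, t}" for s t r
  proof -
    have ki: "k integrable_on {s..t}" using that by (intro integrable_subinterval_real[OF k_integrable]) auto
    have "\<theta> t - \<theta> s - (t - s) * \<kappa> r = integral {s..t} (\<lambda>v. k v - k r)"
      unfolding \<theta>_diff[OF that(1-3)] \<kappa>_def using ki that by (subst integral_diff) (auto simp: algebra_simps)
    also have "norm \<dots> \<le> (L * (t - s)) * (t - s)"
    proof (rule integral_norm_le)
      show "(\<lambda>v. k v - k r) integrable_on {s..t}" using ki by (intro integrable_diff) auto
      fix v assume v: "v \<in> {s..t}"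
      have "L * \<bar>v - r\<bar> \<le> L * (t - s)" using v that L by (intro mult_left_mono) auto
      then show "norm (k v - k r) \<le> L * (t - s)" using L(2)[of r v] v that by auto
    qed (use that in auto)
    finally show ?thesis by (simp add: power2_eq_square mult.assoc)
  qed
  show ?thesis
  proof (rule has_vector_derivative_quadratic[where C = "8 * L"])
    fix v assume v: "v \<in> {0..M}"
    have rng: "\<sigma> u \<in> {0..M}" "\<sigma> v \<in> {0..M}" using u v \<sigma>_range by auto
    have \<kappa>: "1/2 \<le> \<kappa> (\<sigma> u)" using \<kappa>_bounds[OF rng(1)] by simp
    have d: "\<bar>\<sigma> v - \<sigma> u\<bar> \<le> 2 * \<bar>v - u\<bar>"
      using \<sigma>_lip[OF u v] \<sigma>_lip[OF v u] \<sigma>_le_iff(1)[of u v] \<sigma>_le_iff(1)[of v u] by (cases "u \<le> v") auto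
    have t: "\<bar>v - u - (\<sigma> v - \<sigma> u) * \<kappa> (\<sigma> u)\<bar> \<le> L * (\<sigma> v - \<sigma> u)\<^sup>2"
    proof (cases "u \<le> v")
      case True
      then show ?thesis using taylor[of "\<sigma> u" "\<sigma> v" "\<sigma> u"] rng by (simp add: \<sigma>_le_iff)
    next
      case False
      have "\<bar>u - v - (\<sigma> u - \<sigma> v) * \<kappa> (\<sigma> u)\<bar> = \<bar>v - u - (\<sigma> v - \<sigma> u) * \<kappa> (\<sigma> u)\<bar>"
        by (subst abs_minus_commute) (simp add: algebra_simps)
      then show ?thesis using taylor[of "\<sigma> v" "\<sigma> u" "\<sigma> u"] rng False by (simp add: \<sigma>_le_iff power2_commute)
    qed
    have "(\<sigma> v - \<sigma> u - (v - u) * (1 / \<kappa> (\<sigma> u))) * \<kappa> (\<sigma> u) = - (v - u - (\<sigma> v - \<sigma> u) * \<kappa> (\<sigma> u))"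
      using \<kappa> by (simp add: field_simps)
    then have "\<bar>\<sigma> v - \<sigma> u - (v - u) * (1 / \<kappa> (\<sigma> u))\<bar> * \<bar>\<kappa> (\<sigma> u)\<bar> = \<bar>v - u - (\<sigma> v - \<sigma> u) * \<kappa> (\<sigma> u)\<bar>"
      by (metis abs_minus_cancel abs_mult)
    then have "\<bar>\<sigma> v - \<sigma> u - (v - u) * (1 / \<kappa> (\<sigma> u))\<bar> * (1/2) \<le> L * (\<sigma> v - \<sigma> u)\<^sup>2"
      using t \<kappa> mult_left_mono[of "1/2" "\<bar>\<kappa> (\<sigma> u)\<bar>" "\<bar>\<sigma> v - \<sigma> u - (v - u) * (1 / \<kappa> (\<sigma> u))\<bar>"] by linarith
    also have "\<dots> \<le> L * (4 * (v - u)\<^sup>2)"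
    proof -
      have "\<bar>\<sigma> v - \<sigma> u\<bar>\<^sup>2 \<le> (2 * \<bar>v - u\<bar>)\<^sup>2" using d by (intro power_mono) auto
      then show ?thesis using L(1) by (intro mult_left_mono) (auto simp: power_mult_distrib)
    qed
    finally show "norm (\<sigma> v - \<sigma> u - (v - u) *\<^sub>R (1 / \<kappa> (\<sigma> u))) \<le> 8 * L * (v - u)\<^sup>2" by simp
  qed
qed

definition y where "y u = x (\<sigma> u)"
definition \<Psi> where "\<Psi> u = \<Phi> (\<sigma> u)"
definition \<psi> where "\<psi> u = (1 / \<kappa> (\<sigma> u)) *\<^sub>R \<phi> (\<sigma> u)"

lemma order_fun_y: "order_fun M y"
  unfolding order_fun_def
proof (intro conjI ballI)
  show "y ` {0..M} \<subseteq> {0..1}" using x_range[OF \<sigma>_range] by (auto simp: y_def)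
  show "mono_on {0..M} y"
    unfolding y_def
  proof (rule mono_onI)
    fix u v assume "u \<in> {0..M}" "v \<in> {0..M}" "u \<le> v"
    then show "x (\<sigma> u) \<le> x (\<sigma> v)" using \<sigma>_range[of u] \<sigma>_range[of v] by (intro x_mono) (auto simp: \<sigma>_le_iff)
  qed
  show "y M = 1" using x by (simp add: y_def \<sigma>_ends order_fun_def)
  fix u assume u: "u \<in> {0..<M}"
  have "\<sigma> u \<in> {0..<M}" using \<sigma>_range[of u] \<sigma>_le_iff(2)[of u M] u by (auto simp: \<sigma>_ends)
  then have "(x \<longlongrightarrow> x (\<sigma> u)) (at_right (\<sigma> u))"
    using x by (auto simp: order_fun_def continuous_within)
  moreover have "filterlim \<sigma> (at_right (\<sigma> u)) (at_right u)"
    unfolding filterlim_at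
  proof
    show "\<forall>\<^sub>F v in at_right u. \<sigma> v \<in> {\<sigma> u<..} \<and> \<sigma> v \<noteq> \<sigma> u"
      using eventually_at_right_less[of u] by (rule eventually_mono) (simp add: less_imp_neq[symmetric] \<sigma>_le_iff(2))
    have "(\<sigma> \<longlongrightarrow> \<sigma> u) (at u within {0..M})"
      using \<sigma>_continuous u by (auto simp: continuous_on_def)
    then have "(\<sigma> \<longlongrightarrow> \<sigma> u) (at u within {u..M})" by (rule tendsto_within_subset) (use u in auto)
    then show "(\<sigma> \<longlongrightarrow> \<sigma> u) (at_right u)" using u by (simp add: at_within_Icc_at_right)
  qed
  ultimately show "continuous (at_right u) y"
    unfolding continuous_within y_def by (rule filterlim_compose)
qed

lemma lip_inverse_\<kappa>: "lip_on {0..M} (\<lambda>t. 1 / \<kappa> t)"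
proof -
  obtain L where L: "0 < L" "\<And>s t. s \<in> {0..M} \<Longrightarrow> t \<in> {0..M} \<Longrightarrow> norm (k t - k s) \<le> L * \<bar>t - s\<bar>"
    using lip_onE[OF lip_k] by metis
  show ?thesis
  proof (rule lip_onI)
    show "norm (1 / \<kappa> t) \<le> 2" if "t \<in> {0..M}" for t
      using \<kappa>_bounds[OF that] by (auto simp: divide_le_eq)
    fix s t assume st: "s \<in> {0..M}" "t \<in> {0..M}" "s \<le> t"
    have "1 / \<kappa> t - 1 / \<kappa> s = (k s - k t) * (1 / \<kappa> t) * (1 / \<kappa> s)"
      using \<kappa>_bounds[OF st(1)] \<kappa>_bounds[OF st(2)] by (simp add: field_simps) (simp add: \<kappa>_def)
    also have "norm \<dots> \<le> (L * (t - s)) * 2 * 2"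
      unfolding norm_mult
      using \<kappa>_bounds[OF st(1)] \<kappa>_bounds[OF st(2)] L(2)[OF st(1,2)] st(3) L(1)
      by (intro mult_mono) (auto simp: divide_le_eq abs_minus_commute)
    finally show "norm (1 / \<kappa> t - 1 / \<kappa> s) \<le> (4 * L) * (t - s)" by simp
  qed
qed

lemma increasing_path_\<Psi>: "increasing_path M \<beta> Q y \<Psi> \<psi>"
proof
  show "\<Psi> 0 = 0" "\<Psi> M = Q" by (simp_all add: \<Psi>_def \<sigma>_ends \<Phi>_0 \<Phi>_M)
  show "lip_on {0..M} \<psi>"
    unfolding \<psi>_def by (intro lip_intros lip_\<sigma>_comp[OF lip_inverse_\<kappa>] lip_\<sigma>_comp[OF lip_\<phi>])
  fix u assume u: "u \<in> {0..M}"
  show "\<psi> u \<in> psd" unfolding \<psi>_def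
    using \<sigma>_range[OF u] \<kappa>_bounds[of "\<sigma> u"] by (intro psd_scaleR psd_\<phi>) auto
  have "(\<Phi> has_vector_derivative \<phi> (\<sigma> u)) (at (\<sigma> u) within \<sigma> ` {0..M})"
    by (rule has_vector_derivative_within_subset[OF deriv[OF \<sigma>_range[OF u]]]) (use \<sigma>_range in auto)
  from vector_diff_chain_within[OF \<sigma>_deriv[OF u] this]
  show "(\<Psi> has_vector_derivative \<psi> u) (at u within {0..M})"
    by (simp add: \<Psi>_def[abs_def] \<psi>_def o_def)
qed (use M \<beta> Q order_fun_y in auto)

lemma truncated_path_\<Psi>: "truncated_path M \<beta> Q y \<Psi> \<psi> (\<theta> T) c"
proof -
  interpret \<Psi>: increasing_path M \<beta> h Q y \<Psi> \<psi> by (rule increasing_path_\<Psi>)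
  show ?thesis
  proof
    obtain t where t: "t \<in> {0..<T}" "x t = 1" using T by auto
    have "\<theta> t \<in> {0..<\<theta> T}" using t \<theta>_le_iff(1)[of 0 t] \<theta>_le_iff(2)[of t T] by (auto simp: \<theta>_ends)
    then show "\<exists>t\<in>{0..<\<theta> T}. y t = 1" using t by (intro bexI[of _ "\<theta> t"]) (auto simp: y_def)
    show "\<theta> T < M" using \<theta>_mono[OF T(2)] by (simp add: \<theta>_ends)
    show "pd c (Q - \<Psi> (\<theta> T))" using c by (simp add: \<Psi>_def)
  qed (rule c)
qed

lemma change_of_variables:
  fixes f :: "real \<Rightarrow> real"
  assumes ab: "0 \<le> a" "a \<le> b" "b \<le> M" and f: "f integrable_on {a..b}" "\<And>t. t \<in> {a..b} \<Longrightarrow> \<bar>f t\<bar> \<le> B"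
  shows "(\<lambda>u. f (\<sigma> u) * (1 / \<kappa> (\<sigma> u))) integrable_on {\<theta> a..\<theta> b}"
    "integral {\<theta> a..\<theta> b} (\<lambda>u. f (\<sigma> u) * (1 / \<kappa> (\<sigma> u))) = integral {a..b} f"
proof -
  let ?F = "\<lambda>u. f (\<sigma> u) * (1 / \<kappa> (\<sigma> u))"
  have eq: "\<bar>\<kappa> t\<bar> * ?F (\<theta> t) = f t" if "t \<in> {a..b}" for t
    using \<kappa>_bounds[of t] that ab by auto
  have "f absolutely_integrable_on {a..b}"
    by (rule absolutely_integrable_integrable_bound[of _ _ "\<lambda>_. B"]) (use f in auto)
  then have "(\<lambda>t. \<bar>\<kappa> t\<bar> * ?F (\<theta> t)) absolutely_integrable_on {a..b}"
    by (rule set_integrable_cong[THEN iffD1, rotated 3]) (use eq in auto)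
  moreover have "integral {a..b} (\<lambda>t. \<bar>\<kappa> t\<bar> * ?F (\<theta> t)) = integral {a..b} f"
    by (rule integral_cong) (rule eq)
  ultimately have "?F absolutely_integrable_on (\<theta> ` {a..b}) \<and> integral (\<theta> ` {a..b}) ?F = integral {a..b} f"
  proof (intro has_absolute_integral_change_of_variables_1'[THEN iffD1] conjI)
    show "{a..b} \<in> sets lebesgue" by simp
    show "inj_on \<theta> {a..b}" using \<theta>_inj by (rule inj_on_subset) simp
    fix t assume "t \<in> {a..b}"
    then show "(\<theta> has_field_derivative \<kappa> t) (at t within {a..b})"
      unfolding has_real_derivative_iff_has_vector_derivative
      using ab by (intro has_vector_derivative_within_subset[OF \<theta>_deriv]) auto
  qed
  then show "?F integrable_on {\<theta> a..\<theta> b}" "integral {\<theta> a..\<theta> b} ?F = integral {a..b} f"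
    unfolding \<theta>_image[OF ab] by (auto simp: absolutely_integrable_on_def)
qed

lemma J_invariant: "truncated_path.J \<beta> h Q y \<Psi> \<psi> (\<theta> T) = J"
proof -
  interpret \<Psi>: truncated_path M \<beta> h Q y \<Psi> \<psi> "\<theta> T" c by (rule truncated_path_\<Psi>)
  obtain B where B: "0 < B" "\<And>t. t \<in> {0..M} \<Longrightarrow> norm (\<phi> t) \<le> B" using continuous_on_Icc_bounded[OF cont_\<phi>] by metis
  have hat: "\<Psi>.hat (\<theta> t) = hat t" if t: "t \<in> {0..T}" for t
  proof -
    have "integral {\<theta> t..\<theta> T} (\<lambda>s. y s *\<^sub>R \<psi> s) = integral {t..T} (\<lambda>s. x s *\<^sub>R \<phi> s)"
    proof (rule vector_eq_ldot[THEN iffD1], rule allI)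
      fix A :: "real^'m^'m"
      have i1: "(\<lambda>s. x s *\<^sub>R \<phi> s) integrable_on {t..T}" using t T by (intro int_x\<phi>) auto
      have i2: "(\<lambda>s. y s *\<^sub>R \<psi> s) integrable_on {\<theta> t..\<theta> T}"
        using t T \<theta>_le_iff(1)[of 0 t] \<theta>_le_iff(1)[of T M] by (intro \<Psi>.int_x\<phi>) (auto simp: \<theta>_ends)
      have e1: "A \<bullet> integral {t..T} (\<lambda>s. x s *\<^sub>R \<phi> s) = integral {t..T} (\<lambda>s. x s * (A \<bullet> \<phi> s))"
        using integral_linear[OF i1 bounded_linear_inner_right[of A]] by (simp add: o_def)
      have e2: "A \<bullet> integral {\<theta> t..\<theta> T} (\<lambda>s. y s *\<^sub>R \<psi> s) = integral {\<theta> t..\<theta> T} (\<lambda>s. y s * (A \<bullet> \<psi> s))"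
        using integral_linear[OF i2 bounded_linear_inner_right[of A]] by (simp add: o_def)
      have "integral {\<theta> t..\<theta> T} (\<lambda>u. x (\<sigma> u) * (A \<bullet> \<phi> (\<sigma> u)) * (1 / \<kappa> (\<sigma> u))) = integral {t..T} (\<lambda>s. x s * (A \<bullet> \<phi> s))"
      proof (rule change_of_variables(2))
        show "(\<lambda>s. x s * (A \<bullet> \<phi> s)) integrable_on {t..T}"
          using integrable_linear[OF i1 bounded_linear_inner_right[of A]] by (simp add: o_def)
        fix s assume s: "s \<in> {t..T}"
        have "\<bar>A \<bullet> \<phi> s\<bar> \<le> norm A * B"
          using Cauchy_Schwarz_ineq2[of A "\<phi> s"] mult_left_mono[OF B(2)[of s], of "norm A"] s t T by auto
        then show "\<bar>x s * (A \<bullet> \<phi> s)\<bar> \<le> norm A * B"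
          using mult_mono[of "\<bar>x s\<bar>" 1 "\<bar>A \<bullet> \<phi> s\<bar>" "norm A * B"] x_range[of s] s t T B(1) by (auto simp: abs_mult)
      qed (use t T in auto)
      then show "A \<bullet> integral {\<theta> t..\<theta> T} (\<lambda>s. y s *\<^sub>R \<psi> s) = A \<bullet> integral {t..T} (\<lambda>s. x s *\<^sub>R \<phi> s)"
        unfolding e1 e2 by (simp add: y_def \<psi>_def mult_ac)
    qed
    then show ?thesis by (simp add: \<Psi>.hat_def hat_def \<Psi>_def)
  qed
  have cX: "continuous_on {0..T} X" "continuous_on {0..T} p" "continuous_on {0..T} \<phi>"
    by (auto intro: lip_on_continuous lip_X \<phi>_sub)
  have c1: "continuous_on {0..T} (\<lambda>t. p t \<bullet> \<phi> t)" "continuous_on {0..T} (\<lambda>t. X t \<bullet> \<phi> t)"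
    by (intro continuous_intros cX)+
  obtain B1 where B1: "0 < B1" "\<And>t. t \<in> {0..T} \<Longrightarrow> norm (p t \<bullet> \<phi> t) \<le> B1" using continuous_on_Icc_bounded[OF c1(1)] by metis
  obtain B2 where B2: "0 < B2" "\<And>t. t \<in> {0..T} \<Longrightarrow> norm (X t \<bullet> \<phi> t) \<le> B2" using continuous_on_Icc_bounded[OF c1(2)] by metis
  have "integral {\<theta> 0..\<theta> T} (\<lambda>u. x (\<sigma> u) * (p (\<sigma> u) \<bullet> \<phi> (\<sigma> u)) * (1 / \<kappa> (\<sigma> u))) = integral {0..T} (\<lambda>t. x t * (p t \<bullet> \<phi> t))"
  proof (rule change_of_variables(2))
    show "(\<lambda>t. x t * (p t \<bullet> \<phi> t)) integrable_on {0..T}" using T by (intro mono_mult_integrable x_mono_on c1) auto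
    show "\<bar>x t * (p t \<bullet> \<phi> t)\<bar> \<le> B1" if "t \<in> {0..T}" for t
      using mult_mono[of "\<bar>x t\<bar>" 1 "\<bar>p t \<bullet> \<phi> t\<bar>" B1] B1(2)[OF that] x_range[of t] that T by (simp add: abs_mult)
  qed (use T T_pos in auto)
  moreover have "integral {0..\<theta> T} (\<lambda>u. y u * (\<Psi>.p u \<bullet> \<psi> u)) = integral {\<theta> 0..\<theta> T} (\<lambda>u. x (\<sigma> u) * (p (\<sigma> u) \<bullet> \<phi> (\<sigma> u)) * (1 / \<kappa> (\<sigma> u)))"
    by (simp add: \<theta>_ends y_def \<Psi>.p_def p_def \<Psi>_def \<psi>_def mult_ac)
  ultimately have 1: "integral {0..\<theta> T} (\<lambda>u. y u * (\<Psi>.p u \<bullet> \<psi> u)) = integral {0..T} (\<lambda>t. x t * (p t \<bullet> \<phi> t))" by simp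
  have "integral {\<theta> 0..\<theta> T} (\<lambda>u. (X (\<sigma> u) \<bullet> \<phi> (\<sigma> u)) * (1 / \<kappa> (\<sigma> u))) = integral {0..T} (\<lambda>t. X t \<bullet> \<phi> t)"
    using B2(2) T T_pos by (intro change_of_variables(2)[of _ _ _ B2] integrable_continuous_real c1) auto
  moreover have "integral {0..\<theta> T} (\<lambda>u. \<Psi>.X u \<bullet> \<psi> u) = integral {\<theta> 0..\<theta> T} (\<lambda>u. (X (\<sigma> u) \<bullet> \<phi> (\<sigma> u)) * (1 / \<kappa> (\<sigma> u)))"
    unfolding \<theta>_ends
  proof (rule integral_cong)
    fix u assume u: "u \<in> {0..\<theta> T}"
    have "\<sigma> u \<in> {0..T}" using u \<sigma>_le_iff(1)[of 0 u] \<sigma>_le_iff(1)[of u "\<theta> T"] by (simp add: \<sigma>_ends)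
    from hat[OF this] show "\<Psi>.X u \<bullet> \<psi> u = (X (\<sigma> u) \<bullet> \<phi> (\<sigma> u)) * (1 / \<kappa> (\<sigma> u))"
      by (simp add: \<Psi>.X_def X_def \<psi>_def)
  qed
  ultimately have 2: "integral {0..\<theta> T} (\<lambda>u. \<Psi>.X u \<bullet> \<psi> u) = integral {0..T} (\<lambda>t. X t \<bullet> \<phi> t)" by simp
  show ?thesis unfolding \<Psi>.J_def J_def 1 2 by (simp add: \<Psi>_def)
qed

lemma admissible_\<Psi>:
  assumes "\<And>t. t \<in> measure_support (order_measure M x) \<Longrightarrow> trace (\<Phi> t) = \<theta> t"
  shows "admissible Q y \<Psi>" "crisanti_sommers \<beta> h y \<Psi> = 1/2 * (Xi \<beta> h Q + J)"
proof -
  interpret \<Psi>: truncated_path M \<beta> h Q y \<Psi> \<psi> "\<theta> T" c by (rule truncated_path_\<Psi>)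
  have ext: "order_ext M y (\<theta> u) = order_ext M x u" for u
    using \<theta>_le_iff(1)[of 0 u] \<theta>_le_iff(1)[of u M] by (auto simp: order_ext_def y_def \<theta>_ends not_less[symmetric])
  show "admissible Q y \<Psi>"
  proof (rule \<Psi>.admissible)
    fix u assume "u \<in> measure_support (order_measure M y)"
    then have *: "\<And>c d. c < u \<Longrightarrow> u < d \<Longrightarrow> order_ext M y c < order_ext M y d"
      using measure_support_order[OF order_fun_y] M_pos by auto
    have "\<sigma> u \<in> measure_support (order_measure M x)"
      unfolding measure_support_order[OF x less_imp_le[OF M_pos]]
      using *[of "\<theta> _" "\<theta> _"] \<theta>_le_iff(2)[of _ "\<sigma> u"] \<theta>_le_iff(2)[of "\<sigma> u"] by (simp add: ext)
    from assms[OF this] show "trace (\<Psi> u) = u" by (simp add: \<Psi>_def)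
  qed
  show "crisanti_sommers \<beta> h y \<Psi> = 1/2 * (Xi \<beta> h Q + J)"
    using \<Psi>.crisanti_sommers_eq J_invariant by simp
qed

end

subsection \<open>Competitors of a minimizer\<close>

lemma pd_perturb:
  fixes A B :: "real^'n^'n"
  assumes A: "pd c A" and B: "transpose B = B" and le: "norm (B - A) \<le> c - c'"
  shows "pd c' B"
  unfolding pd_def
proof (rule psdI)
  show "transpose (B - c' *\<^sub>R mat 1) = B - c' *\<^sub>R mat 1"
    by (simp add: transpose_diff transpose_scaleR B)
  fix v :: "real^'n"
  have "norm (v \<otimes> v) = (norm v)\<^sup>2"
    by (simp add: norm_eq_sqrt_inner[of "v \<otimes> v"] inner_outer outer_mv power2_norm_eq_inner)
  then have "\<bar>v \<bullet> ((B - A) *v v)\<bar> \<le> (norm v)\<^sup>2 * norm (B - A)"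
    using Cauchy_Schwarz_ineq2[of "v \<otimes> v" "B - A"] by (simp add: inner_outer)
  also have "\<dots> \<le> (norm v)\<^sup>2 * (c - c')" using le by (intro mult_left_mono) auto
  finally have "v \<bullet> (B *v v) \<ge> v \<bullet> (A *v v) - (norm v)\<^sup>2 * (c - c')"
    by (simp add: matrix_vector_mult_diff_rdistrib inner_diff_right abs_le_iff)
  then have "v \<bullet> (B *v v) \<ge> c' * (norm v)\<^sup>2" using pd_quadratic_form[OF A, of v] by (simp add: algebra_simps)
  then show "0 \<le> v \<bullet> ((B - c' *\<^sub>R mat 1) *v v)"
    by (simp add: matrix_vector_mult_diff_rdistrib scaleR_matrix_vector_assoc[symmetric] inner_diff_right power2_norm_eq_inner)
qed

lemma lip_on_power: "lip_on S f \<Longrightarrow> lip_on S (\<lambda>t. f t ^ n :: real)"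
  by (induction n) (auto intro: lip_intros)

text \<open>The slope at \<open>T\<close> is continued by a fast decaying weight, and the remaining
  increment, which is still positive definite, is distributed linearly.\<close>

lemma extend_path:
  fixes V :: "real \<Rightarrow> real^'n^'n"
  assumes T: "0 \<le> T" "T < M" and V: "lip_on {0..T} V" "\<And>t. t \<in> {0..T} \<Longrightarrow> V t \<in> psd"
    and d: "0 < d" "pd d (Q - integral {0..T} V)"
  obtains W where "lip_on {0..M} W" "\<And>t. t \<in> {0..T} \<Longrightarrow> W t = V t"
    "\<And>t. t \<in> {0..M} \<Longrightarrow> W t \<in> psd" "integral {0..M} W = Q"
proof -
  define l where "l = M - T"
  have l: "0 < l" using T by (simp add: l_def)
  obtain N where N: "l * norm (V T) / d < real N" using reals_Archimedean2 by blast
  define w where "w t = (1 - (t - T) / l) ^ N" for t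
  have w_int: "(w has_integral l / real (N + 1)) {T..M}"
  proof -
    have "(w has_integral (- (l / real (N + 1)) * (1 - (M - T) / l) ^ (N + 1)) - (- (l / real (N + 1)) * (1 - (T - T) / l) ^ (N + 1))) {T..M}"
    proof (rule fundamental_theorem_of_calculus)
      fix t assume "t \<in> {T..M}"
      have "((\<lambda>t. - (l / real (N + 1)) * (1 - (t - T) / l) ^ (N + 1)) has_field_derivative
         - (l / real (N + 1)) * (real (N + 1) * (1 - (t - T) / l) ^ N * (- (1 / l)))) (at t within {T..M})"
        using l by (auto intro!: derivative_eq_intros simp del: power_Suc) 
      moreover have "- (l / real (N + 1)) * (real (N + 1) * (1 - (t - T) / l) ^ N * (- (1 / l))) = w t"
        using l by (simp add: w_def)
      ultimately show "((\<lambda>t. - (l / real (N + 1)) * (1 - (t - T) / l) ^ (N + 1)) has_vector_derivative w t) (at t within {T..M})"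
        by (simp only: has_real_derivative_iff_has_vector_derivative)
    qed (use T in simp)
    then show ?thesis using l by (simp add: l_def)
  qed
  have v_int: "((\<lambda>t. t - T) has_integral l\<^sup>2 / 2) {T..M}"
  proof -
    have "((\<lambda>t. t - T) has_integral (M - T)\<^sup>2 / 2 - (T - T)\<^sup>2 / 2) {T..M}"
      using T by (intro fundamental_theorem_of_calculus)
        (auto intro!: derivative_eq_intros simp: has_real_derivative_iff_has_vector_derivative[symmetric])
    then show ?thesis by (simp add: l_def)
  qed
  define R where "R = Q - integral {0..T} V"
  define G where "G = (2 / l\<^sup>2) *\<^sub>R (R - (l / real (N + 1)) *\<^sub>R V T)"
  have VT: "V T \<in> psd" using V(2) T by simp
  have "R - (l / real (N + 1)) *\<^sub>R V T \<in> psd"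
  proof -
    have R: "transpose R = R" using psd_sym[OF pd_psd[OF d(2)]] d(1) by (simp add: R_def)
    have "l * norm (V T) \<le> real (N + 1) * d" using N d by (simp add: field_simps)
    then have "l / real (N + 1) * norm (V T) \<le> d" by (simp add: field_simps)
    then have "pd 0 (R - (l / real (N + 1)) *\<^sub>R V T)"
      using psd_sym[OF VT] R l by (intro pd_perturb[OF d(2)[folded R_def]]) (auto simp: transpose_diff transpose_scaleR)
    then show ?thesis by (simp add: pd_def)
  qed
  then have G: "G \<in> psd" unfolding G_def by (rule psd_scaleR) simp
  define E where "E t = w t *\<^sub>R V T + (t - T) *\<^sub>R G" for t
  have ET: "E T = V T" by (simp add: E_def w_def)
  define W where "W t = (if t \<le> T then V t else E t)" for t
  have WE: "W t = E t" if "t \<in> {T..M}" for t using that ET by (auto simp: W_def)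
  have lE: "lip_on {T..M} E"
    unfolding E_def w_def divide_inverse
    by (intro lip_intros lip_on_scaleR2 lip_on_power lip_on_id) auto
  have lW: "lip_on {0..M} W"
  proof (rule lip_on_union)
    show "lip_on {0..T} W" using V(1) by (subst lip_on_cong[where g = V]) (auto simp: W_def)
    show "lip_on {T..M} W" using lE by (subst lip_on_cong[OF WE]) auto
  qed (use T in auto)
  have W_psd: "W t \<in> psd" if "t \<in> {0..M}" for t
  proof (cases "t \<le> T")
    case True then show ?thesis using V(2) that by (simp add: W_def)
  next
    case False
    have "0 \<le> w t" unfolding w_def using that l by (intro zero_le_power) (simp add: field_simps l_def)
    then show ?thesis using False VT G by (auto simp: W_def E_def intro!: psd_add psd_scaleR)
  qed
  have "(E has_integral (l / real (N + 1)) *\<^sub>R V T + (l\<^sup>2 / 2) *\<^sub>R G) {T..M}"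
    unfolding E_def by (intro has_integral_add has_integral_scaleR_left w_int v_int)
  moreover have "(l / real (N + 1)) *\<^sub>R V T + (l\<^sup>2 / 2) *\<^sub>R G = R" using l by (simp add: G_def)
  ultimately have "integral {T..M} E = R" by (simp add: integral_unique)
  then have "integral {T..M} W = R" using integral_cong[of "{T..M}" W E] WE by simp
  moreover have "integral {0..T} W = integral {0..T} V" by (rule integral_cong) (simp add: W_def)
  moreover have "W integrable_on {0..M}" by (rule integrable_continuous_real[OF lip_on_continuous[OF lW]])
  ultimately have "integral {0..M} W = Q"
    using Henstock_Kurzweil_Integration.integral_combine[of 0 T M W] T by (simp add: R_def)
  with lW W_psd show ?thesis by (intro that[of W]) (auto simp: W_def)
qed

lemma increasing_path_integral:
  fixes W :: "real \<Rightarrow> real^'m^'m"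
  assumes "M = real CARD('m)" "mixture \<beta>" "constraint_matrix Q" "order_fun M x"
    and W: "lip_on {0..M} W" "\<And>t. t \<in> {0..M} \<Longrightarrow> W t \<in> psd" "integral {0..M} W = Q"
  shows "increasing_path M \<beta> Q x (\<lambda>t. integral {0..t} W) W"
proof
  show "((\<lambda>t. integral {0..t} W) has_vector_derivative W t) (at t within {0..M})" if "t \<in> {0..M}" for t
    by (rule integral_has_vector_derivative[OF lip_on_continuous[OF W(1)] that])
qed (use assms in auto)

locale minimizing_path = truncated_path M \<beta> h Q x \<Phi> \<phi> T c
  for M :: real and \<beta> :: "nat \<Rightarrow> real^'m" and h :: "real^'m" and Q :: "real^'m^'m"
    and x :: "real \<Rightarrow> real" and \<Phi> \<phi> :: "real \<Rightarrow> real^'m^'m" and T c :: real +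
  assumes min: "crisanti_sommers_minimizer \<beta> h Q x \<Phi>"
begin

lemma trace_support: "t \<in> measure_support (order_measure M x) \<Longrightarrow> trace (\<Phi> t) = t"
  using min by (simp add: crisanti_sommers_minimizer_def admissible_def matrix_path_def M)

text \<open>The trace constraint is restored by a change of time, under which the functional is invariant.\<close>

lemma competitor:
  obtains \<eta> where "0 < \<eta>"
    "\<And>V. lip_on {0..T} V \<Longrightarrow> (\<And>t. t \<in> {0..T} \<Longrightarrow> V t \<in> psd) \<Longrightarrow> (\<And>t. t \<in> {0..T} \<Longrightarrow> norm (V t - \<phi> t) \<le> \<eta>) \<Longrightarrow>
      \<exists>F f. truncated_path M \<beta> Q x F f T (c/2) \<and> (\<forall>t\<in>{0..T}. f t = V t) \<and> J \<le> truncated_path.J \<beta> h Q x F f T"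
proof -
  obtain K where K: "0 < K" "\<And>A :: real^'m^'m. norm (trace A) \<le> norm A * K"
    using bounded_linear.pos_bounded[OF bounded_linear_trace] by blast
  define l where "l = M - T"
  have l: "0 < l" using T by (simp add: l_def)
  define \<eta> where "\<eta> = min (c / (2 * T)) (1 / (2 * (K * (2 + 2 * T / l))))"
  have den: "0 < K * (2 + 2 * T / l)" using K(1) T_pos l by (intro mult_pos_pos add_pos_nonneg) auto
  have \<eta>: "0 < \<eta>" using c T_pos den by (simp add: \<eta>_def)
  have \<eta>1: "\<eta> * T \<le> c / 2"
  proof -
    have "\<eta> * T \<le> c / (2 * T) * T" using T_pos by (intro mult_right_mono) (auto simp: \<eta>_def)
    then show ?thesis using T_pos by simp
  qed
  have \<eta>2: "K * \<eta> * (2 + 2 * T / l) \<le> 1 / 2"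
  proof -
    have "\<eta> * (K * (2 + 2 * T / l)) \<le> 1 / (2 * (K * (2 + 2 * T / l))) * (K * (2 + 2 * T / l))"
      using den by (intro mult_right_mono) (auto simp: \<eta>_def)
    also have "\<dots> = 1/2"
    proof -
      have "1 / (2 * z) * z = 1/2" if "0 < z" for z :: real using that by simp
      then show ?thesis using den by blast
    qed
    finally show ?thesis by (simp add: mult_ac)
  qed
  show ?thesis
  proof (rule that[OF \<eta>])
    fix V assume V: "lip_on {0..T} V" "\<And>t. t \<in> {0..T} \<Longrightarrow> V t \<in> psd" "\<And>t. t \<in> {0..T} \<Longrightarrow> norm (V t - \<phi> t) \<le> \<eta>"
    have Vi: "V integrable_on {0..T}" by (rule integrable_continuous_real[OF lip_on_continuous[OF V(1)]])
    have fi: "\<phi> integrable_on {0..T}" by (rule integrable_continuous_real[OF lip_on_continuous[OF \<phi>_sub(1)]])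
    have "norm (integral {0..T} (\<lambda>t. V t - \<phi> t)) \<le> \<eta> * (T - 0)"
      using T_pos V(3) by (intro integral_norm_le integrable_diff Vi fi) auto
    then have close: "norm (integral {0..T} V - \<Phi> T) \<le> c - c/2"
      using \<eta>1 T T_pos by (simp add: \<Phi>_integral integral_diff[OF Vi fi])
    have pdV: "pd (c/2) (Q - integral {0..T} V)"
    proof (rule pd_perturb[OF c(2)])
      have "Q \<in> psd" using Q by (simp add: constraint_matrix_def)
      then show "transpose (Q - integral {0..T} V) = Q - integral {0..T} V"
        using psd_sym[OF psd_integral[OF Vi V(2)]] psd_sym by (simp add: transpose_diff)
      have "Q - integral {0..T} V - (Q - \<Phi> T) = - (integral {0..T} V - \<Phi> T)" by simp
      then show "norm (Q - integral {0..T} V - (Q - \<Phi> T)) \<le> c - c/2" using close by (simp only: norm_minus_cancel)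
    qed
    obtain W where W: "lip_on {0..M} W" "\<And>t. t \<in> {0..T} \<Longrightarrow> W t = V t"
      "\<And>t. t \<in> {0..M} \<Longrightarrow> W t \<in> psd" "integral {0..M} W = Q"
      using extend_path[OF less_imp_le[OF T_pos] T(2) V(1,2) _ pdV] c by auto
    define F where "F t = integral {0..t} W" for t
    interpret F: increasing_path M \<beta> h Q x F W
      unfolding F_def using increasing_path_integral[OF M \<beta> Q x W(1,3,4)] .
    have FT: "F t = integral {0..t} V" if "t \<in> {0..T}" for t
      unfolding F_def using that W(2) by (intro integral_cong) auto
    interpret F: truncated_path M \<beta> h Q x F W T "c/2"
      by unfold_locales (use T c pdV FT T_pos in auto)
    define k0 where "k0 t = trace (V t - \<phi> t)" for t
    define k1 where "k1 = - k0 T - 2 * integral {0..T} k0 / l"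
    define k where "k t = (if t \<le> T then k0 t else k0 T * (1 - (t - T) / l) + k1 * ((t - T) / l))" for t
    have k0: "\<bar>k0 t\<bar> \<le> K * \<eta>" if "t \<in> {0..T}" for t
    proof -
      have "norm (k0 t) \<le> norm (V t - \<phi> t) * K" unfolding k0_def by (rule K(2))
      also have "\<dots> \<le> \<eta> * K" using V(3)[OF that] K(1) by (intro mult_right_mono) auto
      finally show ?thesis by (simp add: mult.commute)
    qed
    have lk0: "lip_on {0..T} k0"
      unfolding k0_def by (intro lip_on_linear[OF bounded_linear_trace] lip_intros V \<phi>_sub)
    have k0i: "k0 integrable_on {0..T}" by (rule integrable_continuous_real[OF lip_on_continuous[OF lk0]])
    have ik0: "\<bar>integral {0..T} k0\<bar> \<le> K * \<eta> * T"
      using integral_norm_le[OF k0i, of "K * \<eta>"] k0 T_pos by simp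
    have kl: "k t = k0 T * (1 - (t - T) / l) + k1 * ((t - T) / l)" if "t \<in> {T..M}" for t
      using that by (auto simp: k_def)
    have lip_k: "lip_on {0..M} k"
    proof (rule lip_on_union)
      show "lip_on {0..T} k" using lk0 by (subst lip_on_cong[where g = k0]) (auto simp: k_def)
      show "lip_on {T..M} k"
        by (subst lip_on_cong[OF kl]) (auto simp: divide_inverse intro!: lip_intros lip_on_id)
    qed (use T T_pos in auto)
    have K\<eta>: "0 \<le> K * \<eta>" using K(1) \<eta> by simp
    have kT: "\<bar>k0 T\<bar> \<le> K * \<eta>" using k0 T_pos by simp
    have k1: "\<bar>k1\<bar> \<le> K * \<eta> + 2 * (K * \<eta> * T) / l"
    proof -
      have "\<bar>k1\<bar> \<le> \<bar>k0 T\<bar> + \<bar>2 * integral {0..T} k0 / l\<bar>" unfolding k1_def by linarith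
      also have "\<bar>2 * integral {0..T} k0 / l\<bar> = 2 * \<bar>integral {0..T} k0\<bar> / l" using l by (simp add: abs_mult)
      also have "\<dots> \<le> 2 * (K * \<eta> * T) / l" using ik0 l by (intro divide_right_mono) auto
      finally show ?thesis using kT by linarith
    qed
    have tot: "K * \<eta> + (K * \<eta> + 2 * (K * \<eta> * T) / l) \<le> 1/2" using \<eta>2 by (simp add: algebra_simps)
    have k_bound: "\<bar>k t\<bar> \<le> 1/2" if "t \<in> {0..M}" for t
    proof (cases "t \<le> T")
      case True
      have "0 \<le> 2 * (K * \<eta> * T) / l" using K\<eta> T_pos l by simp
      then show ?thesis using True k0[of t] that tot K\<eta> by (simp add: k_def)
    next
      case False
      define s where "s = (t - T) / l"
      have s: "0 \<le> s" "s \<le> 1" using False that l by (auto simp: s_def l_def field_simps)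
      have "\<bar>k t\<bar> \<le> \<bar>k0 T\<bar> * (1 - s) + \<bar>k1\<bar> * s"
        using False s abs_triangle_ineq[of "k0 T * (1 - s)" "k1 * s"] by (simp add: k_def s_def[symmetric] abs_mult)
      also have "\<dots> \<le> \<bar>k0 T\<bar> * 1 + \<bar>k1\<bar> * 1" using s by (intro add_mono mult_left_mono) auto
      finally show ?thesis using kT k1 tot by linarith
    qed
    have int_k: "integral {0..M} k = 0"
    proof -
      have "((\<lambda>t. k0 T * (1 - (t - T) / l) + k1 * ((t - T) / l)) has_integral
        (k0 T * (M - T) + (k1 - k0 T) * ((M - T)\<^sup>2 / (2 * l))) - (k0 T * (T - T) + (k1 - k0 T) * ((T - T)\<^sup>2 / (2 * l)))) {T..M}"
        using T l by (intro fundamental_theorem_of_calculus)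
          (auto intro!: derivative_eq_intros simp: has_real_derivative_iff_has_vector_derivative[symmetric] field_simps)
      then have "(k has_integral (k0 T * (M - T) + (k1 - k0 T) * ((M - T)\<^sup>2 / (2 * l))) - (k0 T * (T - T) + (k1 - k0 T) * ((T - T)\<^sup>2 / (2 * l)))) {T..M}"
        by (rule has_integral_eq[rotated]) (simp add: kl)
      then have "integral {T..M} k = (k0 T + k1) * l / 2"
        using l by (simp add: integral_unique l_def[symmetric] field_simps power2_eq_square)
      also have "\<dots> = - integral {0..T} k0" using l by (simp add: k1_def)
      finally have "integral {T..M} k = - integral {0..T} k0" .
      moreover have "integral {0..T} k = integral {0..T} k0" by (rule integral_cong) (simp add: k_def)
      ultimately show ?thesis
        using Henstock_Kurzweil_Integration.integral_combine[of 0 T M k] T T_pos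
          integrable_continuous_real[OF lip_on_continuous[OF lip_k]] by simp
    qed
    interpret time_change M \<beta> h Q x F W T "c/2" k
      by unfold_locales (use lip_k k_bound int_k in auto)
    have "trace (F t) = \<theta> t" if t: "t \<in> measure_support (order_measure M x)" for t
    proof -
      have tT: "t \<in> {0..T}" using F.measure_support_subset t by auto
      have i: "V integrable_on {0..t}" "\<phi> integrable_on {0..t}"
        using tT by (auto intro: integrable_subinterval_real[OF Vi] integrable_subinterval_real[OF fi])
      have "integral {0..t} k = integral {0..t} (\<lambda>s. trace (V s - \<phi> s))"
        using tT by (intro integral_cong) (auto simp: k_def k0_def)
      also have "\<dots> = trace (integral {0..t} (\<lambda>s. V s - \<phi> s))"
        using integral_linear[OF integrable_diff[OF i] bounded_linear_trace] by (simp add: o_def)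
      also have "\<dots> = trace (F t) - trace (\<Phi> t)"
        using tT T FT[OF tT] \<Phi>_integral[of t] i by (simp add: integral_diff trace_sub)
      finally show ?thesis using trace_support[OF t] tT T by (simp add: \<theta>_def)
    qed
    note adm = admissible_\<Psi>[OF this]
    have "crisanti_sommers \<beta> h x \<Phi> \<le> crisanti_sommers \<beta> h y \<Psi>"
      using min adm(1) unfolding crisanti_sommers_minimizer_def by blast
    then have "J \<le> F.J" using adm(2) crisanti_sommers_eq by simp
    moreover have "truncated_path M \<beta> Q x F W T (c/2)" by (rule F.truncated_path_axioms)
    ultimately show "\<exists>F f. truncated_path M \<beta> Q x F f T (c/2) \<and> (\<forall>t\<in>{0..T}. f t = V t) \<and> J \<le> truncated_path.J \<beta> h Q x F f T"
      using W(2) by blast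
  qed
qed

end

subsection \<open>The first variation\<close>

lemma norm_mm3_le:
  fixes A B C :: "real^'n^'n"
  shows "norm (A ** B ** C) \<le> norm A * norm B * norm C"
  by (rule order.trans[OF norm_matrix_mult_le mult_right_mono[OF norm_matrix_mult_le norm_ge_zero]])

context truncated_path
begin

definition G :: "real \<Rightarrow> real^'m^'m" where "G t = X t ** \<phi> t ** X t"
definition K :: "real \<Rightarrow> real^'m^'m" where "K t = integral {0..t} G"
definition D :: "real \<Rightarrow> real^'m^'m" where "D t = p t - K t"
definition D' :: "real \<Rightarrow> real^'m^'m" where "D' t = S t - G t"

lemma lip_G: "lip_on {0..T} G"
  unfolding G_def by (intro lip_intros lip_X \<phi>_sub)

lemma cont_G: "continuous_on {0..T} G" by (rule lip_on_continuous[OF lip_G])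

lemma lip_K: "lip_on {0..T} K"
proof -
  obtain B where "0 < B" "\<And>t. t \<in> {0..T} \<Longrightarrow> norm (G t) \<le> B" using continuous_on_Icc_bounded[OF cont_G] by metis
  then show ?thesis unfolding K_def
    by (intro lip_on_integral(1)[of G] integrable_continuous_real cont_G)
qed

lemma lip_D: "lip_on {0..T} D" "lip_on {0..T} D'"
  unfolding D_def D'_def by (intro lip_intros \<phi>_sub lip_K lip_G)+

lemma D_deriv:
  assumes "t \<in> {0..T}" shows "(D has_vector_derivative D' t) (at t within {0..T})"
  unfolding D_def D'_def K_def
proof (rule has_vector_derivative_diff)
  show "(p has_vector_derivative S t) (at t within {0..T})"
    by (rule has_vector_derivative_within_subset[OF p_deriv]) (use assms T in auto)
  show "((\<lambda>t. integral {0..t} G) has_vector_derivative G t) (at t within {0..T})"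
    by (rule integral_has_vector_derivative[OF cont_G assms])
qed

lemma X_sym: "t \<in> {0..T} \<Longrightarrow> transpose (X t) = X t" by (rule psd_sym[OF X_psd])

lemma G_psd:
  assumes "t \<in> {0..T}" shows "G t \<in> psd"
  unfolding G_def using psd_congruence[OF psd_\<phi>[of t], of "X t"] X_sym[OF assms] assms T by simp

lemma X_integral:
  assumes t: "t \<in> {0..T}" shows "X t = X T - integral {t..T} (\<lambda>s. x s *\<^sub>R G s)"
proof -
  obtain b L where b: "0 < b" "\<And>t. t \<in> {0..T} \<Longrightarrow> norm (X t) \<le> b" "0 < L"
    "\<And>s t. s \<in> {0..T} \<Longrightarrow> t \<in> {0..T} \<Longrightarrow> norm (X t - X s) \<le> L * \<bar>t - s\<bar>" using lip_onE[OF lip_X] by metis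
  obtain B where B: "0 < B" "\<And>t. t \<in> {0..T} \<Longrightarrow> norm (\<phi> t) \<le> B"
    using continuous_on_Icc_bounded[OF lip_on_continuous[OF \<phi>_sub(1)]] by metis
  have xG: "(\<lambda>s. x s *\<^sub>R G s) integrable_on {0..T}"
    using T by (intro mono_scaleR_integrable x_mono_on cont_G) auto
  define E where "E t = X t + integral {t..T} (\<lambda>s. x s *\<^sub>R G s)" for t
  have const: "E u = E 0" if "u \<in> {0..T}" for u
  proof (rule quadratic_increments_constant[where f = E and a = 0 and b = T and C = "2 * L * B * b"])
    fix u v assume uv: "0 \<le> u" "u \<le> v" "v \<le> T"
    have m: "u \<in> {0..T}" "v \<in> {0..T}" and sub: "{u..v} \<subseteq> {0..T}" using uv by auto
    have bl: "bounded_linear (\<lambda>A. X u ** A ** X v)"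
      by (rule bounded_linear_compose[OF mm.bounded_linear_left mm.bounded_linear_right])
    have xi: "(\<lambda>s. x s *\<^sub>R \<phi> s) integrable_on {u..v}" using uv T by (intro int_x\<phi>) auto
    have i1: "(\<lambda>s. x s *\<^sub>R (X u ** \<phi> s ** X v)) integrable_on {u..v}"
      using integrable_linear[OF xi bl] by (simp add: o_def mm_simps)
    have i2: "(\<lambda>s. x s *\<^sub>R G s) integrable_on {u..v}" using integrable_subinterval_real[OF xG] sub by auto
    have "X v - X u = integral {u..v} (\<lambda>s. x s *\<^sub>R (X u ** \<phi> s ** X v))"
      unfolding X_diff[OF m] hat_diff[OF uv]
      using integral_linear[OF xi bl] by (simp add: o_def mm_simps)
    then have "E v - E u = integral {u..v} (\<lambda>s. x s *\<^sub>R (X u ** \<phi> s ** X v)) - integral {u..v} (\<lambda>s. x s *\<^sub>R G s)"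
      using integral_diff_interval(2)[OF xG uv] by (simp add: E_def algebra_simps)
    also have "\<dots> = integral {u..v} (\<lambda>s. x s *\<^sub>R (X u ** \<phi> s ** X v) - x s *\<^sub>R G s)"
      by (rule integral_diff[OF i1 i2, symmetric])
    also have "norm \<dots> \<le> (2 * (L * (v - u)) * B * b) * (v - u)"
    proof (rule integral_norm_le[OF integrable_diff[OF i1 i2] _ uv(2)])
      fix s assume s: "s \<in> {u..v}"
      have sT: "s \<in> {0..T}" using s sub by auto
      have X1: "norm (X u - X s) \<le> L * (v - u)"
        by (rule order.trans[OF b(4)[OF sT m(1)] mult_left_mono]) (use s b(3) in auto)
      have X2: "norm (X v - X s) \<le> L * (v - u)"
        by (rule order.trans[OF b(4)[OF sT m(2)] mult_left_mono]) (use s b(3) in auto)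
      have "X u ** \<phi> s ** X v - G s = (X u - X s) ** \<phi> s ** X v + X s ** \<phi> s ** (X v - X s)"
        by (simp add: G_def mm_simps)
      also have "norm \<dots> \<le> (L * (v - u)) * B * b + b * B * (L * (v - u))"
        by (intro order.trans[OF norm_triangle_ineq] add_mono order.trans[OF norm_mm3_le] mult_mono X1 X2 B(2) b(2) sT m)
           (use uv b B in auto)
      finally have n: "norm (X u ** \<phi> s ** X v - G s) \<le> 2 * (L * (v - u)) * B * b" by (simp add: mult_ac)
      have "norm (x s *\<^sub>R (X u ** \<phi> s ** X v) - x s *\<^sub>R G s) = \<bar>x s\<bar> * norm (X u ** \<phi> s ** X v - G s)"
        by (metis norm_scaleR scaleR_diff_right)
      also have "\<dots> \<le> 1 * (2 * (L * (v - u)) * B * b)"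
        using x_range[of s] sT T n by (intro mult_mono) auto
      finally show "norm (x s *\<^sub>R (X u ** \<phi> s ** X v) - x s *\<^sub>R G s) \<le> 2 * (L * (v - u)) * B * b" by simp
    qed
    finally show "norm (E v - E u) \<le> 2 * L * B * b * (v - u)\<^sup>2" by (simp add: power2_eq_square mult_ac)
  qed (use that in auto)
  have "E t = E T" using const[OF t] const[of T] T_pos by simp
  then show ?thesis by (simp add: E_def algebra_simps)
qed

lemma Xi_taylor:
  obtains B where "0 < B" "\<And>A t. t \<in> {0..M} \<Longrightarrow> (\<And>i j. \<bar>A $ i $ j\<bar> \<le> 1) \<Longrightarrow>
    \<bar>Xi \<beta> h A - Xi \<beta> h (\<Phi> t) - p t \<bullet> (A - \<Phi> t)\<bar> \<le> B * (norm (A - \<Phi> t))\<^sup>2"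
proof -
  obtain B where B: "0 < B" "\<And>i j s t. \<bar>s\<bar> \<le> 1 \<Longrightarrow> \<bar>t\<bar> \<le> 1 \<Longrightarrow>
    \<bar>xi_fun 0 \<beta> i j t - xi_fun 0 \<beta> i j s - xi_fun (Suc 0) \<beta> i j s * (t - s)\<bar> \<le> B * (t - s)\<^sup>2"
    using xi_fun_taylor[OF \<beta>, of 0] by metis
  show ?thesis
  proof (rule that[OF B(1)])
    fix A :: "real^'m^'m" and t assume t: "t \<in> {0..M}" and A: "\<And>i j. \<bar>A $ i $ j\<bar> \<le> 1"
    let ?r = "\<lambda>i j. xi_fun 0 \<beta> i j (A $ i $ j) - xi_fun 0 \<beta> i j (\<Phi> t $ i $ j) - xi_fun (Suc 0) \<beta> i j (\<Phi> t $ i $ j) * (A $ i $ j - \<Phi> t $ i $ j)"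
    have "p t \<bullet> (A - \<Phi> t) = (\<Sum>i\<in>UNIV. \<Sum>j\<in>UNIV. xi_fun (Suc 0) \<beta> i j (\<Phi> t $ i $ j) * (A $ i $ j - \<Phi> t $ i $ j)) + (h \<otimes> h) \<bullet> (A - \<Phi> t)"
      by (simp add: p_def inner_add_left xi_entries[OF t] inner_matrix sum.distrib distrib_right)
    then have "Xi \<beta> h A - Xi \<beta> h (\<Phi> t) - p t \<bullet> (A - \<Phi> t) = (\<Sum>i\<in>UNIV. \<Sum>j\<in>UNIV. ?r i j)"
      by (simp add: Xi_def inner_diff_right sum_subtractf)
    also have "\<bar>\<dots>\<bar> \<le> (\<Sum>i\<in>UNIV. \<Sum>j\<in>UNIV. B * (A $ i $ j - \<Phi> t $ i $ j)\<^sup>2)"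
      by (intro order.trans[OF sum_abs] sum_mono B(2) A \<Phi>_entries[OF t])
    also have "\<dots> = B * (norm (A - \<Phi> t))\<^sup>2"
      by (simp add: power2_norm_eq_inner inner_matrix sum_distrib_left power2_eq_square[of "_ - _"])
    finally show "\<bar>Xi \<beta> h A - Xi \<beta> h (\<Phi> t) - p t \<bullet> (A - \<Phi> t)\<bar> \<le> B * (norm (A - \<Phi> t))\<^sup>2" .
  qed
qed

end

context minimizing_path
begin

text \<open>Integrated by parts, the variation is \<open>- \<integral> D \<bullet> \<Psi> d\<mu>\<close>, where \<open>\<Psi>\<close> is the primitive of \<open>\<psi>\<close> and
  \<open>\<mu>\<close> is the order measure.\<close>

definition variation :: "(real \<Rightarrow> real^'m^'m) \<Rightarrow> real" where
  "variation \<psi> = integral {0..T} (\<lambda>t. x t * (D' t \<bullet> integral {0..t} \<psi> + D t \<bullet> \<psi> t)) - D T \<bullet> integral {0..T} \<psi>"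

lemma variation_eq:
  assumes \<psi>: "lip_on {0..T} \<psi>"
  defines "\<Psi> \<equiv> \<lambda>t. integral {0..t} \<psi>"
  defines "P \<equiv> \<lambda>t. integral {t..T} (\<lambda>s. x s *\<^sub>R \<psi> s) - \<Psi> T"
  shows "variation \<psi> = (integral {0..T} (\<lambda>t. x t * (S t \<bullet> \<Psi> t + p t \<bullet> \<psi> t)) - p T \<bullet> \<Psi> T)
    - X T \<bullet> \<Psi> T + integral {0..T} (\<lambda>t. X t \<bullet> \<psi> t - G t \<bullet> P t)"
proof -
  have c\<psi>: "continuous_on {0..T} \<psi>" by (rule lip_on_continuous[OF \<psi>])
  have i\<psi>: "\<psi> integrable_on {0..T}" by (rule integrable_continuous_real[OF c\<psi>])
  obtain B where B: "\<And>t. t \<in> {0..T} \<Longrightarrow> norm (\<psi> t) \<le> B" using continuous_on_Icc_bounded[OF c\<psi>] by metis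
  have c\<Psi>: "continuous_on {0..T} \<Psi>" unfolding \<Psi>_def by (rule lip_on_continuous[OF lip_on_integral(1)[OF i\<psi> B]])
  have mx: "mono_on {0..T} x" using T by (intro x_mono_on) auto
  have bx: "\<bar>x t\<bar> \<le> 1" if "t \<in> {0..T}" for t using x_range[of t] that T by auto
  have x\<psi>: "(\<lambda>s. x s *\<^sub>R \<psi> s) integrable_on {0..T}" by (rule mono_scaleR_integrable[OF mx c\<psi>])
  have xG: "(\<lambda>s. x s *\<^sub>R G s) integrable_on {0..T}" by (rule mono_scaleR_integrable[OF mx cont_G])
  have cP: "continuous_on {0..T} P"
  proof -
    have "norm (x t *\<^sub>R \<psi> t) \<le> B" if "t \<in> {0..T}" for t
      using mult_mono[OF bx[OF that] B[OF that]] by simp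
    from lip_on_continuous[OF lip_on_integral(2)[OF x\<psi> this]] show ?thesis
      unfolding P_def by (intro continuous_intros)
  qed
  have cX: "continuous_on {0..T} X" "continuous_on {0..T} p" "continuous_on {0..T} S" "continuous_on {0..T} K"
    by (auto intro: lip_on_continuous lip_X \<phi>_sub lip_K)
  have iG: "G integrable_on {0..T}" by (rule integrable_continuous_real[OF cont_G])
  have I1: "integral {0..T} (\<lambda>t. G t \<bullet> P t) = integral {0..T} (\<lambda>t. x t * (K t \<bullet> \<psi> t)) - K T \<bullet> \<Psi> T"
  proof -
    have c: "continuous_on {0..T} (\<lambda>t. G t \<bullet> integral {t..T} (\<lambda>s. x s *\<^sub>R \<psi> s))"
    proof -
      have "continuous_on {0..T} (\<lambda>t. G t \<bullet> (P t + \<Psi> T))" by (intro continuous_intros cP cont_G)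
      then show ?thesis by (simp add: P_def)
    qed
    have "integral {0..T} (\<lambda>t. G t \<bullet> P t) = integral {0..T} (\<lambda>t. G t \<bullet> integral {t..T} (\<lambda>s. x s *\<^sub>R \<psi> s)) - integral {0..T} (\<lambda>t. G t \<bullet> \<Psi> T)"
      unfolding P_def inner_diff_right
      by (intro integral_diff integrable_continuous_real c continuous_intros cont_G)
    also have "integral {0..T} (\<lambda>t. G t \<bullet> \<Psi> T) = K T \<bullet> \<Psi> T"
      using integral_linear[OF iG bounded_linear_inner_left[of "\<Psi> T"]] by (simp add: o_def K_def)
    also have "integral {0..T} (\<lambda>t. G t \<bullet> integral {t..T} (\<lambda>s. x s *\<^sub>R \<psi> s)) = integral {0..T} (\<lambda>t. x t * (K t \<bullet> \<psi> t))"
      using mono_integral_by_parts[OF mx bx less_imp_le[OF T_pos] cont_G c\<psi>] by (simp add: K_def)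
    finally show ?thesis .
  qed
  have I2: "integral {0..T} (\<lambda>t. X t \<bullet> \<psi> t) = X T \<bullet> \<Psi> T - integral {0..T} (\<lambda>t. x t * (G t \<bullet> \<Psi> t))"
  proof -
    have eq: "integral {t..T} (\<lambda>s. x s *\<^sub>R G s) = X T - X t" if "t \<in> {0..T}" for t
      using X_integral[OF that] by simp
    have c: "continuous_on {0..T} (\<lambda>t. \<psi> t \<bullet> integral {t..T} (\<lambda>s. x s *\<^sub>R G s))"
    proof -
      have "continuous_on {0..T} (\<lambda>t. \<psi> t \<bullet> (X T - X t))" by (intro continuous_intros cX c\<psi>)
      then show ?thesis by (subst continuous_on_cong[OF refl, where g = "\<lambda>t. \<psi> t \<bullet> (X T - X t)"]) (auto simp: eq)
    qed
    have "integral {0..T} (\<lambda>t. X t \<bullet> \<psi> t) = integral {0..T} (\<lambda>t. X T \<bullet> \<psi> t - \<psi> t \<bullet> integral {t..T} (\<lambda>s. x s *\<^sub>R G s))"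
      by (rule integral_cong) (simp add: eq inner_diff_right inner_commute)
    also have "\<dots> = integral {0..T} (\<lambda>t. X T \<bullet> \<psi> t) - integral {0..T} (\<lambda>t. \<psi> t \<bullet> integral {t..T} (\<lambda>s. x s *\<^sub>R G s))"
      by (intro integral_diff integrable_continuous_real c continuous_intros c\<psi>)
    also have "integral {0..T} (\<lambda>t. X T \<bullet> \<psi> t) = X T \<bullet> \<Psi> T"
      using integral_linear[OF i\<psi> bounded_linear_inner_right[of "X T"]] by (simp add: o_def \<Psi>_def)
    also have "integral {0..T} (\<lambda>t. \<psi> t \<bullet> integral {t..T} (\<lambda>s. x s *\<^sub>R G s)) = integral {0..T} (\<lambda>t. x t * (G t \<bullet> \<Psi> t))"
      using mono_integral_by_parts[OF mx bx less_imp_le[OF T_pos] c\<psi> cont_G] by (simp add: \<Psi>_def inner_commute)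
    finally show ?thesis .
  qed
  have i: "(\<lambda>t. x t * (S t \<bullet> \<Psi> t + p t \<bullet> \<psi> t)) integrable_on {0..T}"
    "(\<lambda>t. x t * (G t \<bullet> \<Psi> t)) integrable_on {0..T}" "(\<lambda>t. x t * (K t \<bullet> \<psi> t)) integrable_on {0..T}"
    by (intro mono_mult_integrable mx continuous_intros cX cont_G c\<psi> c\<Psi>)+
  have "integral {0..T} (\<lambda>t. x t * (D' t \<bullet> \<Psi> t + D t \<bullet> \<psi> t))
    = integral {0..T} (\<lambda>t. x t * (S t \<bullet> \<Psi> t + p t \<bullet> \<psi> t) - x t * (G t \<bullet> \<Psi> t) - x t * (K t \<bullet> \<psi> t))"
    by (rule integral_cong) (simp add: D_def D'_def inner_diff_left algebra_simps)
  also have "\<dots> = integral {0..T} (\<lambda>t. x t * (S t \<bullet> \<Psi> t + p t \<bullet> \<psi> t)) - integral {0..T} (\<lambda>t. x t * (G t \<bullet> \<Psi> t)) - integral {0..T} (\<lambda>t. x t * (K t \<bullet> \<psi> t))"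
    using i by (simp add: integral_diff integrable_diff)
  moreover have "integral {0..T} (\<lambda>t. X t \<bullet> \<psi> t - G t \<bullet> P t) = integral {0..T} (\<lambda>t. X t \<bullet> \<psi> t) - integral {0..T} (\<lambda>t. G t \<bullet> P t)"
    by (intro integral_diff integrable_continuous_real continuous_intros cX c\<psi> cont_G cP)
  ultimately show ?thesis
    unfolding variation_def \<Psi>_def[symmetric] I1 I2 by (simp add: D_def inner_diff_left \<Psi>_def)
qed

end

lemma nonneg_of_quadratic_error:
  fixes v C e :: real
  assumes e: "0 < e" and le: "\<And>s. 0 < s \<Longrightarrow> s \<le> e \<Longrightarrow> 0 \<le> s * v + C * s\<^sup>2"
  shows "0 \<le> v"
proof (rule ccontr)
  assume v: "\<not> 0 \<le> v"
  define s where "s = min e (- v / (2 * (\<bar>C\<bar> + 1)))"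
  have s: "0 < s" "s \<le> e" using e v by (auto simp: s_def divide_neg_pos)
  have "s * (\<bar>C\<bar> + 1) \<le> - v / 2"
  proof -
    have "s * (\<bar>C\<bar> + 1) \<le> (- v / (2 * (\<bar>C\<bar> + 1))) * (\<bar>C\<bar> + 1)" by (intro mult_right_mono) (auto simp: s_def)
    moreover have "- v / (2 * n) * n = - v / 2" if "0 < n" for n :: real using that by simp
    ultimately show ?thesis by (metis abs_ge_zero add_nonneg_pos zero_less_one)
  qed
  moreover have "C * s \<le> s * (\<bar>C\<bar> + 1)" using s mult_left_mono[of C "\<bar>C\<bar> + 1" s] by (simp add: mult.commute)
  ultimately have "v + C * s < 0" using v by linarith
  then have "s * (v + C * s) < 0" using s(1) by (simp add: mult_pos_neg)
  then show False using le[OF s] by (simp add: algebra_simps power2_eq_square)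
qed

lemma continuous_family_bounded:
  fixes A :: "(real \<Rightarrow> 'a::real_normed_vector) set"
  assumes "finite A" "\<And>f. f \<in> A \<Longrightarrow> continuous_on {a..b} f"
  obtains B where "m \<le> B" "\<And>f t. f \<in> A \<Longrightarrow> t \<in> {a..b} \<Longrightarrow> norm (f t) \<le> B"
proof -
  have "\<exists>B\<ge>m. \<forall>f\<in>A. \<forall>t\<in>{a..b}. norm (f t) \<le> B"
    using assms
  proof (induction A)
    case (insert f A)
    then obtain B where B: "m \<le> B" "\<forall>f\<in>A. \<forall>t\<in>{a..b}. norm (f t) \<le> B" by auto
    obtain B' where B': "\<And>t. t \<in> {a..b} \<Longrightarrow> norm (f t) \<le> B'"
      using continuous_on_Icc_bounded[OF insert.prems[OF insertI1]] by metis
    show ?case using B B' by (intro exI[of _ "max B B'"]) (auto simp: le_max_iff_disj)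
  qed auto
  then show ?thesis using that by blast
qed

context minimizing_path
begin

lemma variation_nonneg:
  assumes \<psi>: "lip_on {0..T} \<psi>" and \<omega>: "lip_on {0..T} \<omega>"
    and psd: "\<And>s t. 0 < s \<Longrightarrow> s \<le> 1/2 \<Longrightarrow> t \<in> {0..T} \<Longrightarrow> \<phi> t + s *\<^sub>R \<psi> t + s\<^sup>2 *\<^sub>R \<omega> t \<in> psd"
  shows "0 \<le> variation \<psi>"
proof -
  define \<Psi> where "\<Psi> t = integral {0..t} \<psi>" for t
  define \<Omega> where "\<Omega> t = integral {0..t} \<omega>" for t
  define P where "P t = integral {t..T} (\<lambda>s. x s *\<^sub>R \<psi> s) - \<Psi> T" for t
  define R where "R t = integral {t..T} (\<lambda>s. x s *\<^sub>R \<omega> s) - \<Omega> T" for t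
  have T0: "0 \<le> T" using T_pos by simp
  have mx: "mono_on {0..T} x" using T by (intro x_mono_on) auto
  have bx: "\<bar>x t\<bar> \<le> 1" if "t \<in> {0..T}" for t using x_range[of t] that T by auto
  have c: "continuous_on {0..T} \<psi>" "continuous_on {0..T} \<omega>" "continuous_on {0..T} \<phi>" "continuous_on {0..T} X"
    "continuous_on {0..T} p" "continuous_on {0..T} S"
    by (auto intro: lip_on_continuous \<psi> \<omega> \<phi>_sub lip_X)
  have i: "\<psi> integrable_on {0..T}" "\<omega> integrable_on {0..T}" "\<phi> integrable_on {0..T}"
    by (auto intro: integrable_continuous_real c)
  have primitive: "lip_on {0..T} (\<lambda>t. integral {0..t} f)" "lip_on {0..T} (\<lambda>t. integral {t..T} (\<lambda>s. x s *\<^sub>R f s))"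
    if f: "continuous_on {0..T} f" for f :: "real \<Rightarrow> real^'m^'m"
  proof -
    obtain B where B: "\<And>t. t \<in> {0..T} \<Longrightarrow> norm (f t) \<le> B" using continuous_on_Icc_bounded[OF f] by metis
    have xB: "norm (x t *\<^sub>R f t) \<le> B" if "t \<in> {0..T}" for t
      using mult_mono[OF bx[OF that] B[OF that]] by simp
    show "lip_on {0..T} (\<lambda>t. integral {0..t} f)" "lip_on {0..T} (\<lambda>t. integral {t..T} (\<lambda>s. x s *\<^sub>R f s))"
      using lip_on_integral(1)[OF integrable_continuous_real[OF f] B]
        lip_on_integral(2)[OF mono_scaleR_integrable[OF mx f] xB] by auto
  qed
  have lips: "lip_on {0..T} \<Psi>" "lip_on {0..T} \<Omega>" "lip_on {0..T} P" "lip_on {0..T} R"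
    unfolding \<Psi>_def \<Omega>_def P_def R_def by (intro primitive c lip_intros)+
  have c2: "continuous_on {0..T} \<Psi>" "continuous_on {0..T} \<Omega>" "continuous_on {0..T} P" "continuous_on {0..T} R"
    using lips by (auto intro: lip_on_continuous)
  obtain b where b: "1 \<le> b" "2 * M / c \<le> b"
    and bnd: "\<And>t. t \<in> {0..T} \<Longrightarrow> norm (\<psi> t) \<le> b \<and> norm (\<omega> t) \<le> b \<and> norm (\<phi> t) \<le> b \<and> norm (X t) \<le> b \<and> norm (p t) \<le> b
      \<and> norm (\<Psi> t) \<le> b \<and> norm (\<Omega> t) \<le> b \<and> norm (P t) \<le> b \<and> norm (R t) \<le> b"
  proof -
    obtain b where "max 1 (2 * M / c) \<le> b"
      "\<And>f t. f \<in> {\<psi>, \<omega>, \<phi>, X, p, \<Psi>, \<Omega>, P, R} \<Longrightarrow> t \<in> {0..T} \<Longrightarrow> norm (f t) \<le> b"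
      by (rule continuous_family_bounded[where A = "{\<psi>, \<omega>, \<phi>, X, p, \<Psi>, \<Omega>, P, R}" and m = "max 1 (2 * M / c)" and a = 0 and b = T])
        (use c c2 in auto)
    then show ?thesis by (intro that[of b]) auto
  qed
  have b0: "0 \<le> b" using b(1) by simp
  obtain B where B: "0 < B" "\<And>A t. t \<in> {0..M} \<Longrightarrow> (\<And>i j. \<bar>A $ i $ j\<bar> \<le> 1) \<Longrightarrow>
    \<bar>Xi \<beta> h A - Xi \<beta> h (\<Phi> t) - p t \<bullet> (A - \<Phi> t)\<bar> \<le> B * (norm (A - \<Phi> t))\<^sup>2"
    using Xi_taylor by metis
  obtain \<eta> where \<eta>: "0 < \<eta>"
    "\<And>V. lip_on {0..T} V \<Longrightarrow> (\<And>t. t \<in> {0..T} \<Longrightarrow> V t \<in> psd) \<Longrightarrow> (\<And>t. t \<in> {0..T} \<Longrightarrow> norm (V t - \<phi> t) \<le> \<eta>) \<Longrightarrow>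
      \<exists>F f. truncated_path M \<beta> Q x F f T (c/2) \<and> (\<forall>t\<in>{0..T}. f t = V t) \<and> J \<le> truncated_path.J \<beta> h Q x F f T"
    using competitor by metis
  define e where "e = min (1/2) (\<eta> / (2 * b))"
  have e: "0 < e" using \<eta>(1) b(1) by (simp add: e_def)
  define C1 where "C1 = B * (2 * b)\<^sup>2 + b * b"
  define C3 where "C3 = b * b * b * b + b * (2 * b) * b * (2 * b) * b * b + b * (2 * b) * b * b + b * b"
  define C where "C = C1 + b * b + C3 * T"
  show ?thesis
  proof (rule nonneg_of_quadratic_error[OF e, of _ C])
    fix s assume s: "0 < s" "s \<le> e"
    have s12: "s \<le> 1/2" and s\<eta>: "2 * b * s \<le> \<eta>"
    proof -
      show "s \<le> 1/2" using s by (simp add: e_def)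
      have "s \<le> \<eta> / (2 * b)" using s by (simp add: e_def)
      then show "2 * b * s \<le> \<eta>" using b(1) by (simp add: field_simps)
    qed
    have ss: "s\<^sup>2 \<le> s" "0 \<le> s\<^sup>2" using s s12 mult_left_mono[of s 1 s] by (auto simp: power2_eq_square)
    have comb: "norm (s *\<^sub>R A + s\<^sup>2 *\<^sub>R A') \<le> 2 * b * s" if "norm A \<le> b" "norm A' \<le> b" for A A' :: "real^'m^'m"
    proof -
      have "norm (s *\<^sub>R A + s\<^sup>2 *\<^sub>R A') \<le> s * norm A + s\<^sup>2 * norm A'"
        using s by (intro order.trans[OF norm_triangle_ineq]) simp
      also have "\<dots> \<le> s * b + s * b"
        using that s ss b0 by (intro add_mono mult_mono) auto
      finally show ?thesis by simp
    qed
    have sq: "\<bar>s\<^sup>2 * z\<bar> \<le> b * b * s\<^sup>2" if "\<bar>z\<bar> \<le> b * b" for z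
      using mult_right_mono[OF that ss(2)] by (simp add: abs_mult mult.commute)
    define V where "V t = \<phi> t + s *\<^sub>R \<psi> t + s\<^sup>2 *\<^sub>R \<omega> t" for t
    have lV: "lip_on {0..T} V" unfolding V_def by (intro lip_intros \<psi> \<omega> \<phi>_sub)
    have "norm (V t - \<phi> t) \<le> \<eta>" if "t \<in> {0..T}" for t
      using comb[of "\<psi> t" "\<omega> t"] bnd[OF that] s\<eta> by (simp add: V_def algebra_simps)
    then obtain F f where Ff: "truncated_path M \<beta> Q x F f T (c/2)" and fV: "\<And>t. t \<in> {0..T} \<Longrightarrow> f t = V t"
      and JF: "J \<le> truncated_path.J \<beta> h Q x F f T"
      using \<eta>(2)[OF lV] psd[OF s(1) s12] unfolding V_def by blast
    interpret F: truncated_path M \<beta> h Q x F f T "c/2" by (rule Ff)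
    have sub: "t \<in> {0..M}" if "t \<in> {0..T}" for t using that T by auto
    have Ft: "F t = \<Phi> t + s *\<^sub>R \<Psi> t + s\<^sup>2 *\<^sub>R \<Omega> t" if t: "t \<in> {0..T}" for t
    proof -
      have j: "\<psi> integrable_on {0..t}" "\<omega> integrable_on {0..t}" "\<phi> integrable_on {0..t}"
        using i t by (auto intro: integrable_subinterval_real)
      have "F t = integral {0..t} V"
        unfolding F.\<Phi>_integral[OF sub[OF t]] using t by (intro integral_cong fV) auto
      also have "\<dots> = integral {0..t} \<phi> + s *\<^sub>R integral {0..t} \<psi> + s\<^sup>2 *\<^sub>R integral {0..t} \<omega>"
        unfolding V_def using j by (simp add: integral_add integrable_add integrable_cmul)
      finally show ?thesis by (simp add: \<Phi>_integral[OF sub[OF t]] \<Psi>_def \<Omega>_def)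
    qed
    have hatF: "F.hat t = hat t + s *\<^sub>R P t + s\<^sup>2 *\<^sub>R R t" if t: "t \<in> {0..T}" for t
    proof -
      have st: "{t..T} \<subseteq> {0..T}" using t by auto
      have j: "(\<lambda>u. x u *\<^sub>R \<psi> u) integrable_on {t..T}" "(\<lambda>u. x u *\<^sub>R \<omega> u) integrable_on {t..T}" "(\<lambda>u. x u *\<^sub>R \<phi> u) integrable_on {t..T}"
        using c st by (auto intro!: mono_scaleR_integrable mono_on_subset[OF mx] intro: continuous_on_subset)
      have "integral {t..T} (\<lambda>u. x u *\<^sub>R f u) = integral {t..T} (\<lambda>u. x u *\<^sub>R \<phi> u + s *\<^sub>R (x u *\<^sub>R \<psi> u) + s\<^sup>2 *\<^sub>R (x u *\<^sub>R \<omega> u))"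
        using t by (intro integral_cong) (simp add: fV V_def algebra_simps)
      also have "\<dots> = integral {t..T} (\<lambda>u. x u *\<^sub>R \<phi> u) + s *\<^sub>R integral {t..T} (\<lambda>u. x u *\<^sub>R \<psi> u) + s\<^sup>2 *\<^sub>R integral {t..T} (\<lambda>u. x u *\<^sub>R \<omega> u)"
        using j by (simp add: integral_add integrable_add integrable_cmul del: scaleR_scaleR)
      finally show ?thesis
        using Ft[of T] T0 by (simp add: F.hat_def hat_def P_def R_def algebra_simps)
    qed
    have XF: "norm (F.X t) \<le> b" if "t \<in> {0..T}" for t
      using pd_norm_inv[OF F.pd_hat[OF that] F.c(1)] b(2) by (simp add: F.X_def M mult.commute)

    define r where "r t = Xi \<beta> h (F t) - Xi \<beta> h (\<Phi> t) - s * (p t \<bullet> \<Psi> t)" for t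
    define r' where "r' t = F.p t \<bullet> f t - p t \<bullet> \<phi> t - s * (S t \<bullet> \<Psi> t + p t \<bullet> \<psi> t)" for t
    have cF: "continuous_on {0..T} f" "continuous_on {0..T} F.p" "continuous_on {0..T} F.X"
      by (auto intro: lip_on_continuous F.\<phi>_sub F.lip_X)
    have r_bound: "\<bar>r t\<bar> \<le> C1 * s\<^sup>2" if t: "t \<in> {0..T}" for t
    proof -
      have Fd: "F t - \<Phi> t = s *\<^sub>R \<Psi> t + s\<^sup>2 *\<^sub>R \<Omega> t" using Ft[OF t] by simp
      have "\<bar>Xi \<beta> h (F t) - Xi \<beta> h (\<Phi> t) - p t \<bullet> (F t - \<Phi> t)\<bar> \<le> B * (norm (F t - \<Phi> t))\<^sup>2"
        by (rule B(2)[OF sub[OF t] F.\<Phi>_entries[OF sub[OF t]]])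
      also have "\<dots> \<le> B * (2 * b * s)\<^sup>2"
        unfolding Fd using comb bnd[OF t] B(1) by (intro mult_left_mono power_mono) auto
      finally have 1: "\<bar>Xi \<beta> h (F t) - Xi \<beta> h (\<Phi> t) - p t \<bullet> (F t - \<Phi> t)\<bar> \<le> B * (2 * b)\<^sup>2 * s\<^sup>2" by (simp add: power_mult_distrib mult_ac)
      have "\<bar>p t \<bullet> \<Omega> t\<bar> \<le> b * b"
        using bnd[OF t] b0 by (intro order.trans[OF Cauchy_Schwarz_ineq2] mult_mono) auto
      then have 2: "\<bar>s\<^sup>2 * (p t \<bullet> \<Omega> t)\<bar> \<le> b * b * s\<^sup>2" by (rule sq)
      have "r t = (Xi \<beta> h (F t) - Xi \<beta> h (\<Phi> t) - p t \<bullet> (F t - \<Phi> t)) + s\<^sup>2 * (p t \<bullet> \<Omega> t)"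
        unfolding Fd by (simp add: r_def inner_add_right)
      then show ?thesis using 1 2 unfolding C1_def distrib_right by linarith
    qed
    have r_deriv: "(r has_vector_derivative r' t) (at t within {0..T})" if t: "t \<in> {0..T}" for t
    proof -
      have sT: "{0..T} \<subseteq> {0..M}" using T by auto
      have d1: "((\<lambda>t. Xi \<beta> h (F t)) has_vector_derivative F.p t \<bullet> f t) (at t within {0..T})"
        by (rule has_vector_derivative_within_subset[OF F.Xi_deriv[OF sub[OF t]] sT])
      have d2: "((\<lambda>t. Xi \<beta> h (\<Phi> t)) has_vector_derivative p t \<bullet> \<phi> t) (at t within {0..T})"
        by (rule has_vector_derivative_within_subset[OF Xi_deriv[OF sub[OF t]] sT])
      have d3: "(p has_vector_derivative S t) (at t within {0..T})"
        by (rule has_vector_derivative_within_subset[OF p_deriv[OF sub[OF t]] sT])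
      have d4: "(\<Psi> has_vector_derivative \<psi> t) (at t within {0..T})"
        unfolding \<Psi>_def by (rule integral_has_vector_derivative[OF c(1) t])
      have d5: "((\<lambda>t. s * (p t \<bullet> \<Psi> t)) has_vector_derivative s * (S t \<bullet> \<Psi> t + p t \<bullet> \<psi> t)) (at t within {0..T})"
        using bounded_linear.has_vector_derivative[OF bounded_linear_mult_right[of s] bounded_bilinear.has_vector_derivative[OF bounded_bilinear_inner d3 d4]]
        by (simp add: add.commute)
      show ?thesis unfolding r_def r'_def by (intro has_vector_derivative_diff d1 d2 d5)
    qed
    have cr': "continuous_on {0..T} r'" unfolding r'_def by (intro continuous_intros cF c c2)
    obtain u where u: "u \<in> {0..T}" "integral {0..T} (\<lambda>t. x t * r' t) = x T * r T - x 0 * r 0 - (x T - x 0) * r u"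
      using mono_integral_derivative[OF mx T0 r_deriv cr'] by metis
    have r0: "r 0 = 0" using Ft[of 0] T0 by (simp add: r_def \<Psi>_def \<Omega>_def)
    have x0: "0 \<le> x 0" "x 0 \<le> 1" using x_range[of 0] M_pos by auto
    have "- ((1 - x 0) * r u) \<le> C1 * s\<^sup>2"
    proof -
      have "\<bar>(1 - x 0) * r u\<bar> \<le> 1 * (C1 * s\<^sup>2)"
        unfolding abs_mult using x0 r_bound[OF u(1)] by (intro mult_mono) auto
      then show ?thesis by linarith
    qed
    then have part1: "integral {0..T} (\<lambda>t. x t * r' t) - r T \<le> C1 * s\<^sup>2"
      unfolding u(2) r0 x_T by simp
    have ii: "(\<lambda>t. x t * (F.p t \<bullet> f t)) integrable_on {0..T}" "(\<lambda>t. x t * (p t \<bullet> \<phi> t)) integrable_on {0..T}"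
      "(\<lambda>t. x t * (S t \<bullet> \<Psi> t + p t \<bullet> \<psi> t)) integrable_on {0..T}"
      by (intro mono_mult_integrable mx continuous_intros cF c c2)+
    have xr': "integral {0..T} (\<lambda>t. x t * r' t) = integral {0..T} (\<lambda>t. x t * (F.p t \<bullet> f t)) - integral {0..T} (\<lambda>t. x t * (p t \<bullet> \<phi> t))
       - s * integral {0..T} (\<lambda>t. x t * (S t \<bullet> \<Psi> t + p t \<bullet> \<psi> t))"
    proof -
      have "integral {0..T} (\<lambda>t. x t * r' t) = integral {0..T} (\<lambda>t. x t * (F.p t \<bullet> f t) - x t * (p t \<bullet> \<phi> t) - s *\<^sub>R (x t * (S t \<bullet> \<Psi> t + p t \<bullet> \<psi> t)))"
        by (rule integral_cong) (simp add: r'_def algebra_simps)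
      also have "\<dots> = integral {0..T} (\<lambda>t. x t * (F.p t \<bullet> f t)) - integral {0..T} (\<lambda>t. x t * (p t \<bullet> \<phi> t))
         - s *\<^sub>R integral {0..T} (\<lambda>t. x t * (S t \<bullet> \<Psi> t + p t \<bullet> \<psi> t))"
        by (subst integral_diff[OF integrable_diff[OF ii(1,2)] integrable_cmul[OF ii(3)]])
           (simp add: integral_diff[OF ii(1,2)])
      finally show ?thesis by simp
    qed

    have part2: "ln (det (Q - F T)) - ln (det (Q - \<Phi> T)) \<le> - s * (X T \<bullet> \<Psi> T) + b * b * s\<^sup>2"
    proof -
      have TT: "T \<in> {0..T}" using T0 by simp
      have "ln (det (Q - F T)) \<le> ln (det (Q - \<Phi> T)) + X T \<bullet> ((Q - F T) - (Q - \<Phi> T))"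
        unfolding X_def hat_T
        using pd_psd[OF F.c(2)] pd_det[OF F.c(2,1)] hat_psd[OF TT] pd_det[OF pd_hat[OF TT] truncated_path.c(1)[OF truncated_path_axioms]] F.c(1)
        by (intro ln_det_concave) (auto simp: hat_T)
      also have "(Q - F T) - (Q - \<Phi> T) = - (s *\<^sub>R \<Psi> T + s\<^sup>2 *\<^sub>R \<Omega> T)" using Ft[OF TT] by simp
      finally have "ln (det (Q - F T)) - ln (det (Q - \<Phi> T)) \<le> - s * (X T \<bullet> \<Psi> T) - s\<^sup>2 * (X T \<bullet> \<Omega> T)"
        by (simp add: inner_add_right inner_diff_right)
      moreover have "\<bar>X T \<bullet> \<Omega> T\<bar> \<le> b * b"
        using bnd[OF TT] b0 by (intro order.trans[OF Cauchy_Schwarz_ineq2] mult_mono) auto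
      then have "\<bar>s\<^sup>2 * (X T \<bullet> \<Omega> T)\<bar> \<le> b * b * s\<^sup>2" by (rule sq)
      ultimately show ?thesis by linarith
    qed

    have point: "F.X t \<bullet> f t - X t \<bullet> \<phi> t \<le> s * (X t \<bullet> \<psi> t - G t \<bullet> P t) + C3 * s\<^sup>2" if t: "t \<in> {0..T}" for t
    proof -
      define Y where "Y = F.X t"
      define \<Delta> where "\<Delta> = s *\<^sub>R P t + s\<^sup>2 *\<^sub>R R t"
      have n\<Delta>: "norm \<Delta> \<le> 2 * b * s" unfolding \<Delta>_def using comb bnd[OF t] by auto
      have nY: "norm Y \<le> b" unfolding Y_def by (rule XF[OF t])
      have nX: "norm (X t) \<le> b" "norm (\<phi> t) \<le> b" "norm (\<psi> t) \<le> b" "norm (\<omega> t) \<le> b" "norm (R t) \<le> b" using bnd[OF t] by auto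
      have YX: "Y - X t = - (X t ** \<Delta> ** Y)"
      proof -
        have "Y - X t = X t ** (hat t - F.hat t) ** Y"
          unfolding Y_def F.X_def X_def by (intro matrix_inv_diff hat_invertible F.hat_invertible t)
        also have "hat t - F.hat t = - \<Delta>" using hatF[OF t] by (simp add: \<Delta>_def)
        finally show ?thesis by (simp add: mm_simps)
      qed
      have YX2: "Y - X t = - (X t ** \<Delta> ** X t) + X t ** \<Delta> ** (X t ** \<Delta> ** Y)"
      proof -
        define U where "U = X t ** \<Delta> ** Y"
        have "Y = X t - U" using YX by (simp add: U_def algebra_simps)
        from arg_cong[OF this, of "\<lambda>Z. X t ** \<Delta> ** Z"]
        have U: "U = X t ** \<Delta> ** X t - X t ** \<Delta> ** U" by (simp add: U_def[symmetric] mm.diff_right)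
        have "Y - X t = - U" using YX by (simp add: U_def)
        also have "\<dots> = - (X t ** \<Delta> ** X t - X t ** \<Delta> ** U)" using U by (rule arg_cong)
        finally show ?thesis by (simp add: U_def)
      qed
      have n1: "norm (X t ** \<Delta> ** Y) \<le> b * (2 * b * s) * b"
        by (rule order.trans[OF norm_mm3_le]) (use n\<Delta> nY nX b0 s in \<open>intro mult_mono; auto\<close>)
      have n2: "norm (X t ** \<Delta> ** (X t ** \<Delta> ** Y)) \<le> b * (2 * b * s) * (b * (2 * b * s) * b)"
        by (rule order.trans[OF norm_mm3_le]) (use n\<Delta> n1 nX b0 s in \<open>intro mult_mono; auto\<close>)
      have n3: "norm (X t ** R t ** X t) \<le> b * b * b"
        by (rule order.trans[OF norm_mm3_le]) (use nX b0 s in \<open>intro mult_mono; auto\<close>)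
      have GP: "(X t ** P t ** X t) \<bullet> \<phi> t = G t \<bullet> P t"
      proof -
        have "(X t ** P t ** X t) \<bullet> \<phi> t = (X t ** P t) \<bullet> (\<phi> t ** X t)"
          by (subst inner_mult_right) (simp add: X_sym[OF t])
        also have "\<dots> = P t \<bullet> (X t ** \<phi> t ** X t)"
          by (subst inner_mult_left) (simp add: X_sym[OF t] matrix_mul_assoc)
        finally have "(X t ** P t ** X t) \<bullet> \<phi> t = P t \<bullet> (X t ** \<phi> t ** X t)" .
        then show ?thesis by (simp add: G_def inner_commute)
      qed
      have CS: "\<bar>A \<bullet> A'\<bar> \<le> d * b" if "norm A \<le> d" "norm A' \<le> b" for A A' :: "real^'m^'m" and d
        by (rule order.trans[OF Cauchy_Schwarz_ineq2 mult_mono]) (use that b0 order.trans[OF norm_ge_zero that(1)] in auto)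
      have e1: "\<bar>(X t ** \<Delta> ** (X t ** \<Delta> ** Y)) \<bullet> \<phi> t\<bar> \<le> b * (2 * b * s) * (b * (2 * b * s) * b) * b" by (rule CS[OF n2 nX(2)])
      have e2: "\<bar>(X t ** R t ** X t) \<bullet> \<phi> t\<bar> \<le> b * b * b * b" by (rule CS[OF n3 nX(2)])
      have e3: "\<bar>(X t ** \<Delta> ** Y) \<bullet> \<psi> t\<bar> \<le> b * (2 * b * s) * b * b" by (rule CS[OF n1 nX(3)])
      have e4: "\<bar>Y \<bullet> \<omega> t\<bar> \<le> b * b" by (rule CS[OF nY nX(4)])
      have "Y \<bullet> f t - X t \<bullet> \<phi> t = (Y - X t) \<bullet> \<phi> t + s * (X t \<bullet> \<psi> t) + s * ((Y - X t) \<bullet> \<psi> t) + s\<^sup>2 * (Y \<bullet> \<omega> t)"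
        by (simp add: fV[OF t] V_def inner_add_right inner_diff_left algebra_simps)
      also have "(Y - X t) \<bullet> \<phi> t = - s * (G t \<bullet> P t) - s\<^sup>2 * ((X t ** R t ** X t) \<bullet> \<phi> t) + (X t ** \<Delta> ** (X t ** \<Delta> ** Y)) \<bullet> \<phi> t"
      proof -
        have "X t ** \<Delta> ** X t = s *\<^sub>R (X t ** P t ** X t) + s\<^sup>2 *\<^sub>R (X t ** R t ** X t)"
          by (simp add: \<Delta>_def mm_simps)
        then show ?thesis unfolding YX2 by (simp add: inner_add_left inner_diff_left GP)
      qed
      also have "(Y - X t) \<bullet> \<psi> t = - ((X t ** \<Delta> ** Y) \<bullet> \<psi> t)" unfolding YX by simp
      finally have eq: "Y \<bullet> f t - X t \<bullet> \<phi> t = s * (X t \<bullet> \<psi> t - G t \<bullet> P t)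
        + (- s\<^sup>2 * ((X t ** R t ** X t) \<bullet> \<phi> t) + (X t ** \<Delta> ** (X t ** \<Delta> ** Y)) \<bullet> \<phi> t
         - s * ((X t ** \<Delta> ** Y) \<bullet> \<psi> t) + s\<^sup>2 * (Y \<bullet> \<omega> t))" by (simp add: algebra_simps)
      have f1: "- s\<^sup>2 * ((X t ** R t ** X t) \<bullet> \<phi> t) \<le> s\<^sup>2 * (b * b * b * b)"
        using mult_left_mono[OF e2 ss(2)] abs_ge_minus_self[of "s\<^sup>2 * ((X t ** R t ** X t) \<bullet> \<phi> t)"] by (simp add: abs_mult)
      have f2: "(X t ** \<Delta> ** (X t ** \<Delta> ** Y)) \<bullet> \<phi> t \<le> s\<^sup>2 * (b * (2 * b) * b * (2 * b) * b * b)"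
        using e1 by (simp add: power2_eq_square mult_ac)
      have f3: "- s * ((X t ** \<Delta> ** Y) \<bullet> \<psi> t) \<le> s\<^sup>2 * (b * (2 * b) * b * b)"
      proof -
        have "- s * ((X t ** \<Delta> ** Y) \<bullet> \<psi> t) \<le> s * \<bar>(X t ** \<Delta> ** Y) \<bullet> \<psi> t\<bar>"
          using mult_left_mono[OF abs_ge_minus_self less_imp_le[OF s(1)], of "(X t ** \<Delta> ** Y) \<bullet> \<psi> t"] by simp
        also have "\<dots> \<le> s * (b * (2 * b * s) * b * b)" by (rule mult_left_mono[OF e3]) (use s in simp)
        finally show ?thesis by (simp add: power2_eq_square mult_ac)
      qed
      have f4: "s\<^sup>2 * (Y \<bullet> \<omega> t) \<le> s\<^sup>2 * (b * b)"
        using e4 ss(2) by (intro mult_left_mono) auto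
      have "C3 * s\<^sup>2 = s\<^sup>2 * (b * b * b * b) + s\<^sup>2 * (b * (2 * b) * b * (2 * b) * b * b) + s\<^sup>2 * (b * (2 * b) * b * b) + s\<^sup>2 * (b * b)"
        by (simp add: C3_def algebra_simps)
      then show ?thesis using f1 f2 f3 f4 eq unfolding Y_def by linarith
    qed
    have part3: "integral {0..T} (\<lambda>t. F.X t \<bullet> f t) - integral {0..T} (\<lambda>t. X t \<bullet> \<phi> t)
        \<le> s * integral {0..T} (\<lambda>t. X t \<bullet> \<psi> t - G t \<bullet> P t) + C3 * T * s\<^sup>2"
    proof -
      have j: "(\<lambda>t. F.X t \<bullet> f t) integrable_on {0..T}" "(\<lambda>t. X t \<bullet> \<phi> t) integrable_on {0..T}"
        "(\<lambda>t. X t \<bullet> \<psi> t - G t \<bullet> P t) integrable_on {0..T}"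
        by (intro integrable_continuous_real continuous_intros cF c c2 cont_G)+
      have const: "(\<lambda>t. C3 * s\<^sup>2) integrable_on {0..T}" by (rule integrable_continuous_real) (rule continuous_on_const)
      have "integral {0..T} (\<lambda>t. F.X t \<bullet> f t) - integral {0..T} (\<lambda>t. X t \<bullet> \<phi> t) = integral {0..T} (\<lambda>t. F.X t \<bullet> f t - X t \<bullet> \<phi> t)"
        by (rule integral_diff[OF j(1,2), symmetric])
      also have "\<dots> \<le> integral {0..T} (\<lambda>t. s *\<^sub>R (X t \<bullet> \<psi> t - G t \<bullet> P t) + C3 * s\<^sup>2)"
      proof (rule integral_le)
        show "(\<lambda>t. F.X t \<bullet> f t - X t \<bullet> \<phi> t) integrable_on {0..T}" by (rule integrable_diff[OF j(1,2)])
        show "(\<lambda>t. s *\<^sub>R (X t \<bullet> \<psi> t - G t \<bullet> P t) + C3 * s\<^sup>2) integrable_on {0..T}"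
          by (rule integrable_add[OF integrable_cmul[OF j(3)] const])
      qed (use point in simp)
      also have "\<dots> = s *\<^sub>R integral {0..T} (\<lambda>t. X t \<bullet> \<psi> t - G t \<bullet> P t) + integral {0..T} (\<lambda>t. C3 * s\<^sup>2)"
        by (subst integral_add[OF integrable_cmul[OF j(3)] const]) simp
      finally show ?thesis using T0 by (simp add: mult_ac)
    qed
    have "0 \<le> F.J - J" using JF by simp
    also have "F.J - J = (integral {0..T} (\<lambda>t. x t * r' t) - r T) + s * (integral {0..T} (\<lambda>t. x t * (S t \<bullet> \<Psi> t + p t \<bullet> \<psi> t)) - p T \<bullet> \<Psi> T)
       + (ln (det (Q - F T)) - ln (det (Q - \<Phi> T))) + (integral {0..T} (\<lambda>t. F.X t \<bullet> f t) - integral {0..T} (\<lambda>t. X t \<bullet> \<phi> t))"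
      unfolding xr' r_def F.J_def J_def by (simp add: algebra_simps)
    also have "\<dots> \<le> s * ((integral {0..T} (\<lambda>t. x t * (S t \<bullet> \<Psi> t + p t \<bullet> \<psi> t)) - p T \<bullet> \<Psi> T)
       - X T \<bullet> \<Psi> T + integral {0..T} (\<lambda>t. X t \<bullet> \<psi> t - G t \<bullet> P t)) + C * s\<^sup>2"
      using part1 part2 part3 unfolding C_def by (simp add: algebra_simps)
    also have "(integral {0..T} (\<lambda>t. x t * (S t \<bullet> \<Psi> t + p t \<bullet> \<psi> t)) - p T \<bullet> \<Psi> T)
       - X T \<bullet> \<Psi> T + integral {0..T} (\<lambda>t. X t \<bullet> \<psi> t - G t \<bullet> P t) = variation \<psi>"
      using variation_eq[OF \<psi>] unfolding \<Psi>_def P_def by simp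
    finally show "0 \<le> s * variation \<psi> + C * s\<^sup>2" .
  qed
qed

end

subsection \<open>Stationarity on the support\<close>

lemma has_vector_derivative_quotient:
  assumes "(f has_vector_derivative d) (at u within S)"
  shows "((\<lambda>v. (1 / (v - u)) *\<^sub>R (f v - f u)) \<longlongrightarrow> d) (at u within S)"
proof -
  have "((\<lambda>v. (1 / norm (v - u)) *\<^sub>R (f v - (f u + (v - u) *\<^sub>R d))) \<longlongrightarrow> 0) (at u within S)"
    using assms unfolding has_vector_derivative_def has_derivative_within by blast
  then have "((\<lambda>v. norm ((1 / norm (v - u)) *\<^sub>R (f v - (f u + (v - u) *\<^sub>R d)))) \<longlongrightarrow> 0) (at u within S)"
    by (rule tendsto_norm_zero)
  moreover have "\<forall>\<^sub>F v in at u within S. norm ((1 / norm (v - u)) *\<^sub>R (f v - (f u + (v - u) *\<^sub>R d))) = norm ((1 / (v - u)) *\<^sub>R (f v - f u) - d)"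
    unfolding eventually_at_filter
  proof (rule always_eventually, intro allI impI)
    fix v assume "v \<noteq> u"
    then have "(1 / (v - u)) *\<^sub>R (f v - f u) - d = (1 / (v - u)) *\<^sub>R (f v - (f u + (v - u) *\<^sub>R d))"
      by (simp add: scaleR_diff_right scaleR_add_right)
    then show "norm ((1 / norm (v - u)) *\<^sub>R (f v - (f u + (v - u) *\<^sub>R d))) = norm ((1 / (v - u)) *\<^sub>R (f v - f u) - d)" by simp
  qed
  ultimately have "((\<lambda>v. norm ((1 / (v - u)) *\<^sub>R (f v - f u) - d)) \<longlongrightarrow> 0) (at u within S)"
    by (rule Lim_transform_eventually)
  then show ?thesis by (simp only: tendsto_norm_zero_iff LIM_zero_iff)
qed

lemma pd_inner_ge_trace:
  assumes "pd c A" "B \<in> psd" shows "c * trace B \<le> A \<bullet> B"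
  using psd_inner_nonneg[OF assms(1)[unfolded pd_def] assms(2)] by (simp add: inner_diff_left inner_mat1)

lemma matrix_product_primitive:
  fixes f g f' g' :: "real \<Rightarrow> real^'n^'n"
  assumes f: "\<And>s t. a \<le> s \<Longrightarrow> s \<le> t \<Longrightarrow> t \<le> b \<Longrightarrow> f t - f s = integral {s..t} f'"
    and g: "\<And>s t. a \<le> s \<Longrightarrow> s \<le> t \<Longrightarrow> t \<le> b \<Longrightarrow> g t - g s = integral {s..t} g'"
    and int: "f' integrable_on {a..b}" "g' integrable_on {a..b}"
      "(\<lambda>s. f' s ** g s) integrable_on {a..b}" "(\<lambda>s. f s ** g' s) integrable_on {a..b}"
    and bound: "\<And>t. t \<in> {a..b} \<Longrightarrow> norm (f' t) \<le> B" "\<And>t. t \<in> {a..b} \<Longrightarrow> norm (g' t) \<le> B"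
    and st: "a \<le> s" "s \<le> t" "t \<le> b"
  shows "f t ** g t - f s ** g s = integral {s..t} (\<lambda>u. f' u ** g u + f u ** g' u)"
proof -
  have B0: "0 \<le> B" using order.trans[OF norm_ge_zero bound(1)[of s]] st by simp
  have i: "(\<lambda>u. f' u ** g u + f u ** g' u) integrable_on {a..b}" using int by (intro integrable_add)
  define E where "E t = f t ** g t - integral {a..t} (\<lambda>u. f' u ** g u + f u ** g' u)" for t
  have const: "E u = E a" if "u \<in> {a..b}" for u
  proof (rule quadratic_increments_constant[where f = E and a = a and b = b and C = "2 * (B * B)"])
    fix u v assume uv: "a \<le> u" "u \<le> v" "v \<le> b"
    have sub: "{u..v} \<subseteq> {a..b}" using uv by auto
    have j: "f' integrable_on {u..v}" "g' integrable_on {u..v}" "(\<lambda>s. f' s ** g s) integrable_on {u..v}" "(\<lambda>s. f s ** g' s) integrable_on {u..v}"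
      using int sub by (auto intro: integrable_subinterval_real)
    have j1: "(\<lambda>s. f' s ** g v) integrable_on {u..v}" "integral {u..v} (\<lambda>s. f' s ** g v) = integral {u..v} f' ** g v"
      using integrable_linear[OF j(1) mm.bounded_linear_left[of "g v"]] integral_linear[OF j(1) mm.bounded_linear_left[of "g v"]] by (simp_all add: o_def)
    have j2: "(\<lambda>s. f u ** g' s) integrable_on {u..v}" "integral {u..v} (\<lambda>s. f u ** g' s) = f u ** integral {u..v} g'"
      using integrable_linear[OF j(2) mm.bounded_linear_right[of "f u"]] integral_linear[OF j(2) mm.bounded_linear_right[of "f u"]] by (simp_all add: o_def)
    have d1: "(\<lambda>s. f' s ** (g v - g s)) integrable_on {u..v}" "(\<lambda>s. (f u - f s) ** g' s) integrable_on {u..v}"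
      using integrable_diff[OF j1(1) j(3)] integrable_diff[OF j2(1) j(4)] by (simp_all add: mm_simps)
    have "f v ** g v - f u ** g u = (f v - f u) ** g v + f u ** (g v - g u)" by (simp add: mm_simps)
    also have "\<dots> = integral {u..v} (\<lambda>s. f' s ** g v) + integral {u..v} (\<lambda>s. f u ** g' s)"
      unfolding f[OF uv] g[OF uv] j1(2) j2(2) ..
    finally have "E v - E u = (integral {u..v} (\<lambda>s. f' s ** g v) + integral {u..v} (\<lambda>s. f u ** g' s)) - integral {u..v} (\<lambda>s. f' s ** g s + f s ** g' s)"
      using integral_diff_interval(1)[OF i uv] by (simp add: E_def algebra_simps)
    also have "\<dots> = integral {u..v} (\<lambda>s. f' s ** (g v - g s)) + integral {u..v} (\<lambda>s. (f u - f s) ** g' s)"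
      using j1(1) j2(1) j(3,4) by (simp add: integral_add integral_diff mm.diff_left mm.diff_right)
    finally have eq: "E v - E u = integral {u..v} (\<lambda>s. f' s ** (g v - g s)) + integral {u..v} (\<lambda>s. (f u - f s) ** g' s)" .
    have ng: "norm (g v - g s) \<le> B * (v - u)" if "s \<in> {u..v}" for s
    proof -
      have "norm (g v - g s) \<le> B * (v - s)"
        using that uv bound(2) by (subst g) (auto intro!: integral_norm_le integrable_subinterval_real[OF int(2)])
      also have "\<dots> \<le> B * (v - u)" using that B0 by (intro mult_left_mono) auto
      finally show ?thesis .
    qed
    have nf: "norm (f u - f s) \<le> B * (v - u)" if "s \<in> {u..v}" for s
    proof -
      have "norm (f s - f u) \<le> B * (s - u)"
        using that uv bound(1) by (subst f) (auto intro!: integral_norm_le integrable_subinterval_real[OF int(1)])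
      also have "\<dots> \<le> B * (v - u)" using that B0 by (intro mult_left_mono) auto
      finally show ?thesis by (simp add: norm_minus_commute)
    qed
    have "norm (integral {u..v} (\<lambda>s. f' s ** (g v - g s))) \<le> (B * (B * (v - u))) * (v - u)"
      by (rule integral_norm_le[OF d1(1) _ uv(2)], rule order.trans[OF norm_matrix_mult_le], rule mult_mono)
         (use bound(1) ng sub B0 in auto)
    moreover have "norm (integral {u..v} (\<lambda>s. (f u - f s) ** g' s)) \<le> (B * (v - u) * B) * (v - u)"
      by (rule integral_norm_le[OF d1(2) _ uv(2)], rule order.trans[OF norm_matrix_mult_le], rule mult_mono)
         (use bound(2) nf sub B0 uv in auto)
    ultimately have "norm (E v - E u) \<le> (B * (B * (v - u))) * (v - u) + (B * (v - u) * B) * (v - u)"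
      unfolding eq by (intro order.trans[OF norm_triangle_ineq add_mono])
    then show "norm (E v - E u) \<le> 2 * (B * B) * (v - u)\<^sup>2" by (simp add: power2_eq_square mult_ac)
  qed (use that in auto)
  have "E t = E s" using const[of t] const[of s] st by simp
  then show ?thesis using integral_diff_interval(1)[OF i st] by (simp add: E_def algebra_simps)
qed

lemma integral_decaying_weight:
  fixes t \<nu> :: real
  assumes "0 \<le> t"
  shows "((\<lambda>s. 2 * \<nu> * max 0 (1 - \<nu> * s)) has_integral 1 - (max 0 (1 - \<nu> * t))\<^sup>2) {0..t}"
proof -
  have sq: "\<bar>(max 0 a)\<^sup>2 - (max 0 b)\<^sup>2 - 2 * max 0 b * (a - b)\<bar> \<le> (a - b)\<^sup>2" for a b :: real
  proof -
    consider "0 \<le> a" "0 \<le> b" | "a < 0" "0 \<le> b" | "0 \<le> a" "b < 0" | "a < 0" "b < 0" by linarith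
    then show ?thesis
    proof cases
      case 1
      have "a\<^sup>2 - b\<^sup>2 - 2 * b * (a - b) = (a - b)\<^sup>2" by (simp add: power2_eq_square algebra_simps)
      then show ?thesis using 1 by (simp add: max_def)
    next
      case 2
      have "0 \<le> a * a" "0 \<le> b * b" "a * b \<le> 0" using 2 by (auto simp: mult_nonpos_nonneg)
      then have "0 \<le> b * b - 2 * (a * b)" by linarith
      then have "\<bar>b * b - 2 * (a * b)\<bar> \<le> (a - b)\<^sup>2" using zero_le_square[of a] by (subst abs_of_nonneg) (auto simp: power2_eq_square algebra_simps)
      then show ?thesis using 2 by (simp add: max_def power2_eq_square algebra_simps)
    next
      case 3
      have "0 \<le> b * b" "a * b \<le> 0" using 3 by (auto simp: mult_nonneg_nonpos)
      then show ?thesis using 3 by (simp add: max_def power2_eq_square algebra_simps)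
    qed (simp add: max_def)
  qed
  have "((\<lambda>s. 2 * \<nu> * max 0 (1 - \<nu> * s)) has_integral (- (max 0 (1 - \<nu> * t))\<^sup>2) - (- (max 0 (1 - \<nu> * 0))\<^sup>2)) {0..t}"
  proof (rule fundamental_theorem_of_calculus[OF assms])
    fix u assume "u \<in> {0..t}"
    show "((\<lambda>s. - (max 0 (1 - \<nu> * s))\<^sup>2) has_vector_derivative 2 * \<nu> * max 0 (1 - \<nu> * u)) (at u within {0..t})"
    proof (rule has_vector_derivative_quadratic[where C = "\<nu>\<^sup>2"])
      fix v
      have "- (max 0 (1 - \<nu> * v))\<^sup>2 - - (max 0 (1 - \<nu> * u))\<^sup>2 - (v - u) *\<^sub>R (2 * \<nu> * max 0 (1 - \<nu> * u))
        = - ((max 0 (1 - \<nu> * v))\<^sup>2 - (max 0 (1 - \<nu> * u))\<^sup>2 - 2 * max 0 (1 - \<nu> * u) * ((1 - \<nu> * v) - (1 - \<nu> * u)))"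
        by (simp add: algebra_simps)
      moreover have "((1 - \<nu> * v) - (1 - \<nu> * u))\<^sup>2 = \<nu>\<^sup>2 * (v - u)\<^sup>2" by (simp add: power2_eq_square algebra_simps)
      ultimately show "norm (- (max 0 (1 - \<nu> * v))\<^sup>2 - - (max 0 (1 - \<nu> * u))\<^sup>2 - (v - u) *\<^sub>R (2 * \<nu> * max 0 (1 - \<nu> * u))) \<le> \<nu>\<^sup>2 * (v - u)\<^sup>2"
        using sq[of "1 - \<nu> * v" "1 - \<nu> * u"] by (simp only: real_norm_def abs_minus_cancel)
    qed
  qed
  then show ?thesis by simp
qed

context truncated_path
begin

lemma hat_sym: "t \<in> {0..T} \<Longrightarrow> transpose (hat t) = hat t" by (rule psd_sym[OF hat_psd])

lemma D_sym: assumes "t \<in> {0..T}" shows "transpose (D t) = D t"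
proof -
  have "K t \<in> psd" unfolding K_def
    using assms by (intro psd_integral integrable_subinterval_real[OF integrable_continuous_real[OF cont_G]] G_psd) auto
  then show ?thesis using p_sym[of t] assms T by (simp add: D_def transpose_diff psd_sym)
qed

lemma D_0: "D 0 = h \<otimes> h"
proof -
  have "xi1 \<beta> (\<Phi> 0) = 0"
  proof -
    have "xi1 \<beta> (\<Phi> 0) = (\<chi> i j. xi_fun 1 \<beta> i j (\<Phi> 0 $ i $ j))" using M_pos by (intro xi_entries) simp
    also have "\<dots> = 0" by (simp add: \<Phi>_0 vec_eq_iff xi_fun_def powser_zero) (simp add: diffs_def xi_coeff_def)
    finally show ?thesis .
  qed
  then show ?thesis by (simp add: D_def p_def K_def)
qed

definition Z :: "real \<Rightarrow> real^'m^'m" where "Z t = hat t ** D t ** hat t"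
definition W :: "real \<Rightarrow> real^'m^'m" where "W t = \<phi> t ** D t ** hat t + hat t ** D t ** \<phi> t"

lemma lip_Z: "lip_on {0..T} Z" "lip_on {0..T} W"
  unfolding Z_def W_def by (intro lip_intros lip_hat lip_D \<phi>_sub)+

lemma D_diff: 
  assumes "0 \<le> s" "s \<le> t" "t \<le> T" shows "D t - D s = integral {s..t} D'"
proof -
  have "(D' has_integral D t - D s) {s..t}"
  proof (rule fundamental_theorem_of_calculus[OF assms(2)])
    fix u assume "u \<in> {s..t}"
    then show "(D has_vector_derivative D' u) (at u within {s..t})"
      using assms by (intro has_vector_derivative_within_subset[OF D_deriv]) auto
  qed
  then show ?thesis by (simp add: integral_unique)
qed

lemma Z_diff:
  assumes st: "0 \<le> s" "s \<le> t" "t \<le> T"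
  shows "Z t - Z s = integral {s..t} (\<lambda>u. hat u ** S u ** hat u - \<phi> u - x u *\<^sub>R W u)"
proof -
  have mx: "mono_on {0..T} x" using T by (intro x_mono_on) auto
  have bx: "\<bar>x t\<bar> \<le> 1" if "t \<in> {0..T}" for t using x_range[of t] that T by auto
  have c: "continuous_on {0..T} hat" "continuous_on {0..T} D" "continuous_on {0..T} D'" "continuous_on {0..T} \<phi>"
    by (auto intro: lip_on_continuous lip_hat lip_D \<phi>_sub)
  note mc = bounded_bilinear.continuous_on[OF bounded_bilinear_matrix_mult]
  have xi: "(\<lambda>s. x s *\<^sub>R f s) integrable_on {0..T}" if "continuous_on {0..T} f" for f :: "real \<Rightarrow> real^'m^'m"
    by (rule mono_scaleR_integrable[OF mx that])
  have bd: "\<exists>B. 0 < B \<and> (\<forall>t\<in>{0..T}. norm (f t) \<le> B)" if "continuous_on {0..T} f" for f :: "real \<Rightarrow> real^'m^'m"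
    using continuous_on_Icc_bounded[OF that] by metis
  have minus: "(\<lambda>s. - x s *\<^sub>R f s) = (\<lambda>s. x s *\<^sub>R (- f s))" for f :: "real \<Rightarrow> real^'m^'m" by simp
  have hat': "hat t - hat s = integral {s..t} (\<lambda>u. - x u *\<^sub>R \<phi> u)" if "0 \<le> s" "s \<le> t" "t \<le> T" for s t
    using hat_diff[OF that] by (simp add: minus_diff_eq[symmetric, of "hat t"] del: minus_diff_eq)
  obtain b1 where b1: "0 < b1" "\<forall>t\<in>{0..T}. norm (\<phi> t) \<le> b1" using bd[OF c(4)] by blast
  obtain b2 where b2: "0 < b2" "\<forall>t\<in>{0..T}. norm (D' t) \<le> b2" using bd[OF c(3)] by blast
  define f1 where "f1 u = (- x u *\<^sub>R \<phi> u) ** D u + hat u ** D' u" for u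
  have n\<phi>: "norm (- x u *\<^sub>R \<phi> u) \<le> b1" if "u \<in> {0..T}" for u
    using mult_mono[OF bx[OF that], of "norm (\<phi> u)" b1] b1 that by simp
  have HD: "hat v ** D v - hat u ** D u = integral {u..v} f1" if "0 \<le> u" "u \<le> v" "v \<le> T" for u v
    unfolding f1_def
  proof (rule matrix_product_primitive[where a = 0 and b = T and B = "max b1 b2"])
    show "(\<lambda>u. - x u *\<^sub>R \<phi> u) integrable_on {0..T}" unfolding minus by (intro xi continuous_intros c)
    show "(\<lambda>s. (- x s *\<^sub>R \<phi> s) ** D s) integrable_on {0..T}"
      using xi[of "\<lambda>s. - (\<phi> s ** D s)"] by (simp add: mm_simps mc c continuous_on_minus)
    show "norm (- x t *\<^sub>R \<phi> t) \<le> max b1 b2" if "t \<in> {0..T}" for t using n\<phi>[OF that] by linarith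
    show "norm (D' t) \<le> max b1 b2" if "t \<in> {0..T}" for t using b2 that by (simp add: le_max_iff_disj)
  qed (use that hat' D_diff in \<open>auto intro!: integrable_continuous_real mc c\<close>)
  have f1: "f1 u = x u *\<^sub>R (- (\<phi> u ** D u)) + hat u ** D' u" for u by (simp add: f1_def mm_simps)
  have cHD': "continuous_on {0..T} (\<lambda>u. hat u ** D' u)" "continuous_on {0..T} (\<lambda>u. - (\<phi> u ** D u))"
    by (intro continuous_intros mc c)+
  obtain b3 where b3: "0 < b3" "\<forall>t\<in>{0..T}. norm (hat t ** D' t) \<le> b3" using bd[OF cHD'(1)] by blast
  obtain b4 where b4: "0 < b4" "\<forall>t\<in>{0..T}. norm (- (\<phi> t ** D t)) \<le> b4" using bd[OF cHD'(2)] by blast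
  have "Z t - Z s = integral {s..t} (\<lambda>u. f1 u ** hat u + (hat u ** D u) ** (- x u *\<^sub>R \<phi> u))"
    unfolding Z_def
  proof (rule matrix_product_primitive[where a = 0 and b = T and B = "b4 + b3 + b1"])
    show "f1 integrable_on {0..T}" unfolding f1
      by (intro integrable_add xi cHD' integrable_continuous_real)
    show "(\<lambda>u. - x u *\<^sub>R \<phi> u) integrable_on {0..T}" unfolding minus by (intro xi continuous_intros c)
    have "(\<lambda>u. x u *\<^sub>R (- (\<phi> u ** D u) ** hat u) + hat u ** D' u ** hat u) integrable_on {0..T}"
      by (intro integrable_add xi integrable_continuous_real mc c cHD')
    then show "(\<lambda>u. f1 u ** hat u) integrable_on {0..T}" unfolding f1 by (simp add: mm_simps)
    have "(\<lambda>u. x u *\<^sub>R (hat u ** D u ** (- \<phi> u))) integrable_on {0..T}"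
      by (intro xi mc c continuous_intros)
    then show "(\<lambda>u. (hat u ** D u) ** (- x u *\<^sub>R \<phi> u)) integrable_on {0..T}" by (simp add: mm_simps)
    show "norm (f1 u) \<le> b4 + b3 + b1" if u: "u \<in> {0..T}" for u
    proof -
      have "norm (f1 u) \<le> \<bar>x u\<bar> * norm (- (\<phi> u ** D u)) + norm (hat u ** D' u)"
        unfolding f1 by (rule order.trans[OF norm_triangle_ineq]) simp
      also have "\<dots> \<le> 1 * b4 + b3" using bx[OF u] b3 b4 u by (intro add_mono mult_mono) auto
      finally show ?thesis using b1(1) by simp
    qed
    show "norm (- x u *\<^sub>R \<phi> u) \<le> b4 + b3 + b1" if "u \<in> {0..T}" for u using n\<phi>[OF that] b3(1) b4(1) by linarith
  qed (use st hat' HD in auto)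
  also have "\<dots> = integral {s..t} (\<lambda>u. hat u ** S u ** hat u - \<phi> u - x u *\<^sub>R W u)"
  proof (rule integral_cong)
    fix u assume "u \<in> {s..t}"
    then have u: "u \<in> {0..T}" using st by auto
    have "hat u ** G u ** hat u = (hat u ** X u) ** \<phi> u ** (X u ** hat u)" by (simp add: G_def matrix_mul_assoc)
    also have "\<dots> = \<phi> u" using X_hat[OF u] by simp
    finally have "hat u ** D' u ** hat u = hat u ** S u ** hat u - \<phi> u" by (simp add: D'_def mm_simps)
    then show "f1 u ** hat u + (hat u ** D u) ** (- x u *\<^sub>R \<phi> u) = hat u ** S u ** hat u - \<phi> u - x u *\<^sub>R W u"
      unfolding f1 W_def by (simp add: mm_simps scaleR_add_right)
  qed
  finally show ?thesis .
qed

lemma D_Z_ge: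
  assumes t: "t \<in> {0..T}" shows "c\<^sup>2 * (norm (D t))\<^sup>2 \<le> D t \<bullet> Z t"
proof -
  have c0: "0 < c" by (rule truncated_path.c(1)[OF truncated_path_axioms])
  have 1: "D t ** hat t ** D t \<in> psd" using psd_congruence[OF hat_psd[OF t], of "D t"] D_sym[OF t] by simp
  have 2: "D t ** D t \<in> psd" using psd_congruence[OF psd_mat1, of "D t"] D_sym[OF t] by simp
  have "D t \<bullet> Z t = hat t \<bullet> (D t ** hat t ** D t)"
  proof -
    have "hat t \<bullet> (D t ** hat t ** D t) = (D t ** hat t) \<bullet> (hat t ** D t)"
      by (subst inner_commute, subst inner_mult_right) (simp add: D_sym[OF t])
    also have "\<dots> = D t \<bullet> (hat t ** D t ** hat t)" by (subst inner_mult_right) (simp add: hat_sym[OF t])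
    finally show ?thesis by (simp add: Z_def)
  qed
  also have "\<dots> \<ge> c * trace (D t ** hat t ** D t)" by (rule pd_inner_ge_trace[OF pd_hat[OF t] 1])
  also have "trace (D t ** hat t ** D t) = hat t \<bullet> (D t ** D t)"
  proof -
    have "trace (D t ** hat t ** D t) = trace (hat t ** (D t ** D t))"
      by (metis matrix_mul_assoc trace_mul_sym)
    then show ?thesis by (simp add: inner_eq_trace hat_sym[OF t])
  qed
  finally have 3: "c * (hat t \<bullet> (D t ** D t)) \<le> D t \<bullet> Z t" .
  have "trace (D t ** D t) = (norm (D t))\<^sup>2" by (simp add: power2_norm_eq_inner inner_eq_trace D_sym[OF t])
  then have "c * (c * (norm (D t))\<^sup>2) \<le> c * (hat t \<bullet> (D t ** D t))"
    using pd_inner_ge_trace[OF pd_hat[OF t] 2] c0 by (intro mult_left_mono) auto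
  then show ?thesis using 3 by (simp add: power2_eq_square mult.assoc)
qed

end

context minimizing_path
begin

lemma variation_split:
  assumes \<psi>: "lip_on {0..T} \<psi>" and cd: "0 \<le> c1" "c1 \<le> d1" "d1 \<le> T"
  defines "r \<equiv> \<lambda>t. D t \<bullet> integral {0..t} \<psi>"
  obtains t1 t2 t3 where "t1 \<in> {0..T}" "t2 \<in> {c1..d1}" "t3 \<in> {0..T}"
    "variation \<psi> = - (x c1 - x 0) * r t1 - (x d1 - x c1) * r t2 - (1 - x d1) * r t3"
proof -
  have c\<psi>: "continuous_on {0..T} \<psi>" by (rule lip_on_continuous[OF \<psi>])
  obtain B where B: "\<And>t. t \<in> {0..T} \<Longrightarrow> norm (\<psi> t) \<le> B" using continuous_on_Icc_bounded[OF c\<psi>] by metis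
  have c: "continuous_on {0..T} (\<lambda>t. integral {0..t} \<psi>)" "continuous_on {0..T} D" "continuous_on {0..T} D'"
    using lip_on_continuous[OF lip_on_integral(1)[OF integrable_continuous_real[OF c\<psi>] B]] lip_D by (auto intro: lip_on_continuous)
  define r' where "r' t = D' t \<bullet> integral {0..t} \<psi> + D t \<bullet> \<psi> t" for t
  have cr': "continuous_on {0..T} r'" unfolding r'_def by (intro continuous_intros c c\<psi>)
  have dr: "(r has_vector_derivative r' t) (at t within {0..T})" if t: "t \<in> {0..T}" for t
    using bounded_bilinear.has_vector_derivative[OF bounded_bilinear_inner D_deriv[OF t] integral_has_vector_derivative[OF c\<psi> t]]
    unfolding r_def r'_def by (simp add: add.commute)
  have mx: "mono_on {0..T} x" using T by (intro x_mono_on) auto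
  have piece: "\<exists>t\<in>{a..b}. integral {a..b} (\<lambda>t. x t * r' t) = x b * r b - x a * r a - (x b - x a) * r t"
    if ab: "0 \<le> a" "a \<le> b" "b \<le> T" for a b
  proof -
    have sub: "{a..b} \<subseteq> {0..T}" using ab by auto
    have "(r has_vector_derivative r' t) (at t within {a..b})" if "t \<in> {a..b}" for t
      using sub that by (intro has_vector_derivative_within_subset[OF dr]) auto
    from mono_integral_derivative[OF mono_on_subset[OF mx sub] ab(2) this continuous_on_subset[OF cr' sub]]
    show ?thesis by metis
  qed
  obtain t1 where t1: "t1 \<in> {0..c1}" "integral {0..c1} (\<lambda>t. x t * r' t) = x c1 * r c1 - x 0 * r 0 - (x c1 - x 0) * r t1"
    using piece[of 0 c1] cd by auto
  obtain t2 where t2: "t2 \<in> {c1..d1}" "integral {c1..d1} (\<lambda>t. x t * r' t) = x d1 * r d1 - x c1 * r c1 - (x d1 - x c1) * r t2"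
    using piece[of c1 d1] cd by auto
  obtain t3 where t3: "t3 \<in> {d1..T}" "integral {d1..T} (\<lambda>t. x t * r' t) = x T * r T - x d1 * r d1 - (x T - x d1) * r t3"
    using piece[of d1 T] cd by auto
  have i: "(\<lambda>t. x t * r' t) integrable_on {0..T}" by (rule mono_mult_integrable[OF mx cr'])
  have "integral {0..T} (\<lambda>t. x t * r' t) = integral {0..c1} (\<lambda>t. x t * r' t) + integral {c1..d1} (\<lambda>t. x t * r' t) + integral {d1..T} (\<lambda>t. x t * r' t)"
    using integral_diff_interval(1)[OF i, of c1 d1] integral_diff_interval(1)[OF i, of d1 T] cd by simp
  moreover have "variation \<psi> = integral {0..T} (\<lambda>t. x t * r' t) - r T"
    unfolding variation_def r'_def r_def ..
  moreover have "r 0 = 0" by (simp add: r_def)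
  ultimately have "variation \<psi> = - (x c1 - x 0) * r t1 - (x d1 - x c1) * r t2 - (1 - x d1) * r t3"
    unfolding t1(2) t2(2) t3(2) by (simp add: x_T algebra_simps)
  then show ?thesis using t1(1) t2(1) t3(1) cd by (intro that[of t1 t2 t3]) auto
qed

text \<open>With \<open>x\<close> in place of its Lipschitz approximation \<open>g\<close> and without the initial layer at time \<open>0\<close>,
  \<open>\<psi>\<close> is the derivative of \<open>Z\<close>. Up to second order, the terms with \<open>g\<close> are a congruence transform of
  \<open>\<phi>\<close>, so the perturbed path stays monotone even where \<open>\<phi>\<close> is singular.\<close>

lemma variation_test_direction:
  assumes g: "lip_on {0..T} g" and \<nu>: "0 < \<nu>"
  defines "\<psi> \<equiv> \<lambda>t. hat t ** S t ** hat t - \<phi> t - g t *\<^sub>R W t + (2 * \<nu> * max 0 (1 - \<nu> * t)) *\<^sub>R Z 0"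
  shows "lip_on {0..T} \<psi>" "0 \<le> variation \<psi>"
proof -
  show \<psi>: "lip_on {0..T} \<psi>"
    unfolding \<psi>_def by (intro lip_intros lip_hat \<phi>_sub lip_Z g lip_on_scaleR2 lip_on_max lip_on_id) auto
  define B where "B t = g t *\<^sub>R (hat t ** D t)" for t
  define \<omega> where "\<omega> t = 2 *\<^sub>R (B t ** \<phi> t ** transpose (B t))" for t
  have lB: "lip_on {0..T} B" unfolding B_def by (intro lip_intros g lip_hat lip_D)
  have \<omega>: "lip_on {0..T} \<omega>"
    unfolding \<omega>_def by (intro lip_intros lB lip_on_linear[OF bounded_linear_transpose lB] \<phi>_sub)
  show "0 \<le> variation \<psi>"
  proof (rule variation_nonneg[OF \<psi> \<omega>])
    fix s t :: real assume s: "0 < s" "s \<le> 1/2" and t: "t \<in> {0..T}"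
    have tM: "t \<in> {0..M}" using t T by auto
    have Bt: "transpose (B t) = g t *\<^sub>R (D t ** hat t)"
      by (simp add: B_def transpose_scaleR matrix_transpose_mul D_sym[OF t] hat_sym[OF t])
    define C where "C = mat 1 - (2 * s) *\<^sub>R B t"
    have "C ** \<phi> t ** transpose C = \<phi> t - (2 * s) *\<^sub>R (B t ** \<phi> t + \<phi> t ** transpose (B t)) + (4 * s\<^sup>2) *\<^sub>R (B t ** \<phi> t ** transpose (B t))"
      by (simp add: C_def transpose_diff transpose_scaleR mm_simps scaleR_add_right scaleR_diff_right power2_eq_square)
    moreover have "B t ** \<phi> t + \<phi> t ** transpose (B t) = g t *\<^sub>R W t"
      unfolding Bt by (simp add: B_def W_def mm_simps scaleR_add_right)
    ultimately have "\<phi> t + s *\<^sub>R \<psi> t + s\<^sup>2 *\<^sub>R \<omega> t = (1/2 - s) *\<^sub>R \<phi> t + (1/2) *\<^sub>R (C ** \<phi> t ** transpose C)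
       + s *\<^sub>R (hat t ** S t ** hat t) + (s * (2 * \<nu> * max 0 (1 - \<nu> * t))) *\<^sub>R Z 0"
    proof -
      have "F + s *\<^sub>R (H - F - A + m *\<^sub>R E) + s\<^sup>2 *\<^sub>R (2 *\<^sub>R A') = (1/2 - s) *\<^sub>R F
        + (1/2) *\<^sub>R (F - (2 * s) *\<^sub>R A + (4 * s\<^sup>2) *\<^sub>R A') + s *\<^sub>R H + (s * m) *\<^sub>R E"
        for F H A A' E :: "real^'m^'m" and m
        by (simp add: vec_eq_iff field_simps)
      then show ?thesis unfolding \<psi>_def \<omega>_def \<open>C ** \<phi> t ** transpose C = _\<close> \<open>B t ** \<phi> t + \<phi> t ** transpose (B t) = _\<close> .
    qed
    moreover have "C ** \<phi> t ** transpose C \<in> psd" by (rule psd_congruence[OF psd_\<phi>[OF tM]])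
    moreover have "hat t ** S t ** hat t \<in> psd"
      using psd_congruence[OF S_psd[OF tM], of "hat t"] hat_sym[OF t] by simp
    moreover have "Z 0 \<in> psd"
      using psd_congruence[OF psd_outer[of h], of "hat 0"] hat_sym[of 0] T_pos by (simp add: Z_def D_0)
    ultimately show "\<phi> t + s *\<^sub>R \<psi> t + s\<^sup>2 *\<^sub>R \<omega> t \<in> psd"
      using s \<nu> psd_\<phi>[OF tM] by (auto intro!: psd_add psd_scaleR)
  qed
qed

lemma stationarity:
  assumes ab: "0 \<le> a" "a < b" "b < M" and supp: "{a<..<b} \<subseteq> measure_support (order_measure M x)"
    and u: "u \<in> {a<..<b}"
  shows "D u = 0"
proof (rule ccontr)
  assume nz: "D u \<noteq> 0"
  have c0: "0 < c" by (rule truncated_path.c(1)[OF truncated_path_axioms])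
  have inT: "t \<in> {0..T}" if "t \<in> {a<..<b}" for t using supp measure_support_subset that by blast
  have strict: "x s < x t" if "s \<in> {a<..<b}" "t \<in> {a<..<b}" "s < t" for s t
  proof -
    have "(s + t) / 2 \<in> measure_support (order_measure M x)" using supp that by auto
    then have "order_ext M x s < order_ext M x t"
      using measure_support_order[OF x less_imp_le[OF M_pos]] that(3) by auto
    then show ?thesis using that ab by (auto simp: order_ext_def)
  qed
  define q where "q t = D t \<bullet> Z t" for t
  have q_nonneg: "0 \<le> q t" if "t \<in> {0..T}" for t
    unfolding q_def using D_Z_ge[OF that] order.trans[OF _ D_Z_ge[OF that]] by auto
  have cq: "continuous_on {0..T} q"
    unfolding q_def by (intro lip_on_continuous lip_intros lip_D lip_Z)
  have qu: "0 < q u"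
  proof -
    have "0 < c\<^sup>2 * (norm (D u))\<^sup>2" using nz c0 by simp
    then show ?thesis using D_Z_ge[OF inT[OF u]] unfolding q_def by linarith
  qed
  obtain \<delta> where \<delta>: "0 < \<delta>" "\<And>t. t \<in> {0..T} \<Longrightarrow> \<bar>t - u\<bar> < \<delta> \<Longrightarrow> \<bar>q t - q u\<bar> < q u / 2"
    using cq[unfolded continuous_on_iff, rule_format, OF inT[OF u], of "q u / 2"] qu by (auto simp: dist_real_def)
  define \<epsilon> where "\<epsilon> = min (\<delta> / 2) (min ((u - a) / 2) ((b - u) / 2))"
  define c1 where "c1 = u - \<epsilon>"
  define d1 where "d1 = u + \<epsilon>"
  have \<epsilon>: "0 < \<epsilon>" using \<delta>(1) u by (auto simp: \<epsilon>_def)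
  have in1: "c1 \<in> {a<..<b}" "d1 \<in> {a<..<b}" "c1 < d1" "0 < c1"
    using u ab \<delta>(1) by (auto simp: c1_def d1_def \<epsilon>_def min_def field_simps split: if_splits)
  have qcd: "q u / 2 \<le> q t" if "t \<in> {c1..d1}" for t
  proof -
    have "t \<in> {0..T}" using that inT[OF in1(1)] inT[OF in1(2)] by auto
    moreover have "\<bar>t - u\<bar> < \<delta>" using that \<delta>(1) \<epsilon> by (auto simp: c1_def d1_def \<epsilon>_def abs_less_iff)
    ultimately show ?thesis using \<delta>(2)[of t] by linarith
  qed
  define \<mu> where "\<mu> = x d1 - x c1"
  have \<mu>: "0 < \<mu>" using strict[OF in1(1,2,3)] by (simp add: \<mu>_def)
  define k where "k = min (q u / 4) (\<mu> * q u / 16)"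
  have k: "0 < k" "k \<le> q u / 4" "k \<le> \<mu> * q u / 16" using qu \<mu> by (auto simp: k_def)
  have cD: "continuous_on {0..T} (\<lambda>t. D t \<bullet> Z 0)" "continuous_on {0..T} D" "continuous_on {0..T} W"
    by (intro lip_on_continuous lip_intros lip_D lip_Z)+
  have z0: "0 \<in> {0..T}" using T_pos by simp
  obtain \<rho>1 where \<rho>1: "0 < \<rho>1" "\<And>t. t \<in> {0..T} \<Longrightarrow> \<bar>t\<bar> < \<rho>1 \<Longrightarrow> \<bar>q t - q 0\<bar> < k / 4"
    using cq[unfolded continuous_on_iff, rule_format, OF z0, of "k / 4"] k by (auto simp: dist_real_def)
  obtain \<rho>2 where \<rho>2: "0 < \<rho>2" "\<And>t. t \<in> {0..T} \<Longrightarrow> \<bar>t\<bar> < \<rho>2 \<Longrightarrow> \<bar>D t \<bullet> Z 0 - D 0 \<bullet> Z 0\<bar> < k / 4"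
    using cD(1)[unfolded continuous_on_iff, rule_format, OF z0, of "k / 4"] k by (auto simp: dist_real_def)
  define \<rho> where "\<rho> = min c1 (min \<rho>1 \<rho>2)"
  have \<rho>: "0 < \<rho>" "\<rho> \<le> c1" "\<rho> \<le> \<rho>1" "\<rho> \<le> \<rho>2" using \<rho>1(1) \<rho>2(1) in1 by (auto simp: \<rho>_def)
  define \<nu> where "\<nu> = 1 / \<rho>"
  have \<nu>: "0 < \<nu>" using \<rho> by (simp add: \<nu>_def)
  define w where "w t = (max 0 (1 - \<nu> * t))\<^sup>2" for t
  have w0: "w t = 0" if "\<rho> \<le> t" for t
  proof -
    have "1 \<le> \<nu> * t" using that \<rho>(1) by (simp add: \<nu>_def field_simps)
    then show ?thesis by (simp add: w_def max_def)
  qed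
  have w1: "0 \<le> w t" "w t \<le> 1" if "0 \<le> t" for t
    using that \<nu> by (auto simp: w_def intro!: power_le_one)
  have layer: "- k / 2 \<le> q t - w t * (D t \<bullet> Z 0)" if t: "t \<in> {0..T}" for t
  proof (cases "\<rho> \<le> t")
    case True then show ?thesis using w0 q_nonneg[OF t] k by simp
  next
    case False
    have "\<bar>q t - q 0\<bar> < k / 4" using \<rho>1(2)[OF t] False \<rho> t by auto
    then have 1: "q 0 - k / 4 < q t" unfolding abs_less_iff by linarith
    have "\<bar>D t \<bullet> Z 0 - q 0\<bar> < k / 4" using \<rho>2(2)[OF t] False \<rho> t by (auto simp: q_def)
    then have 2: "D t \<bullet> Z 0 < q 0 + k / 4" unfolding abs_less_iff by linarith
    have w: "0 \<le> w t" "w t \<le> 1" using w1 t by auto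
    have "w t * (D t \<bullet> Z 0) \<le> w t * (q 0 + k / 4)" using 2 w by (intro mult_left_mono) auto
    also have "\<dots> \<le> 1 * (q 0 + k / 4)" using w q_nonneg[OF z0] k by (intro mult_right_mono) auto
    finally have "w t * (D t \<bullet> Z 0) \<le> q 0 + k / 4" by simp
    then show ?thesis using 1 by (simp add: field_simps)
  qed
  obtain BD where BD: "0 < BD" "\<And>t. t \<in> {0..T} \<Longrightarrow> norm (D t) \<le> BD" using continuous_on_Icc_bounded[OF cD(2)] by metis
  obtain BW where BW: "0 < BW" "\<And>t. t \<in> {0..T} \<Longrightarrow> norm (W t) \<le> BW" using continuous_on_Icc_bounded[OF cD(3)] by metis
  define e where "e = k / (2 * BD * BW)"
  have e: "0 < e" using k BD BW by (simp add: e_def)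
  have mM: "mono_on {0..M} x" by (intro x_mono_on) auto
  obtain g where g: "lip_on {0..T} g" "\<And>t. t \<in> {0..T} \<Longrightarrow> x t \<le> g t" "\<And>t. t \<in> {0..T} \<Longrightarrow> g t \<le> 1"
    "integral {0..T} g \<le> integral {0..T} x + e"
    using mono_lipschitz_approximation[OF mM _ T_pos T(2) e] x_range by (metis atLeastAtMost_iff)
  define \<psi> where "\<psi> t = hat t ** S t ** hat t - \<phi> t - g t *\<^sub>R W t + (2 * \<nu> * max 0 (1 - \<nu> * t)) *\<^sub>R Z 0" for t
  have \<psi>: "lip_on {0..T} \<psi>" "0 \<le> variation \<psi>"
    using variation_test_direction[OF g(1) \<nu>] unfolding \<psi>_def by auto
  define r where "r t = D t \<bullet> integral {0..t} \<psi>" for t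
  have r: "\<bar>r t - (q t - w t * (D t \<bullet> Z 0))\<bar> \<le> k / 2" if t: "t \<in> {0..T}" for t
  proof -
    have sub: "{0..t} \<subseteq> {0..T}" using t by auto
    have mx: "mono_on {0..t} x" using t T by (intro x_mono_on) auto
    have c: "continuous_on {0..t} W" "continuous_on {0..t} g" "continuous_on {0..t} (\<lambda>u. hat u ** S u ** hat u - \<phi> u)"
      using sub by (auto intro!: lip_on_continuous lip_on_subset[OF _ sub] lip_intros lip_Z g lip_hat \<phi>_sub)
    have i1: "(\<lambda>u. hat u ** S u ** hat u - \<phi> u - x u *\<^sub>R W u) integrable_on {0..t}"
      by (intro integrable_diff integrable_continuous_real[OF c(3)] mono_scaleR_integrable[OF mx c(1)])
    have i2: "(\<lambda>u. (g u - x u) *\<^sub>R W u) integrable_on {0..t}"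
      unfolding scaleR_diff_left
      by (intro integrable_diff integrable_continuous_real mono_scaleR_integrable[OF mx c(1)] continuous_intros c)
    have i3: "((\<lambda>u. (2 * \<nu> * max 0 (1 - \<nu> * u)) *\<^sub>R Z 0) has_integral (1 - w t) *\<^sub>R Z 0) {0..t}"
      unfolding w_def using integral_decaying_weight t by (intro has_integral_scaleR_left) auto
    have "integral {0..t} \<psi> = integral {0..t} (\<lambda>u. (hat u ** S u ** hat u - \<phi> u - x u *\<^sub>R W u) - (g u - x u) *\<^sub>R W u + (2 * \<nu> * max 0 (1 - \<nu> * u)) *\<^sub>R Z 0)"
      by (rule integral_cong) (simp add: \<psi>_def algebra_simps)
    also have "\<dots> = integral {0..t} (\<lambda>u. hat u ** S u ** hat u - \<phi> u - x u *\<^sub>R W u) - integral {0..t} (\<lambda>u. (g u - x u) *\<^sub>R W u) + (1 - w t) *\<^sub>R Z 0"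
      by (rule integral_unique) (intro has_integral_add has_integral_diff integrable_integral i1 i2 i3)
    also have "integral {0..t} (\<lambda>u. hat u ** S u ** hat u - \<phi> u - x u *\<^sub>R W u) = Z t - Z 0"
      using Z_diff[of 0 t] t by simp
    finally have \<Psi>: "integral {0..t} \<psi> = Z t - w t *\<^sub>R Z 0 - integral {0..t} (\<lambda>u. (g u - x u) *\<^sub>R W u)"
      by (simp add: scaleR_diff_left)
    have gi: "g integrable_on {0..T}" "x integrable_on {0..T}"
      using integrable_continuous_real[OF lip_on_continuous[OF g(1)]] mono_integrable[OF x_mono_on[of 0 T]] T by auto
    have gxi: "(\<lambda>u. (g u - x u) * BW) integrable_on {0..T}"
      using integrable_on_mult_left[OF integrable_diff[OF gi], of BW] by simp
    have gx0: "0 \<le> (g u - x u) * BW" if "u \<in> {0..T}" for u using g(2)[OF that] BW(1) by simp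
    have "norm (integral {0..t} (\<lambda>u. (g u - x u) *\<^sub>R W u)) \<le> integral {0..t} (\<lambda>u. (g u - x u) * BW)"
    proof (rule integral_norm_bound_integral[OF i2])
      show "(\<lambda>u. (g u - x u) * BW) integrable_on {0..t}" using gxi sub by (rule integrable_subinterval_real)
      fix u assume "u \<in> {0..t}"
      then have u: "u \<in> {0..T}" using sub by auto
      show "norm ((g u - x u) *\<^sub>R W u) \<le> (g u - x u) * BW" using g(2)[OF u] BW(2)[OF u] by (simp add: mult_left_mono)
    qed
    also have "\<dots> \<le> integral {0..T} (\<lambda>u. (g u - x u) * BW)"
      using gxi gx0 sub by (intro integral_subset_le integrable_subinterval_real[OF gxi]) auto
    also have "\<dots> = (integral {0..T} g - integral {0..T} x) * BW" using gi by (simp add: integral_diff)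
    also have "\<dots> \<le> e * BW" using g(4) BW(1) by (intro mult_right_mono) auto
    finally have err: "norm (integral {0..t} (\<lambda>u. (g u - x u) *\<^sub>R W u)) \<le> e * BW" .
    have "r t - (q t - w t * (D t \<bullet> Z 0)) = - (D t \<bullet> integral {0..t} (\<lambda>u. (g u - x u) *\<^sub>R W u))"
      unfolding r_def \<Psi> q_def by (simp add: inner_diff_right)
    also have "\<bar>\<dots>\<bar> \<le> BD * (e * BW)"
      using order.trans[OF Cauchy_Schwarz_ineq2 mult_mono[OF BD(2)[OF t] err]] BD(1) by simp
    also have "\<dots> = k / 2" using BD(1) BW(1) by (simp add: e_def field_simps)
    finally show ?thesis .
  qed
  have r_low: "- k \<le> r t" if "t \<in> {0..T}" for t using r[OF that] layer[OF that] by linarith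
  have r_high: "q u / 4 \<le> r t" if t: "t \<in> {c1..d1}" for t
  proof -
    have tT: "t \<in> {0..T}" using t inT[OF in1(1)] inT[OF in1(2)] by auto
    have "w t = 0" using w0[of t] \<rho> t by auto
    then have "q t - k / 2 \<le> r t" using r[OF tT] unfolding abs_le_iff by simp
    then show ?thesis using qcd[OF t] k by linarith
  qed
  have c1d1: "0 \<le> c1" "c1 \<le> d1" "d1 \<le> T" using in1 inT[OF in1(2)] by auto
  obtain t1 t2 t3 where ts: "t1 \<in> {0..T}" "t2 \<in> {c1..d1}" "t3 \<in> {0..T}"
    "variation \<psi> = - (x c1 - x 0) * r t1 - (x d1 - x c1) * r t2 - (1 - x d1) * r t3"
    using variation_split[OF \<psi>(1) c1d1] unfolding r_def by metis
  have xs: "0 \<le> x c1 - x 0" "x c1 - x 0 \<le> 1" "0 \<le> 1 - x d1" "1 - x d1 \<le> 1"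
    using x_mono[of 0 c1] x_range[of 0] x_range[of c1] x_range[of d1] c1d1 T M_pos by auto
  have "- (x c1 - x 0) * r t1 \<le> k"
    using mult_left_mono[OF r_low[OF ts(1)] xs(1)] mult_right_mono[OF xs(2), of k] k(1) by (simp add: algebra_simps)
  moreover have "- (1 - x d1) * r t3 \<le> k"
    using mult_left_mono[OF r_low[OF ts(3)] xs(3)] mult_right_mono[OF xs(4), of k] k(1) by (simp add: algebra_simps)
  moreover have "\<mu> * (q u / 4) \<le> (x d1 - x c1) * r t2"
    using mult_left_mono[OF r_high[OF ts(2)] less_imp_le[OF \<mu>]] by (simp add: \<mu>_def)
  ultimately have "variation \<psi> \<le> k + k - \<mu> * (q u / 4)" unfolding ts(4) by linarith
  also have "\<dots> < 0" using k \<mu> qu mult_pos_pos[OF \<mu> qu] by simp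
  finally show False using \<psi>(2) by simp
qed

end

subsection \<open>The formula for the order parameter\<close>

lemma hadamard_inner: "(A \<odot> B) \<bullet> C = (A \<odot> C) \<bullet> B"
  by (simp add: hadamard_def inner_matrix mult_ac)

lemma hadamard_diff: "(A - B) \<odot> C = A \<odot> C - B \<odot> C"
  by (simp add: hadamard_def vec_eq_iff left_diff_distrib)

lemma bounded_bilinear_hadamard: "bounded_bilinear ((\<odot>) :: real^'n^'n \<Rightarrow> _)"
proof -
  have "bilinear ((\<odot>) :: real^'n^'n \<Rightarrow> _)"
    by (auto simp: bilinear_def hadamard_def vec_eq_iff algebra_simps intro!: linearI)
  then show ?thesis by (simp add: bilinear_conv_bounded_bilinear)
qed

lemma psd_trace_cube_pos:
  assumes Y: "Y \<in> psd" "Y \<noteq> 0" shows "0 < trace (Y ** Y ** Y)"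
proof -
  obtain P d where Pd: "orthogonal_matrix P" "\<And>i. 0 \<le> d $ i" "Y = P ** diag_matrix d ** transpose P"
    using psd_spectral[OF Y(1)] by blast
  have tr: "trace (Y ** Y ** Y) = (\<Sum>i\<in>UNIV. d $ i * d $ i * d $ i)"
    unfolding Pd(3) conj_diag_mult[OF Pd(1)] trace_conj_diag[OF Pd(1)] by simp
  have "\<exists>i. d $ i \<noteq> 0"
  proof (rule ccontr)
    assume "\<nexists>i. d $ i \<noteq> 0"
    then have "diag_matrix d = 0" by (simp add: diag_matrix_def vec_eq_iff)
    then show False using Y(2) Pd(3) by (simp add: mm.zero_left mm.zero_right)
  qed
  then obtain i where "d $ i \<noteq> 0" ..
  then have "0 < d $ i * d $ i * d $ i" using Pd(2)[of i] by simp
  also have "\<dots> \<le> (\<Sum>i\<in>UNIV. d $ i * d $ i * d $ i)"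
    by (rule member_le_sum[where f = "\<lambda>i. d $ i * d $ i * d $ i"]) (auto simp: Pd(2))
  finally show ?thesis using tr by simp
qed

context minimizing_path
begin

context
  fixes a b :: real
  assumes ab: "0 \<le> a" "a < b" "b < M" and supp: "{a<..<b} \<subseteq> measure_support (order_measure M x)"
begin

lemma support_in_T: "u \<in> {a<..<b} \<Longrightarrow> u \<in> {0..T}"
  using supp measure_support_subset by blast

lemma S_eq_G:
  assumes u: "u \<in> {a<..<b}" shows "S u = G u"
proof -
  have "(D has_vector_derivative D' u) (at u within {a<..<b})"
    by (rule has_vector_derivative_within_subset[OF D_deriv[OF support_in_T[OF u]]]) (use support_in_T in blast)
  then have 1: "(D has_vector_derivative D' u) (at u)" using u by (simp add: at_within_open[OF u])
  have "((\<lambda>_. 0) has_vector_derivative 0) (at u)" by (rule has_vector_derivative_const)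
  then have "(D has_vector_derivative 0) (at u)"
    by (rule has_vector_derivative_transform_within_open[OF _ open_greaterThanLessThan u])
       (use stationarity[OF ab supp] in auto)
  from vector_derivative_unique_at[OF 1 this] show ?thesis by (simp add: D'_def)
qed

lemma trace_\<phi>:
  assumes u: "u \<in> {a<..<b}" shows "trace (\<phi> u) = 1"
proof -
  have sub: "{a<..<b} \<subseteq> {0..M}" using ab by auto
  have "(\<Phi> has_vector_derivative \<phi> u) (at u within {a<..<b})"
    by (rule has_vector_derivative_within_subset[OF deriv sub]) (use u sub in auto)
  from bounded_linear.has_vector_derivative[OF bounded_linear_trace this]
  have 1: "((\<lambda>t. trace (\<Phi> t)) has_vector_derivative trace (\<phi> u)) (at u)" using u by (simp add: at_within_open[OF u])
  have "((\<lambda>t. t) has_vector_derivative 1) (at u)" by (rule has_vector_derivative_id)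
  then have "((\<lambda>t. trace (\<Phi> t)) has_vector_derivative 1) (at u)"
    by (rule has_vector_derivative_transform_within_open[OF _ open_greaterThanLessThan u])
       (use trace_support supp in auto)
  from vector_derivative_unique_at[OF 1 this] show ?thesis .
qed

text \<open>Since \<open>\<phi>\<close> is merely Lipschitz, \<open>S = X ** \<phi> ** X\<close> is not differentiated directly: in the
  antisymmetric difference of \<open>S v \<bullet> \<phi> u\<close> the increments of \<open>\<phi>\<close> cancel.\<close>

lemma third_order_identity:
  assumes u: "u \<in> {a<..<b}"
  shows "xi3 \<beta> (\<Phi> u) \<bullet> (\<phi> u \<circ>^ 3) = 2 * x u * ((X u ** \<phi> u ** X u ** \<phi> u ** X u) \<bullet> \<phi> u)"
proof -
  have uT: "u \<in> {0..T}" by (rule support_in_T[OF u])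
  have uM: "u \<in> {0..M}" using uT T by auto
  define d where "d = (u + b) / 2"
  define F where "F = at u within {u..d}"
  have ub: "u < b" using u by simp
  have ud: "u < d" "d < b" using ub by (auto simp: d_def)
  have nt: "F \<noteq> bot"
    unfolding F_def using ud by (simp add: at_within_Icc_at_right)
  have sub: "{u..d} \<subseteq> {0..T}" using support_in_T u ud by auto
  have subM: "{u..d} \<subseteq> {0..M}" using sub T by auto
  have c: "(\<phi> \<longlongrightarrow> \<phi> u) F" "(X \<longlongrightarrow> X u) F"
  proof -
    have "continuous_on {0..T} \<phi>" "continuous_on {0..T} X" by (auto intro: lip_on_continuous lip_X \<phi>_sub)
    then show "(\<phi> \<longlongrightarrow> \<phi> u) F" "(X \<longlongrightarrow> X u) F"
      unfolding F_def using uT by (auto simp: continuous_on_def intro!: tendsto_within_subset[OF _ sub])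
  qed
  define q where "q v = (1 / (v - u)) *\<^sub>R (X v - X u)" for v
  have q: "(q \<longlongrightarrow> x u *\<^sub>R G u) F"
  proof -
    have xG: "(\<lambda>s. x s *\<^sub>R G s) integrable_on {0..T}"
      using T by (intro mono_scaleR_integrable x_mono_on cont_G) auto
    have i: "(\<lambda>s. x s *\<^sub>R G s) integrable_on {u..T}" using uT by (intro integrable_subinterval_real[OF xG]) auto
    have uT': "u < T"
    proof -
      have "(u + b) / 2 \<in> {0..T}" by (rule support_in_T) (use u in auto)
      then show ?thesis using ub by simp
    qed
    have "continuous (at u within {u..T}) x"
      using x uM uT' T by (simp add: at_within_Icc_at_right order_fun_def)
    moreover have "continuous (at u within {u..T}) G"
      by (rule continuous_within_subset[OF continuous_on_eq_continuous_within[THEN iffD1, rule_format, OF cont_G uT]]) (use uT in auto)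
    ultimately have "continuous (at u within ({u..T} - {})) (\<lambda>s. x s *\<^sub>R G s)" by (simp add: continuous_intros)
    then have "((\<lambda>v. integral {u..v} (\<lambda>s. x s *\<^sub>R G s)) has_vector_derivative x u *\<^sub>R G u) (at u within ({u..T} - {}))"
      using uT by (intro integral_has_vector_derivative_continuous_at[OF i]) auto
    then have "((\<lambda>v. X u + integral {u..v} (\<lambda>s. x s *\<^sub>R G s)) has_vector_derivative x u *\<^sub>R G u) (at u within {u..T})"
      by (auto intro!: derivative_eq_intros)
    then have "(X has_vector_derivative x u *\<^sub>R G u) (at u within {u..T})"
    proof (rule has_vector_derivative_transform[rotated 2])
      fix v assume v: "v \<in> {u..T}"
      have "X v = X T - integral {v..T} (\<lambda>s. x s *\<^sub>R G s)" using v uT by (intro X_integral) auto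
      moreover have "X u = X T - integral {u..T} (\<lambda>s. x s *\<^sub>R G s)" by (rule X_integral[OF uT])
      moreover have "integral {u..v} (\<lambda>s. x s *\<^sub>R G s) = integral {u..T} (\<lambda>s. x s *\<^sub>R G s) - integral {v..T} (\<lambda>s. x s *\<^sub>R G s)"
        using integral_diff_interval(2)[OF xG, of u v] v uT by simp
      ultimately show "X v = X u + integral {u..v} (\<lambda>s. x s *\<^sub>R G s)" by simp
    qed (use uT in auto)
    then have "(X has_vector_derivative x u *\<^sub>R G u) F"
      unfolding F_def by (rule has_vector_derivative_within_subset) (use sub in auto)
    then show ?thesis unfolding q_def F_def by (rule has_vector_derivative_quotient)
  qed
  define r where "r v = (1 / (v - u)) *\<^sub>R (xi2 \<beta> (\<Phi> v) - xi2 \<beta> (\<Phi> u))" for v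
  have r: "(r \<longlongrightarrow> xi3 \<beta> (\<Phi> u) \<odot> \<phi> u) F"
  proof -
    have "((\<lambda>t. \<chi> i j. xi_fun 2 \<beta> i j (\<Phi> t $ i $ j)) has_vector_derivative xi3 \<beta> (\<Phi> u) \<odot> \<phi> u) (at u within {0..M})"
    proof (rule has_vector_derivative_matrixI)
      fix i j
      show "((\<lambda>t. (\<chi> i j. xi_fun 2 \<beta> i j (\<Phi> t $ i $ j)) $ i $ j) has_field_derivative (xi3 \<beta> (\<Phi> u) \<odot> \<phi> u) $ i $ j) (at u within {0..M})"
        using xi_fun_deriv[OF uM, of 2 i j] by (simp add: hadamard_def xi_entries[OF uM] numeral_3_eq_3 numeral_2_eq_2)
    qed
    then have "((\<lambda>t. xi2 \<beta> (\<Phi> t)) has_vector_derivative xi3 \<beta> (\<Phi> u) \<odot> \<phi> u) (at u within {0..M})"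
      by (rule has_vector_derivative_transform[OF uM, rotated]) (simp add: xi_entries)
    then have "((\<lambda>t. xi2 \<beta> (\<Phi> t)) has_vector_derivative xi3 \<beta> (\<Phi> u) \<odot> \<phi> u) F"
      unfolding F_def by (rule has_vector_derivative_within_subset[OF _ subM])
    then show ?thesis unfolding r_def F_def by (rule has_vector_derivative_quotient)
  qed
  have eq: "(r v \<odot> \<phi> v) \<bullet> \<phi> u = (q v ** \<phi> v ** X v + X u ** \<phi> v ** q v) \<bullet> \<phi> u" if v: "v \<in> {u..d}" for v
  proof -
    have vab: "v \<in> {a<..<b}" using v u ud by auto
    have "((xi2 \<beta> (\<Phi> v) - xi2 \<beta> (\<Phi> u)) \<odot> \<phi> v) \<bullet> \<phi> u = S v \<bullet> \<phi> u - S u \<bullet> \<phi> v"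
      by (simp add: hadamard_diff inner_diff_left S_def) (rule hadamard_inner)
    also have "\<dots> = (X v ** \<phi> v ** X v) \<bullet> \<phi> u - (X u ** \<phi> u ** X u) \<bullet> \<phi> v"
      by (simp add: S_eq_G[OF u] S_eq_G[OF vab] G_def)
    also have "(X u ** \<phi> u ** X u) \<bullet> \<phi> v = (X u ** \<phi> v ** X u) \<bullet> \<phi> u"
    proof -
      have "(X u ** \<phi> u ** X u) \<bullet> \<phi> v = (X u ** \<phi> u) \<bullet> (\<phi> v ** X u)"
        by (subst inner_mult_right) (simp add: X_sym[OF uT])
      also have "\<dots> = \<phi> u \<bullet> (X u ** \<phi> v ** X u)"
        by (subst inner_mult_left) (simp add: X_sym[OF uT] matrix_mul_assoc)
      finally show ?thesis by (simp add: inner_commute)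
    qed
    also have "(X v ** \<phi> v ** X v) \<bullet> \<phi> u - (X u ** \<phi> v ** X u) \<bullet> \<phi> u
       = ((X v - X u) ** \<phi> v ** X v + X u ** \<phi> v ** (X v - X u)) \<bullet> \<phi> u"
      by (simp add: mm_simps inner_diff_left inner_add_left)
    finally have "(1 / (v - u)) * (((xi2 \<beta> (\<Phi> v) - xi2 \<beta> (\<Phi> u)) \<odot> \<phi> v) \<bullet> \<phi> u)
       = (1 / (v - u)) * (((X v - X u) ** \<phi> v ** X v + X u ** \<phi> v ** (X v - X u)) \<bullet> \<phi> u)" by (rule arg_cong)
    moreover have "(c *\<^sub>R A) \<odot> B = c *\<^sub>R (A \<odot> B)" for c and A B :: "real^'m^'m"
      by (simp add: hadamard_def vec_eq_iff)
    ultimately show ?thesis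
      unfolding r_def q_def by (simp add: mm.scaleR_left mm.scaleR_right inner_add_left distrib_left)
  qed
  have "((\<lambda>v. (r v \<odot> \<phi> v) \<bullet> \<phi> u) \<longlongrightarrow> ((xi3 \<beta> (\<Phi> u) \<odot> \<phi> u) \<odot> \<phi> u) \<bullet> \<phi> u) F"
    by (intro tendsto_intros bounded_bilinear.tendsto[OF bounded_bilinear_hadamard] r c)
  moreover have "\<forall>\<^sub>F v in F. (r v \<odot> \<phi> v) \<bullet> \<phi> u = (q v ** \<phi> v ** X v + X u ** \<phi> v ** q v) \<bullet> \<phi> u"
    unfolding F_def eventually_at_filter using eq by (intro always_eventually) auto
  ultimately have lim1: "((\<lambda>v. (q v ** \<phi> v ** X v + X u ** \<phi> v ** q v) \<bullet> \<phi> u) \<longlongrightarrow> ((xi3 \<beta> (\<Phi> u) \<odot> \<phi> u) \<odot> \<phi> u) \<bullet> \<phi> u) F"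
    by (rule Lim_transform_eventually)
  have lim2: "((\<lambda>v. (q v ** \<phi> v ** X v + X u ** \<phi> v ** q v) \<bullet> \<phi> u) \<longlongrightarrow> ((x u *\<^sub>R G u) ** \<phi> u ** X u + X u ** \<phi> u ** (x u *\<^sub>R G u)) \<bullet> \<phi> u) F"
    by (intro tendsto_intros mm.tendsto q c)
  have "((xi3 \<beta> (\<Phi> u) \<odot> \<phi> u) \<odot> \<phi> u) \<bullet> \<phi> u = xi3 \<beta> (\<Phi> u) \<bullet> (\<phi> u \<circ>^ 3)"
    by (simp add: inner_matrix hadamard_def hadamard_power_def power3_eq_cube mult_ac)
  moreover have "((x u *\<^sub>R G u) ** \<phi> u ** X u + X u ** \<phi> u ** (x u *\<^sub>R G u)) \<bullet> \<phi> u
     = 2 * x u * ((X u ** \<phi> u ** X u ** \<phi> u ** X u) \<bullet> \<phi> u)"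
  proof -
    have "(x u *\<^sub>R G u) ** \<phi> u ** X u = x u *\<^sub>R (X u ** \<phi> u ** X u ** \<phi> u ** X u)"
      "X u ** \<phi> u ** (x u *\<^sub>R G u) = x u *\<^sub>R (X u ** \<phi> u ** X u ** \<phi> u ** X u)"
      by (simp_all add: G_def mm_simps)
    then show ?thesis by (simp only: inner_add_left inner_scaleR_left)
  qed
  ultimately show ?thesis using tendsto_unique[OF nt lim1 lim2] by simp
qed

lemma order_parameter_formula:
  assumes u: "u \<in> {a<..<b}"
  shows "x u = (xi3 \<beta> (\<Phi> u) \<bullet> (\<phi> u \<circ>^ 3)) /
    (2 * trace (psd_powr (psd_powr (\<phi> u) (1/2) ** (xi2 \<beta> (\<Phi> u) \<odot> \<phi> u) ** psd_powr (\<phi> u) (1/2)) (3/2)))"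
proof -
  have uT: "u \<in> {0..T}" by (rule support_in_T[OF u])
  have uM: "u \<in> {0..M}" using uT T by auto
  define R where "R = psd_powr (\<phi> u) (1/2)"
  have R: "R \<in> psd" "R ** R = \<phi> u" "transpose R = R"
    using psd_sqrt[OF psd_\<phi>[OF uM]] psd_sym by (auto simp: R_def)
  define Y where "Y = R ** X u ** R"
  have Y: "Y \<in> psd" using psd_congruence[OF X_psd[OF uT], of R] by (simp add: Y_def R)
  have "R ** S u ** R = Y ** Y"
    by (simp add: S_eq_G[OF u] G_def Y_def R(2)[symmetric] matrix_mul_assoc)
  then have pw: "psd_powr (R ** S u ** R) (3/2) = Y ** Y ** Y" by (simp add: psd_powr_square[OF Y])
  have "trace (Y ** Y ** Y) = (X u ** \<phi> u ** X u ** \<phi> u ** X u) \<bullet> \<phi> u"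
  proof -
    have "Y ** Y ** Y = R ** (X u ** \<phi> u ** X u ** \<phi> u ** X u ** R)"
      by (simp add: Y_def R(2)[symmetric] matrix_mul_assoc)
    then have "trace (Y ** Y ** Y) = trace ((X u ** \<phi> u ** X u ** \<phi> u ** X u ** R) ** R)" by (metis trace_mul_sym)
    also have "\<dots> = trace (transpose (X u ** \<phi> u ** X u ** \<phi> u ** X u) ** \<phi> u)"
      using X_sym[OF uT] psd_sym[OF psd_\<phi>[OF uM]] R(2)
      by (simp add: matrix_transpose_mul flip: matrix_mul_assoc)
    finally show ?thesis by (simp add: inner_eq_trace)
  qed
  moreover have "0 < trace (Y ** Y ** Y)"
  proof (rule psd_trace_cube_pos[OF Y])
    show "Y \<noteq> 0"
    proof
      assume Y0: "Y = 0"
      obtain d where d: "0 < d" "pd d (X u)"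
      proof (rule psd_det_pd[OF X_psd[OF uT]])
        show "det (X u) \<noteq> 0" using X_hat(1)[OF uT] by (metis det_I det_mul mult_zero_left zero_neq_one)
      qed
      have "d * trace (\<phi> u) \<le> X u \<bullet> \<phi> u" by (rule pd_inner_ge_trace[OF d(2) psd_\<phi>[OF uM]])
      also have "X u \<bullet> \<phi> u = trace Y"
      proof -
        have "trace Y = trace (X u ** R ** R)" unfolding Y_def by (metis matrix_mul_assoc trace_mul_sym)
        then show ?thesis using R(2) X_sym[OF uT] by (simp add: inner_eq_trace flip: matrix_mul_assoc)
      qed
      finally show False using trace_\<phi>[OF u] d(1) Y0 by (simp add: trace_def)
    qed
  qed
  ultimately show ?thesis
    using third_order_identity[OF u] pw unfolding R_def[symmetric] S_def by simp
qed

end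

end

lemma continuous_on_det: "continuous_on S f \<Longrightarrow> continuous_on S (\<lambda>t. det (f t :: real^'n^'n))"
  unfolding det_def by (intro continuous_intros)

lemma minimizing_path_exists:
  fixes \<Phi> :: "real \<Rightarrow> real^'m^'m"
  assumes "mixture \<beta>" "constraint_matrix Q" and min: "crisanti_sommers_minimizer \<beta> h Q x \<Phi>"
  obtains T c where "minimizing_path (real CARD('m)) \<beta> h Q x \<Phi> (path_deriv \<Phi>) T c"
proof -
  define M where "M = real CARD('m)"
  have M: "0 < M" by (simp add: M_def)
  have adm: "order_fun M x" "matrix_path x Q \<Phi>" "0 < det (Q - \<Phi> (order_top M x))"
    using min by (auto simp: crisanti_sommers_minimizer_def admissible_def M_def)
  have der: "(\<Phi> has_vector_derivative path_deriv \<Phi> t) (at t within {0..M})" if "t \<in> {0..M}" for t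
    using adm(2) that unfolding matrix_path_def path_deriv_def M_def[symmetric]
    by (simp add: vector_derivative_works[symmetric])
  have lip: "lip_on {0..M} (path_deriv \<Phi>)"
  proof -
    obtain L where L: "L-lipschitz_on {0..M} (path_deriv \<Phi>)"
      using adm(2) unfolding matrix_path_def M_def[symmetric] by auto
    obtain B where "\<And>t. t \<in> {0..M} \<Longrightarrow> norm (path_deriv \<Phi> t) \<le> B"
      using continuous_on_Icc_bounded[OF lipschitz_on_continuous_on[OF L]] by metis
    then show ?thesis
    proof (rule lip_onI)
      show "norm (path_deriv \<Phi> t - path_deriv \<Phi> s) \<le> L * (t - s)" if "s \<in> {0..M}" "t \<in> {0..M}" "s \<le> t" for s t
        using lipschitz_onD[OF L that(2,1)] that(3) by (simp add: dist_norm)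
    qed
  qed
  have incr: "\<Phi> t - \<Phi> s \<in> psd" if "0 \<le> s" "s \<le> t" "t \<le> M" for s t
    using adm(2) that unfolding matrix_path_def loewner_le_def M_def[symmetric] by auto
  have psd: "path_deriv \<Phi> t \<in> psd" if t: "t \<in> {0..M}" for t
  proof (rule Lim_in_closed_set[OF closed_psd _ _ has_vector_derivative_quotient[OF der[OF t]]])
    show "at t within {0..M} \<noteq> bot" using t M by (simp add: trivial_limit_within)
    show "\<forall>\<^sub>F v in at t within {0..M}. (1 / (v - t)) *\<^sub>R (\<Phi> v - \<Phi> t) \<in> psd"
      unfolding eventually_at_filter
    proof (intro always_eventually allI impI)
      fix v assume v: "v \<noteq> t" "v \<in> {0..M}"
      show "(1 / (v - t)) *\<^sub>R (\<Phi> v - \<Phi> t) \<in> psd"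
      proof (cases "t < v")
        case True
        then show ?thesis using incr[of t v] t v by (intro psd_scaleR) auto
      next
        case False
        have "(1 / (v - t)) *\<^sub>R (\<Phi> v - \<Phi> t) = (1 / (t - v)) *\<^sub>R (\<Phi> t - \<Phi> v)"
          by (metis (no_types, opaque_lifting) minus_diff_eq minus_divide_right scaleR_minus_left scaleR_minus_right)
        then show ?thesis using incr[of v t] t v False by (simp add: psd_scaleR)
      qed
    qed
  qed
  have ends: "\<Phi> 0 = 0" "\<Phi> M = Q" using adm(2) by (auto simp: matrix_path_def M_def)
  define t0 where "t0 = order_top M x"
  have t0: "0 \<le> t0" "t0 \<le> M"
  proof -
    have bdd: "bdd_below {t \<in> {0..M}. x t = 1}" by (rule bdd_belowI[of _ 0]) auto
    have mem: "M \<in> {t \<in> {0..M}. x t = 1}" using adm(1) M by (auto simp: order_fun_def)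
    show "t0 \<le> M" unfolding t0_def order_top_def by (rule cInf_lower[OF mem bdd])
    show "0 \<le> t0" unfolding t0_def order_top_def using mem by (intro cInf_greatest) auto
  qed
  have "t0 \<noteq> M"
  proof
    assume "t0 = M"
    then have "det (0 :: real^'m^'m) > 0" using adm(3) ends by (simp add: t0_def)
    moreover have "(0 :: real^'m^'m) = mat 0" by (simp add: mat_def vec_eq_iff)
    ultimately show False using det_0[where 'a = real and 'n = 'm] by simp
  qed
  then have t0M: "t0 < M" using t0 by simp
  have "continuous_on {0..M} \<Phi>"
    unfolding continuous_on_eq_continuous_within using der by (blast intro: has_vector_derivative_continuous)
  then have "continuous_on {0..M} (\<lambda>t. det (Q - \<Phi> t))" by (intro continuous_on_det continuous_intros)
  then have "((\<lambda>t. det (Q - \<Phi> t)) \<longlongrightarrow> det (Q - \<Phi> t0)) (at t0 within {0..M})"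
    using t0 by (auto simp: continuous_on_def)
  then have "((\<lambda>t. det (Q - \<Phi> t)) \<longlongrightarrow> det (Q - \<Phi> t0)) (at t0 within {t0..M})"
    by (rule tendsto_within_subset) (use t0 in auto)
  then have "\<forall>\<^sub>F t in at_right t0. 0 < det (Q - \<Phi> t)"
    using adm(3) t0M by (auto simp: at_within_Icc_at_right t0_def intro: order_tendstoD)
  moreover have "\<forall>\<^sub>F t in at_right t0. t \<in> {t0<..<M}" by (rule eventually_at_right_real[OF t0M])
  ultimately have "\<forall>\<^sub>F t in at_right t0. 0 < det (Q - \<Phi> t) \<and> t \<in> {t0<..<M}" by (rule eventually_conj)
  then obtain T where T: "0 < det (Q - \<Phi> T)" "t0 < T" "T < M"
    using eventually_happens'[OF trivial_limit_at_right_real] by auto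
  have "Q - \<Phi> T \<in> psd" using incr[of T M] T t0 ends by simp
  then obtain c where c: "0 < c" "pd c (Q - \<Phi> T)" using psd_det_pd T(1) by (metis less_irrefl)
  have "\<exists>t\<in>{0..<T}. x t = 1" using order_top_less_iff[OF adm(1), of T] T M by (simp add: t0_def)
  then have "minimizing_path M \<beta> h Q x \<Phi> (path_deriv \<Phi>) T c"
    using M_def assms adm ends der lip psd T c by unfold_locales auto
  then show ?thesis using that by (simp add: M_def)
qed

theorem proposition14:
  fixes \<beta> :: "nat \<Rightarrow> real^'m" and h :: "real^'m" and Q :: "real^'m^'m"
    and x :: "real \<Rightarrow> real" and \<Phi> :: "real \<Rightarrow> real^'m^'m" and a b :: real
  assumes "mixture \<beta>"
    and "constraint_matrix Q"
    and "crisanti_sommers_minimizer \<beta> h Q x \<Phi>"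
    and "0 \<le> a" and "a < b" and "b < real CARD('m)"
    and "{a<..<b} \<subseteq> measure_support (order_measure (real CARD('m)) x)"
  shows "\<forall>u\<in>{a<..<b}. measure (order_measure (real CARD('m)) x) {0..u} =
    (xi3 \<beta> (\<Phi> u) \<bullet> (path_deriv \<Phi> u) \<circ>^ 3) /
    (2 * trace (psd_powr
      (psd_powr (path_deriv \<Phi> u) (1/2) ** (xi2 \<beta> (\<Phi> u) \<odot> path_deriv \<Phi> u)
         ** psd_powr (path_deriv \<Phi> u) (1/2)) (3/2)))"
proof
  fix u assume u: "u \<in> {a<..<b}"
  obtain T c where "minimizing_path (real CARD('m)) \<beta> h Q x \<Phi> (path_deriv \<Phi>) T c"
    using minimizing_path_exists[OF assms(1-3)] .
  then interpret minimizing_path "real CARD('m)" \<beta> h Q x \<Phi> "path_deriv \<Phi>" T c .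
  have uM: "u \<in> {0..real CARD('m)}" using u assms(4,6) by auto
  have "measure (order_measure (real CARD('m)) x) {0..u} = x u"
    using emeasure_order_measure(1)[OF x uM] x_range[OF uM] by (simp add: measure_def)
  then show "measure (order_measure (real CARD('m)) x) {0..u} =
    (xi3 \<beta> (\<Phi> u) \<bullet> (path_deriv \<Phi> u) \<circ>^ 3) /
    (2 * trace (psd_powr
      (psd_powr (path_deriv \<Phi> u) (1/2) ** (xi2 \<beta> (\<Phi> u) \<odot> path_deriv \<Phi> u)
         ** psd_powr (path_deriv \<Phi> u) (1/2)) (3/2)))"
    using order_parameter_formula[OF assms(4-7) u] by simp
qed

end
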